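(* Let $X_1,X_2,\dots$ and the boundary sequence $(g_i)_{i\ge1}$ be as in the context, and let $k=k_n$ be integers with $1\le k_n<n$, $k_n\to\infty$ and $n-k_n\to\infty$ as $n\to\infty$. Suppose that $\lim_{n\to\infty}k_n/n$ exists and is $<1$. Then, as $n\to\infty$, $$\mathbb{P}\left(\tau_g>k\mid S_n=0\right)\sim\sqrt{\frac{2}{\pi}}\,L_g(k)\,\sqrt{\frac{n-k}{n}}\,k^{-1/2}.$$
   Context: Random walk: $X_1,X_2,\dots$ are independent, identically distributed real random variables with $\mathbb{E}X_i=0$, $\mathbb{E}X_i^2=1$; their law has a density $f$, and there exists $n_0$ such that the density $f_{n_0}$ of $S_{n_0}$ is (almost everywhere) bounded. Here $S_0=0$ and $S_m=\sum_{i=1}^m X_i$. Write $f_1=f$ and $f_m(t)=\int_{\mathbb{R}}f_{m-1}(u)f(t-u)\,du$ for $m\ge2$, the density of $S_m$ (continuous for all large $m$). Boundary: $(g_i)_{i\ge1}$ is a real sequence with $|g_i|=o(\sqrt{i})$ as $i\to\infty$, and $\tau_g=\min\{i\ge1:S_i\le g_i\}$. It is assumed that $\mathbb{P}(\tau_g>n)>0$ for all $n\ge1$. Function $L_g$: $L_g(n)=\mathbb{E}\left[(S_n-g_n)\mathbf{1}\{\tau_g>n\}\right]$. It is known that under these assumptions $L_g$ is positive and slowly varying and $\mathbb{P}(\tau_g>n)\sim\sqrt{2/\pi}\,L_g(n)/\sqrt{n}$ as $n\to\infty$. Conditioning on $S_n=0$ is understood through densities: for $n$ large, $\mathbb{P}(\tau_g>k\mid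 S_n=0)=\frac{1}{f_n(0)}\int_{g_k}^\infty f_{n-k}(-u)\,\mathbb{P}(S_k\in du,\ \tau_g>k)$. Notation: $a_n\sim b_n$ means $a_n/b_n\to1$ as $n\to\infty$. *)

theory Defs
  imports "HOL-Probability.Probability" "HOL-Library.Landau_Symbols" "HOL-Library.Extended_Nat"
begin

definition walk :: "(nat \<Rightarrow> 'a \<Rightarrow> real) \<Rightarrow> nat \<Rightarrow> 'a \<Rightarrow> real" where
  "walk X m \<omega> = (\<Sum>i=1..m. X i \<omega>)"

(* The infimum in enat of the empty set is infinity: the walk never hits the boundary. *)
definition hitting_time ::
    "(nat \<Rightarrow> 'a \<Rightarrow> real) \<Rightarrow> (nat \<Rightarrow> real) \<Rightarrow> 'a \<Rightarrow> enat" where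
  "hitting_time X g \<omega> = (INF i\<in>{i. 1 \<le> i \<and> walk X i \<omega> \<le> g i}. enat i)"

definition survival_event ::
    "'a measure \<Rightarrow> (nat \<Rightarrow> 'a \<Rightarrow> real) \<Rightarrow> (nat \<Rightarrow> real) \<Rightarrow> nat \<Rightarrow> 'a set" where
  "survival_event M X g n = {\<omega> \<in> space M. enat n < hitting_time X g \<omega>}"

definition L_fun ::
    "'a measure \<Rightarrow> (nat \<Rightarrow> 'a \<Rightarrow> real) \<Rightarrow> (nat \<Rightarrow> real) \<Rightarrow> nat \<Rightarrow> real" where
  "L_fun M X g n = (\<integral>\<omega>. (walk X n \<omega> - g n) * indicator (survival_event M X g n) \<omega> \<partial>M)"

(* The value at m = 0 is a dummy: the law of the empty sum has no density.  Where the
   convolution integral diverges, the Bochner integral returns 0; this happens only on a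
   Lebesgue null set, and nowhere once m exceeds an index with an a.e. bounded density. *)
fun walk_density :: "(real \<Rightarrow> real) \<Rightarrow> nat \<Rightarrow> real \<Rightarrow> real" where
  "walk_density f 0 = (\<lambda>t. 0)"
| "walk_density f (Suc 0) = f"
| "walk_density f (Suc (Suc m)) =
     (\<lambda>t. \<integral>u. walk_density f (Suc m) u * f (t - u) \<partial>lborel)"

(* The sub-probability measure B \<mapsto> P(S_k \<in> B, tau_g > k) on the real line. *)
definition killed_law ::
    "'a measure \<Rightarrow> (nat \<Rightarrow> 'a \<Rightarrow> real) \<Rightarrow> (nat \<Rightarrow> real) \<Rightarrow> nat \<Rightarrow> real measure" where
  "killed_law M X g k = distr (restrict_space M (survival_event M X g k)) borel (walk X k)"

(* P(tau_g > k | S_n = 0), conditioning being understood through the densities. *)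
definition bridge_survival_prob ::
    "'a measure \<Rightarrow> (nat \<Rightarrow> 'a \<Rightarrow> real) \<Rightarrow> (real \<Rightarrow> real) \<Rightarrow> (nat \<Rightarrow> real) \<Rightarrow> nat \<Rightarrow> nat \<Rightarrow> real"
  where
  "bridge_survival_prob M X f g n k =
     1 / walk_density f n 0 *
       (LINT u:{g k<..}|killed_law M X g k. walk_density f (n - k) (- u))"

end

theory Submission
  imports Defs
begin

text \<open>
  Below, \<open>K n F = E[F(S_n) 1{tau_g > n}]\<close>, \<open>q n\<close> is the survival probability and \<open>L\<close> is \<open>L_g\<close>.
  The uniform local limit theorem for the densities replaces \<open>f_(n-k)\<close> and \<open>f_n(0)\<close> by Gaussian values
  and reduces the claim to \<open>K n (exp (- a x^2 / n)) ~ sqrt (2 / pi) / (1 + 2 a) * L n / sqrt n\<close>.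

  A priori bounds: survival is an increasing event, so Harris' inequality gives
  \<open>L n >= c sqrt n * q n\<close>. Optional stopping, with overshoots of order \<open>o(sqrt n)\<close>, gives
  \<open>L n - L m = o(sqrt n) q m\<close>, so that \<open>L\<close> varies slowly, and \<open>K n (x^2) <= sum_(i<n) q i = O(sqrt n * L n)\<close>.

  Main step: let \<open>H\<close> be odd, bounded and Lipschitz, \<open>m = n div d\<close> and \<open>N = n - m\<close>. The free
  averages \<open>v_r(z) = E H((z + S_r) / sqrt N)\<close> are small for \<open>z = o(sqrt N)\<close> because \<open>H\<close> is odd, hence paths that are
  killed after time \<open>m\<close> contribute negligibly to \<open>K m v_N\<close>, which is therefore close to
  \<open>K n (H(x / sqrt N))\<close>. On the other hand
  \<open>v_N(x)\<close> is nearly a smooth odd function of \<open>x / sqrt N\<close>, so \<open>K m v_N\<close> is a constant times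
  \<open>L m / sqrt N\<close> up to \<open>O(K m (x^2) / N)\<close>, a relative error of order \<open>d^(-1/2)\<close>. Gaussian test functions,
  which do not vanish at the boundary, are reached through a bound on the mass near zero.
\<close>

section \<open>Fourier inversion and Gaussian smoothing\<close>

text \<open>Why odd test functions: at scale \<open>sqrt n\<close> the boundary is invisible, so the
  limit is Brownian motion killed at 0, and for an odd function the killed and the free expectation
  from a point of the half line coincide. The slope at 0 of the smoothed \<open>H\<close> is
  E[Y H(Y)] with Y standard normal; for odd \<open>H\<close> this is \<open>sqrt (2 / pi)\<close>
  times the mean of \<open>H\<close> under the density y exp(-y^2/2) on y > 0. So the Rayleigh law,
  the endpoint law of Brownian meander, appears without a functional limit theorem. The obstacle is
  that errors must be small relative to \<open>L n / sqrt n\<close>, which itself tends to 0.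
  Absolute errors are therefore always multiplied by a survival probability \<open>q m\<close>, and
  \<open>sqrt n * q m\<close> is at most a constant times \<open>L n\<close>. For
  \<open>m = n div d\<close> this constant grows with d. Hence d stays fixed while n tends to
  infinity, tolerances for errors vanishing with n are chosen after d, and the errors that do not
  vanish with n must carry constants independent of d.\<close>

lemma integrable_le:
  fixes f :: "'a \<Rightarrow> real" and g :: "'a \<Rightarrow> 'b::{banach,second_countable_topology}"
  assumes "integrable M f" "g \<in> borel_measurable M" "\<And>x. norm (g x) \<le> f x"
  shows "integrable M g"
proof (rule Bochner_Integration.integrable_bound[OF assms(1,2)])
  show "AE x in M. norm (g x) \<le> norm (f x)"
    using assms(3) by (intro AE_I2) (auto intro: order_trans[OF _ abs_ge_self])
qed

section \<open>Inverse Fourier transforms and recovery of a density\<close>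

definition inv_fourier :: "(real \<Rightarrow> complex) \<Rightarrow> real \<Rightarrow> complex" where
  "inv_fourier \<phi> x = (1 / (2 * pi)) * (\<integral>t. iexp (-(t * x)) * \<phi> t \<partial>lborel)"

lemma integrable_inv_fourier:
  assumes "integrable lborel \<phi>"
  shows "integrable lborel (\<lambda>t. iexp (-(t * x)) * \<phi> t)"
  using assms by (rule Bochner_Integration.integrable_bound)
     (use assms in \<open>auto simp: norm_mult intro!: AE_I2\<close>)

lemma continuous_inv_fourier:
  assumes "integrable lborel \<phi>"
  shows "isCont (inv_fourier \<phi>) x"
  unfolding continuous_at_sequentially
proof safe
  fix X assume X: "X \<longlonglongrightarrow> x"
  have m: "\<phi> \<in> borel_measurable lborel" using assms by auto
  have "(\<lambda>i. \<integral>t. iexp (-(t * X i)) * \<phi> t \<partial>lborel) \<longlonglongrightarrow> (\<integral>t. iexp (-(t * x)) * \<phi> t \<partial>lborel)"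
  proof (rule integral_dominated_convergence[where w="\<lambda>t. norm (\<phi> t)"])
    show "AE t in lborel. (\<lambda>i. iexp (-(t * X i)) * \<phi> t) \<longlonglongrightarrow> iexp (-(t * x)) * \<phi> t"
      using X by (intro AE_I2 tendsto_intros)
  qed (use assms m in \<open>auto simp: norm_mult\<close>)
  then show "(inv_fourier \<phi> \<circ> X) \<longlonglongrightarrow> inv_fourier \<phi> x"
    unfolding inv_fourier_def comp_def by (intro tendsto_intros)
qed

lemma fourier_interval:
  assumes "a \<le> b" "t \<noteq> 0"
  shows "(\<integral>x. indicator {a..b} x *\<^sub>R iexp (-(t * x)) \<partial>lborel)
    = (iexp (-(t * a)) - iexp (-(t * b))) / (\<i> * t)"
proof -
  have "(\<integral>x. indicator {a..b} x *\<^sub>R iexp (-(t * x)) \<partial>lborel) =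
     (\<i>/t) * iexp (-(t * b)) - (\<i>/t) * iexp (-(t * a))"
    using assms
    by (intro integral_FTC_atLeastAtMost)
      (auto intro!: derivative_eq_intros continuous_intros simp: has_vector_derivative_complex_iff
         Re_exp Im_exp)
  also have "\<dots> = (iexp (-(t * a)) - iexp (-(t * b))) / (\<i> * t)"
    using assms by (simp add: field_simps)
  finally show ?thesis .
qed

text \<open>Levy's kernel is at most \<open>b - a\<close> in modulus, so for integrable
  \<open>char M\<close> the truncated integrals converge to an absolutely convergent one. Rewriting
  the kernel as an integral over \<open>{a..b}\<close> and applying Fubini exhibits
  \<open>inv_fourier\<close> as a density. Levy's formula requires end points without mass.\<close>

lemma (in real_distribution) char_inversion_interval:
  assumes int: "integrable lborel (char M)" and ab: "a < b"
    and atoms: "measure M {a} = 0" "measure M {b} = 0"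
  shows "measure M {a<..b} = (\<integral>x. indicator {a..b} x * Re (inv_fourier (char M) x) \<partial>lborel)"
proof -
  define F where "F t = (iexp (-(t * a)) - iexp (-(t * b))) / (\<i> * t) * char M t" for t :: real
  have [measurable]: "char M \<in> borel_measurable borel" by simp
  have F_meas[measurable]: "F \<in> borel_measurable borel" unfolding F_def by measurable
  have F_bd: "norm (F t) \<le> (b - a) * norm (char M t)" if "t \<noteq> 0" for t
  proof -
    have "norm (F t) = norm ((iexp (t * -a) - iexp (t * -b)) / (\<i> * t)) * norm (char M t)"
      by (simp only: F_def norm_mult mult_minus_right)
    also have "\<dots> \<le> (b - a) * norm (char M t)"
      using Levy_Inversion_aux2[of "-b" "-a" t] that ab by (intro mult_right_mono) auto
    finally show ?thesis .
  qed
  have F_bd': "AE t in lborel. norm (F t) \<le> (b - a) * norm (char M t)"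
    by (intro AE_I[where N="{0}"]) (use F_bd in auto)
  have intF: "integrable lborel F"
    by (rule Bochner_Integration.integrable_bound[where f="\<lambda>t. (b - a) * norm (char M t)"])
      (use int F_bd' ab in auto)
  have "(\<lambda>T. 1 / (2 * pi) * (CLBINT t=-real T..real T. F t)) \<longlonglongrightarrow> complex_of_real (measure M {a<..b})"
    unfolding F_def using Levy_Inversion[of a b] ab atoms by simp
  moreover have "(\<lambda>T. CLBINT t=-real T..real T. F t) \<longlonglongrightarrow> (\<integral>t. F t \<partial>lborel)"
  proof -
    have "(\<lambda>T. \<integral>t. indicator {-real T..real T} t *\<^sub>R F t \<partial>lborel) \<longlonglongrightarrow> (\<integral>t. F t \<partial>lborel)"
    proof (rule integral_dominated_convergence[where w="\<lambda>t. norm (F t)"])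
      show "AE t in lborel. (\<lambda>i. indicator {- real i..real i} t *\<^sub>R F t) \<longlonglongrightarrow> F t"
      proof (intro AE_I2 tendsto_eventually)
        fix t :: real
        show "\<forall>\<^sub>F i in sequentially. indicator {- real i..real i} t *\<^sub>R F t = F t"
          using eventually_ge_at_top[of "nat \<lceil>\<bar>t\<bar>\<rceil>"]
          by eventually_elim (auto simp: indicator_def)
      qed
    qed (use intF in \<open>auto simp: indicator_def\<close>)
    then show ?thesis
      by (simp add: interval_integral_Icc set_lebesgue_integral_def)
  qed
  ultimately have lim: "complex_of_real (measure M {a<..b}) = 1 / (2 * pi) * (\<integral>t. F t \<partial>lborel)"
    by (intro LIMSEQ_unique) (auto intro!: tendsto_intros)
  define G where "G p = (case p of (t, x) \<Rightarrow> indicator {a..b} x *\<^sub>R (iexp (-(t * x)) * char M t))"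
    for p :: "real \<times> real"
  have [measurable]: "G \<in> borel_measurable (lborel \<Otimes>\<^sub>M lborel)"
    unfolding G_def by measurable
  have intG: "integrable (lborel \<Otimes>\<^sub>M lborel) G"
  proof (rule lborel_pair.Fubini_integrable)
    show "integrable lborel (\<lambda>x. \<integral>y. norm (G (x, y)) \<partial>lborel)"
      using int ab by (auto simp: G_def norm_mult)
    show "AE x in lborel. integrable lborel (\<lambda>y. G (x, y))"
    proof (intro AE_I2)
      fix t :: real
      have "integrable lborel (\<lambda>y. indicator {a..b} y *\<^sub>R (iexp (-(t * y)) * char M t))"
      proof (rule Bochner_Integration.integrable_bound)
        show "integrable lborel (\<lambda>y. indicator {a..b} y *\<^sub>R norm (char M t))"
          using ab by auto
      qed (auto simp: norm_mult split: split_indicator)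
      then show "integrable lborel (\<lambda>y. G (t, y))" by (simp add: G_def)
    qed
  qed simp
  have "(\<integral>t. F t \<partial>lborel) = (\<integral>t. (\<integral>x. G (t, x) \<partial>lborel) \<partial>lborel)"
  proof (rule integral_cong_AE)
    \<comment> \<open>At \<open>t = 0\<close> the quotient in \<open>F\<close> is 0 by the division
      convention, while the inner integral is \<open>b - a\<close>; the identity therefore holds
      only off a null set.\<close>
    show "AE t in lborel. F t = (\<integral>x. G (t, x) \<partial>lborel)"
    proof (rule AE_I[where N="{0}"])
      have "F t = (\<integral>x. G (t, x) \<partial>lborel)" if "t \<noteq> 0" for t
      proof -
        have "(\<integral>x. G (t, x) \<partial>lborel) = (\<integral>x. (indicator {a..b} x *\<^sub>R iexp (-(t * x))) * char M t \<partial>lborel)"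
          by (simp add: G_def)
        also have "\<dots> = (\<integral>x. indicator {a..b} x *\<^sub>R iexp (-(t * x)) \<partial>lborel) * char M t"
          by (rule integral_mult_left_zero)
        finally show ?thesis unfolding F_def using fourier_interval[of a b t] ab that by simp
      qed
      then show "{t \<in> space lborel. F t \<noteq> (\<integral>x. G (t, x) \<partial>lborel)} \<subseteq> {0}" by auto
    qed auto
  qed auto
  also have "\<dots> = (\<integral>x. (\<integral>t. G (t, x) \<partial>lborel) \<partial>lborel)"
    using lborel_pair.Fubini_integral[of "\<lambda>t x. G (t, x)"] intG by simp
  also have "\<dots> = (\<integral>x. (2 * pi) * (indicator {a..b} x *\<^sub>R inv_fourier (char M) x) \<partial>lborel)"
    by (intro Bochner_Integration.integral_cong) (auto simp: G_def inv_fourier_def)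
  also have "\<dots> = (2 * pi) * (\<integral>x. indicator {a..b} x *\<^sub>R inv_fourier (char M) x \<partial>lborel)"
    by (rule integral_mult_right_zero)
  finally have eq: "complex_of_real (measure M {a<..b}) = (\<integral>x. indicator {a..b} x *\<^sub>R inv_fourier (char M) x \<partial>lborel)"
    unfolding lim by simp
  have "integrable lborel (\<lambda>x. indicator {a..b} x *\<^sub>R inv_fourier (char M) x)"
    by (rule borel_integrable_compact)
      (auto intro!: continuous_at_imp_continuous_on continuous_inv_fourier int)
  from integral_Re[OF this] eq[symmetric] show ?thesis
    by (simp only: Re_complex_of_real scaleR_complex.sel(1))
qed

text \<open>Inversion fixes the measure of half-open intervals, an intersection-stable generator,
  and densities of the same measure agree almost everywhere. More than an a.e. statement cannot be
  expected, since \<open>h\<close> is determined only up to null sets.\<close>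

lemma (in real_distribution) char_inversion_density:
  assumes int: "integrable lborel (char M)" and h: "M = density lborel (\<lambda>x. ennreal (h x))"
    and [measurable]: "h \<in> borel_measurable borel" and hpos: "\<And>x. 0 \<le> h x"
  shows "AE x in lborel. h x = Re (inv_fourier (char M) x)"
proof -
  define G where "G x = Re (inv_fourier (char M) x)" for x
  have contG: "isCont G x" for x unfolding G_def
    by (intro isCont_Re continuous_inv_fourier int)
  have [measurable]: "G \<in> borel_measurable borel"
    by (auto intro!: borel_measurable_continuous_onI continuous_at_imp_continuous_on contG)
  have atoms: "measure M {a} = 0" for a
  proof -
    have "{a} \<in> null_sets (density lborel (\<lambda>x. ennreal (h x)))"
      by (rule absolutely_continuousI_density[unfolded absolutely_continuous_def, THEN subsetD])
         (auto simp: null_sets_def)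
    then have "{a} \<in> null_sets M" by (simp only: h)
    from null_setsD1[OF this] show ?thesis unfolding measure_def by (simp only: enn2real_0)
  qed
  have inv: "measure M {a<..b} = (\<integral>x. indicator {a..b} x * G x \<partial>lborel)" if "a < b" for a b
    unfolding G_def by (intro char_inversion_interval int that atoms)
  \<comment> \<open>\<open>ennreal\<close> truncates negative values, so the density built from
    \<open>G\<close> reproduces the interval integrals only once \<open>G\<close> is known to be
    nonnegative. A negative value would spread to an interval by continuity and give it negative
    measure.\<close>
  have Gpos: "0 \<le> G x" for x
  proof (rule ccontr)
    assume "\<not> 0 \<le> G x"
    then have "G x < G x / 2" by simp
    have "\<forall>\<^sub>F y in nhds x. G y < G x / 2"
      using contG[of x] \<open>G x < G x / 2\<close> unfolding continuous_at
    by (metis order_tendstoD(2) tendsto_at_iff_tendsto_nhds)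
    then obtain e where e: "e > 0" "\<And>y. dist y x < e \<Longrightarrow> G y < G x / 2"
      unfolding eventually_nhds_metric by auto
    let ?a = "x - e/2" and ?b = "x + e/2"
    have "(\<integral>y. indicator {?a..?b} y * G y \<partial>lborel) \<le> (\<integral>y. indicator {?a..?b} y * (G x / 2) \<partial>lborel)"
    proof (rule integral_mono)
      show "integrable lborel (\<lambda>y. indicator {?a..?b} y * G y)"
        using borel_integrable_compact[of "{?a..?b}" G] contG
        by (auto intro!: continuous_at_imp_continuous_on)
      show "indicator {?a..?b} y * G y \<le> indicator {?a..?b} y * (G x / 2)" for y
      proof (cases "y \<in> {?a..?b}")
        case True
        then have "dist y x < e" using e(1) by (auto simp: dist_real_def abs_less_iff)
        then show ?thesis using e(2)[of y] by (simp add: indicator_def)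
      qed simp
    qed (use e in auto)
    also have "\<dots> = e * (G x / 2)" using e(1) by simp
    also have "\<dots> < 0" using e(1) \<open>\<not> 0 \<le> G x\<close> by (simp add: mult_pos_neg)
    finally show False using inv[of ?a ?b] e(1) measure_nonneg[of M "{?a<..?b}"] by simp
  qed
  have "density lborel (\<lambda>x. ennreal (h x)) = density lborel (\<lambda>x. ennreal (G x))"
  proof (rule measure_eqI_generator_eq_countable[where E="range (\<lambda>(a::real,b). {a<..b})" and \<Omega>=UNIV and A="range (\<lambda>n::nat. {- real n<..real n})"])
    show "Int_stable (range (\<lambda>(a::real,b). {a<..b}))" 
      by (auto simp: Int_stable_def)
    show "emeasure (density lborel (\<lambda>x. ennreal (h x))) Y = emeasure (density lborel (\<lambda>x. ennreal (G x))) Y"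
      if "Y \<in> range (\<lambda>(a::real,b). {a<..b})" for Y
    proof -
      from that obtain a b where Y: "Y = {a<..b}" by auto
      show ?thesis
      proof (cases "a < b")
        case True
        have "emeasure (density lborel (\<lambda>x. ennreal (G x))) Y = (\<integral>\<^sup>+x. ennreal (indicator {a..b} x * G x) \<partial>lborel)"
          unfolding Y by (subst emeasure_density, simp, simp, intro nn_integral_cong_AE AE_I[where N="{a}"])
            (auto simp: indicator_def)
        also have "\<dots> = ennreal (\<integral>x. indicator {a..b} x * G x \<partial>lborel)"
          using borel_integrable_compact[of "{a..b}" G] contG Gpos
          by (intro nn_integral_eq_integral) (auto intro!: continuous_at_imp_continuous_on)
        also have "\<dots> = emeasure M Y" using inv[OF True] Y by (simp add: emeasure_eq_measure)
        finally show ?thesis unfolding h by simp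
      qed (simp add: Y)
    qed
    show "sets (density lborel (\<lambda>x. ennreal (h x))) = sigma_sets UNIV (range (\<lambda>(a::real, b). {a<..b}))"
      by (simp add: borel_sigma_sets_Ioc)
    show "sets (density lborel (\<lambda>x. ennreal (G x))) = sigma_sets UNIV (range (\<lambda>(a::real, b). {a<..b}))"
      by (simp add: borel_sigma_sets_Ioc)
    show "\<Union> (range (\<lambda>n. {- real n<..real n})) = UNIV"
    proof -
      have "\<exists>n. x \<in> {- real n<..real n}" for x using reals_Archimedean2[of "\<bar>x\<bar>"]
        by (auto intro!: exI[of _ "nat \<lceil>\<bar>x\<bar>+1\<rceil>"] simp: abs_le_iff) linarith+
      then show ?thesis by blast
    qed
    show "emeasure (density lborel (\<lambda>x. ennreal (h x))) a \<noteq> \<infinity>" if "a \<in> range (\<lambda>n. {- real n<..real n})" for a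
      unfolding h[symmetric] by simp
  qed (auto)
  then have "AE x in lborel. ennreal (h x) = ennreal (G x)"
    by (intro sigma_finite_measure.density_unique[OF lborel.sigma_finite_measure_axioms]) auto
  then show ?thesis unfolding G_def[symmetric] using hpos Gpos by (auto elim!: eventually_mono)
qed

text \<open>Fubini, dominated by \<open>norm (w t)\<close> because \<open>iexp\<close> has modulus
  1. It moves the Fourier transform from the law to the weight, where it can be computed.\<close>

lemma (in real_distribution) char_parseval:
  assumes w: "integrable lborel w"
  shows "(\<integral>t. char M t * w t \<partial>lborel) = (\<integral>x. (\<integral>t. iexp (t * x) * w t \<partial>lborel) \<partial>M)"
proof -
  interpret P: pair_sigma_finite lborel M ..
  have [measurable]: "w \<in> borel_measurable borel" using w by auto
  have [measurable_cong]: "sets M = sets borel" by simp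
  define G where "G p = (case p of (t, x) \<Rightarrow> iexp (t * x) * w t)" for p :: "real \<times> real"
  have [measurable]: "G \<in> borel_measurable (lborel \<Otimes>\<^sub>M M)"
    unfolding G_def by measurable
  have intG: "integrable (lborel \<Otimes>\<^sub>M M) G"
  proof (rule P.Fubini_integrable)
    show "integrable lborel (\<lambda>x. \<integral>y. norm (G (x, y)) \<partial>M)"
      using w prob_space by (simp add: G_def norm_mult)
    show "AE x in lborel. integrable M (\<lambda>y. G (x, y))"
      by (intro AE_I2 integrable_const_bound[where B="norm (w t)" for t])
        (auto simp: G_def norm_mult)
  qed simp
  have "(\<integral>t. char M t * w t \<partial>lborel) = (\<integral>t. (\<integral>x. G (t, x) \<partial>M) \<partial>lborel)"
    by (simp add: G_def char_def)
  also have "\<dots> = (\<integral>x. (\<integral>t. G (t, x) \<partial>lborel) \<partial>M)"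
    using P.Fubini_integral[of "\<lambda>t x. G (t, x)"] intG by simp
  finally show ?thesis by (simp add: G_def)
qed

section \<open>Gaussian regularisation and square integrability of the characteristic
  function\<close>

lemma integrable_gaussian:
  assumes "s > 0"
  shows "integrable lborel (\<lambda>t::real. exp (- (s * t)\<^sup>2 / 2))"
proof -
  have "integrable lborel (\<lambda>t. sqrt (2 * pi) * std_normal_density t)" by simp
  then have "integrable lborel (\<lambda>t. exp (- t\<^sup>2 / 2) :: real)" by (simp add: std_normal_density_def)
  from lborel_integrable_real_affine[OF this, of s 0] show ?thesis using assms by simp
qed

lemma fourier_gaussian:
  assumes s: "s > 0"
  shows "(\<integral>t. iexp (t * u) * complex_of_real (exp (- (s * t)\<^sup>2 / 2)) \<partial>lborel) =
    complex_of_real (2 * pi * normal_density 0 s u)"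
proof -
  have *: "complex_of_real (exp (- (u/s)\<^sup>2 / 2)) = char std_normal_distribution (u / s)"
    by (simp add: char_std_normal_distribution)
  also have "\<dots> = (\<integral>t. std_normal_density t *\<^sub>R iexp (u / s * t) \<partial>lborel)"
    unfolding char_def by (subst integral_density) auto
  also have "\<dots> = \<bar>s\<bar> *\<^sub>R (\<integral>t. std_normal_density (0 + s * t) *\<^sub>R iexp (u / s * (0 + s * t)) \<partial>lborel)"
    by (rule lborel_integral_real_affine) (use s in auto)
  also have "\<dots> = s *\<^sub>R (\<integral>t. (1 / sqrt (2 * pi)) *\<^sub>R (iexp (t * u) * complex_of_real (exp (- (s * t)\<^sup>2 / 2))) \<partial>lborel)"
  proof -
    have a: "u / s * (0 + s * t) = t * u" for t using s by simp
    show ?thesis using s unfolding a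
      by (simp add: std_normal_density_def scaleR_conv_of_real mult_ac)
  qed
  also have "\<dots> = (s / sqrt (2 * pi)) *\<^sub>R (\<integral>t. (iexp (t * u) * complex_of_real (exp (- (s * t)\<^sup>2 / 2))) \<partial>lborel)"
    by simp
  finally have e: "complex_of_real (exp (- (u/s)\<^sup>2 / 2)) = (s / sqrt (2 * pi)) *\<^sub>R (\<integral>t. (iexp (t * u) * complex_of_real (exp (- (s * t)\<^sup>2 / 2))) \<partial>lborel)" .
  have "(\<integral>t. (iexp (t * u) * complex_of_real (exp (- (s * t)\<^sup>2 / 2))) \<partial>lborel) =
     (sqrt (2 * pi) / s) *\<^sub>R complex_of_real (exp (- (u/s)\<^sup>2 / 2))"
    unfolding e using s by simp
  also have "\<dots> = complex_of_real (sqrt (2 * pi) / s * exp (- (u/s)\<^sup>2 / 2))" by (simp add: scaleR_conv_of_real)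
  also have "sqrt (2 * pi) / s * exp (- (u/s)\<^sup>2 / 2) = 2 * pi * normal_density 0 s u"
  proof -
    have "sqrt (2 * pi * s\<^sup>2) = sqrt (2 * pi) * s" using s by (simp add: real_sqrt_mult)
    moreover have "2 * pi / sqrt (2 * pi) = sqrt (2 * pi)" by (rule real_div_sqrt) simp
    ultimately show ?thesis using s unfolding normal_density_def
      by (simp add: power_divide field_simps)
  qed
  finally show ?thesis .
qed

text \<open>Plancherel with a Gaussian regulariser: the square is
  \<open>char M t * cnj (char M t)\<close>, and two uses of \<open>char_parseval\<close> leave the
  \<open>M\<close>-mean of the density smoothed at width \<open>s\<close>. Smoothing preserves the
  bound \<open>C\<close>, so the estimate is uniform in \<open>s\<close>.\<close>

lemma (in real_distribution) gaussian_weighted_char_square_le: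
  assumes h: "M = density lborel (\<lambda>x. ennreal (h x))"
    and [measurable]: "h \<in> borel_measurable borel" and hpos: "\<And>x. 0 \<le> h x"
    and bd: "AE x in lborel. h x \<le> C" and s: "s > 0"
  shows "(\<integral>t. (norm (char M t))\<^sup>2 * exp (- (s * t)\<^sup>2 / 2) \<partial>lborel) \<le> 2 * pi * C"
proof -
  define w where "w t = complex_of_real (exp (- (s * t)\<^sup>2 / 2))" for t
  have w: "integrable lborel w" unfolding w_def using integrable_gaussian[OF s] by (rule integrable_of_real)
  have [measurable]: "char M \<in> borel_measurable borel" "w \<in> borel_measurable borel"
    using w by auto
  have [measurable]: "cnj \<in> borel_measurable borel"
    by (intro borel_measurable_continuous_onI continuous_intros)
  have w1: "integrable lborel (\<lambda>t. cnj (char M t) * w t)"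
  proof (rule Bochner_Integration.integrable_bound[OF w])
    show "AE t in lborel. norm (cnj (char M t) * w t) \<le> norm (w t)"
      using cmod_char_le_1 by (intro AE_I2) (auto simp: norm_mult intro!: mult_left_le_one_le)
  qed simp
  have w2: "integrable lborel (\<lambda>t. iexp (- (t * x)) * w t)" for x
    by (rule integrable_inv_fourier[OF w])
  have cnjw: "cnj (w t) = w t" for t by (simp add: w_def)
  have cnji: "cnj (iexp a) = iexp (- a)" for a :: real
    by (simp add: exp_cnj)
  define N where "N x = (\<integral>y. normal_density 0 s (y - x) \<partial>M)" for x
  have inner: "(\<integral>t. iexp (t * x) * (cnj (char M t) * w t) \<partial>lborel) = complex_of_real (2 * pi * N x)" for x
  proof -
    have "(\<integral>t. iexp (t * x) * (cnj (char M t) * w t) \<partial>lborel) =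
        (\<integral>t. cnj (char M t * (iexp (- (t * x)) * w t)) \<partial>lborel)"
      by (intro Bochner_Integration.integral_cong[OF refl])
        (simp only: complex_cnj_mult cnjw cnji minus_minus mult.left_commute)
    also have "\<dots> = cnj (\<integral>t. char M t * (iexp (- (t * x)) * w t) \<partial>lborel)"
      by (rule Bochner_Integration.integral_cnj)
    also have "\<dots> = cnj (\<integral>y. (\<integral>t. iexp (t * y) * (iexp (- (t * x)) * w t) \<partial>lborel) \<partial>M)"
      using char_parseval[OF w2[of x]] by simp
    also have "(\<lambda>y. \<integral>t. iexp (t * y) * (iexp (- (t * x)) * w t) \<partial>lborel) = (\<lambda>y. \<integral>t. iexp (t * (y - x)) * w t \<partial>lborel)"
    proof (intro ext Bochner_Integration.integral_cong refl)
      fix y t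
      have "t * (y - x) = t * y + - (t * x)" by (simp add: algebra_simps)
      then have "iexp (t * (y - x)) = iexp (t * y) * iexp (- (t * x))"
        by (metis exp_add of_real_add distrib_left)
      then show "iexp (t * y) * (iexp (- (t * x)) * w t) = iexp (t * (y - x)) * w t"
        by (simp only: mult.assoc)
    qed
    also have "\<dots> = (\<lambda>y. complex_of_real (2 * pi * normal_density 0 s (y - x)))"
      unfolding w_def by (rule ext) (rule fourier_gaussian[OF s])
    also have "cnj (\<integral>y. complex_of_real (2 * pi * normal_density 0 s (y - x)) \<partial>M) = complex_of_real (2 * pi * N x)"
      unfolding N_def by (subst integral_complex_of_real) simp
    finally show ?thesis .
  qed
  have NC: "N x \<le> C" for x
  proof -
    have shift: "normal_density 0 s (y - x) = normal_density x s y" for y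
      by (simp add: normal_density_def)
    have int: "integrable lborel (\<lambda>y. normal_density 0 s (y - x))"
      unfolding shift using s by (rule integrable_normal_density)
    have "N x = (\<integral>y. h y * normal_density 0 s (y - x) \<partial>lborel)"
      unfolding N_def h by (subst integral_density) (auto simp: hpos)
    also have "\<dots> \<le> (\<integral>y. C * normal_density 0 s (y - x) \<partial>lborel)"
    proof (rule integral_mono_AE)
      show "integrable lborel (\<lambda>y. h y * normal_density 0 s (y - x))"
        by (rule Bochner_Integration.integrable_bound[where f="\<lambda>y. C * normal_density 0 s (y - x)"])
          (use int bd hpos in \<open>auto simp: abs_mult elim!: eventually_mono intro!: mult_right_mono order_trans[OF _ abs_ge_self]\<close>)
      show "AE y in lborel. h y * normal_density 0 s (y - x) \<le> C * normal_density 0 s (y - x)"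
        using bd by (auto elim!: eventually_mono intro!: mult_right_mono)
    qed (use int in auto)
    also have "(\<integral>y. C * normal_density 0 s (y - x) \<partial>lborel) = C"
      unfolding shift using s by simp
    finally show ?thesis .
  qed
  have "complex_of_real (\<integral>t. (norm (char M t))\<^sup>2 * exp (- (s * t)\<^sup>2 / 2) \<partial>lborel) =
      (\<integral>t. complex_of_real ((norm (char M t))\<^sup>2 * exp (- (s * t)\<^sup>2 / 2)) \<partial>lborel)"
    by (rule integral_complex_of_real[symmetric])
  also have "\<dots> = (\<integral>t. char M t * (cnj (char M t) * w t) \<partial>lborel)"
    by (intro Bochner_Integration.integral_cong[OF refl]) (simp only: of_real_mult complex_norm_square w_def mult.assoc)
  also have "\<dots> = (\<integral>x. complex_of_real (2 * pi * N x) \<partial>M)"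
    unfolding char_parseval[OF w1] inner ..
  also have "\<dots> = complex_of_real (\<integral>x. 2 * pi * N x \<partial>M)" by (rule integral_complex_of_real)
  finally have "(\<integral>t. (norm (char M t))\<^sup>2 * exp (- (s * t)\<^sup>2 / 2) \<partial>lborel) = (\<integral>x. 2 * pi * N x \<partial>M)"
    by (simp only: of_real_eq_iff)
  also have "\<dots> \<le> 2 * pi * C"
  proof (rule integral_le_const)
    have N0: "0 \<le> N x" for x unfolding N_def by (intro Bochner_Integration.integral_nonneg) auto
    have [measurable]: "N \<in> borel_measurable borel"
      unfolding N_def by (intro borel_measurable_lebesgue_integral) measurable
    show "integrable M (\<lambda>x. 2 * pi * N x)"
      by (rule integrable_const_bound[where B="2 * pi * C"]) (use NC N0 in \<open>auto simp: abs_mult\<close>)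
    show "AE x in M. 2 * pi * N x \<le> 2 * pi * C" using NC by auto
  qed
  finally show ?thesis .
qed

text \<open>Letting the width tend to 0 removes the regulariser by Fatou's lemma. Here the
  boundedness of a density is converted into integrability on the Fourier side.\<close>

lemma (in real_distribution) char_square_integrable:
  assumes h: "M = density lborel (\<lambda>x. ennreal (h x))"
    and [measurable]: "h \<in> borel_measurable borel" and hpos: "\<And>x. 0 \<le> h x"
    and bd: "AE x in lborel. h x \<le> C"
  shows "integrable lborel (\<lambda>t. (norm (char M t))\<^sup>2)"
proof (rule integrableI_bounded)
  have [measurable]: "char M \<in> borel_measurable borel" by simp
  show "(\<lambda>t. (norm (char M t))\<^sup>2) \<in> borel_measurable lborel" by measurable
  define G where "G n t = (norm (char M t))\<^sup>2 * exp (- (1 / real (Suc n) * t)\<^sup>2 / 2)" for n t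
  have lim: "(\<lambda>n. ennreal (G n t)) \<longlonglongrightarrow> ennreal ((norm (char M t))\<^sup>2)" for t
  proof -
    have "(\<lambda>n. (norm (char M t))\<^sup>2 * exp (- (1 / real (Suc n) * t)\<^sup>2 / 2)) \<longlonglongrightarrow> (norm (char M t))\<^sup>2 * exp (- (0 * t)\<^sup>2 / 2)"
      using LIMSEQ_Suc[OF lim_1_over_n[where 'a=real]] by (intro tendsto_intros) auto
    then show ?thesis unfolding G_def by (intro tendsto_ennrealI) simp
  qed
  have le: "(\<integral>\<^sup>+t. ennreal (G n t) \<partial>lborel) \<le> ennreal (2 * pi * C)" for n
  proof -
    have "integrable lborel (G n)"
      unfolding G_def
    proof (rule Bochner_Integration.integrable_bound[OF integrable_gaussian[of "1 / real (Suc n)"]])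
      show "AE t in lborel. norm ((norm (char M t))\<^sup>2 * exp (- (1 / real (Suc n) * t)\<^sup>2 / 2)) \<le> norm (exp (- (1 / real (Suc n) * t)\<^sup>2 / 2))"
        using cmod_char_le_1 by (intro AE_I2) (auto simp: abs_mult power_le_one intro!: mult_left_le_one_le)
    qed auto
    then have "(\<integral>\<^sup>+t. ennreal (G n t) \<partial>lborel) = ennreal (\<integral>t. G n t \<partial>lborel)"
      by (intro nn_integral_eq_integral AE_I2) (simp_all add: G_def[abs_def])
    also have "\<dots> \<le> ennreal (2 * pi * C)"
      unfolding G_def by (intro ennreal_leI gaussian_weighted_char_square_le[OF h _ hpos bd]) auto
    finally show ?thesis .
  qed
  have "(\<integral>\<^sup>+t. ennreal (norm ((norm (char M t))\<^sup>2)) \<partial>lborel) = (\<integral>\<^sup>+t. liminf (\<lambda>n. ennreal (G n t)) \<partial>lborel)"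
    by (intro nn_integral_cong) (use lim_imp_Liminf[OF _ lim] in auto)
  also have "\<dots> \<le> liminf (\<lambda>n. \<integral>\<^sup>+t. ennreal (G n t) \<partial>lborel)"
    by (rule nn_integral_liminf) (simp add: G_def)
  also have "\<dots> \<le> ennreal (2 * pi * C)"
    using le by (intro Liminf_le) auto
  also have "\<dots> < \<infinity>" by simp
  finally show "(\<integral>\<^sup>+t. ennreal (norm ((norm (char M t))\<^sup>2)) \<partial>lborel) < \<infinity>" .
qed

section \<open>Characteristic functions of centred laws\<close>

text \<open>The integrable power is all that remains of the bounded density. Together with the
  Lipschitz bound below it does the work of the Riemann-Lebesgue lemma and excludes lattice laws.
  The exponent \<open>m\<close> will be \<open>2 * n\<^sub>0\<close>.\<close>

locale smooth_law = real_distribution M for M :: "real measure" +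
  fixes m :: nat
  assumes integrable_id: "integrable M (\<lambda>x. x)" and mean_zero: "expectation (\<lambda>x. x) = 0"
    and integrable_square: "integrable M (\<lambda>x. x\<^sup>2)" and second_moment: "expectation (\<lambda>x. x\<^sup>2) = 1"
    and integrable_char_power: "integrable lborel (\<lambda>t. norm (char M t) ^ m)"
begin

text \<open>\<open>iexp a - 1\<close> has modulus at most \<open>\<bar>a\<bar>\<close>, and the
  first moment is finite. The bound serves to upgrade integrability of a power to decay at
  infinity.\<close>

lemma char_lipschitz: "norm (char M s - char M t) \<le> expectation abs * \<bar>s - t\<bar>"
proof -
  have int: "integrable M (\<lambda>x. iexp (u * x))" for u :: real
    by (intro integrable_iexp) auto
  have "char M s - char M t = (\<integral>x. iexp (s * x) - iexp (t * x) \<partial>M)"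
    unfolding char_def by (rule Bochner_Integration.integral_diff[OF int int, symmetric])
  also have "norm \<dots> \<le> (\<integral>x. norm (iexp (s * x) - iexp (t * x)) \<partial>M)"
    by (rule integral_norm_bound)
  also have "\<dots> \<le> (\<integral>x. \<bar>x\<bar> * \<bar>s - t\<bar> \<partial>M)"
  proof (rule integral_mono)
    fix x
    have "s * x = t * x + (s - t) * x" by (simp add: algebra_simps)
    then have "iexp (s * x) = iexp (t * x) * iexp ((s - t) * x)"
      by (metis exp_add of_real_add distrib_left)
    then have "norm (iexp (s * x) - iexp (t * x)) = norm (iexp (t * x) * (iexp ((s - t) * x) - 1))"
      by (simp only: right_diff_distrib mult_1_right)
    also have "\<dots> = norm (iexp ((s - t) * x) - 1)" by (simp add: norm_mult)
    also have "\<dots> \<le> \<bar>(s - t) * x\<bar>" using iexp_approx1[of "(s - t) * x" 0] by simp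
    finally show "norm (iexp (s * x) - iexp (t * x)) \<le> \<bar>x\<bar> * \<bar>s - t\<bar>" by (simp add: abs_mult mult.commute)
  next
    show "integrable M (\<lambda>x. norm (iexp (s * x) - iexp (t * x)))"
      by (rule integrable_norm[OF Bochner_Integration.integrable_diff[OF int int]])
    show "integrable M (\<lambda>x. \<bar>x\<bar> * \<bar>s - t\<bar>)"
      using integrable_id by simp
  qed
  finally show ?thesis by simp
qed

text \<open>By the Lipschitz bound a value of modulus at least \<open>c\<close> forces modulus at
  least \<open>c / 2\<close> on an interval of fixed length. Far out, such an interval would
  contribute more than the tail of a convergent integral.\<close>

lemma char_vanishes_at_infinity:
  assumes c: "c > 0"
  shows "\<exists>A. \<forall>s. \<bar>s\<bar> \<ge> A \<longrightarrow> norm (char M s) < c"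
proof (rule ccontr)
  assume neg: "\<not> ?thesis"
  define K where "K = expectation abs + 1"
  have "0 \<le> expectation abs" by (rule Bochner_Integration.integral_nonneg) simp
  then have K: "K > 0" unfolding K_def by linarith
  \<comment> \<open>The radius within which a function with Lipschitz constant \<open>K\<close> can
    lose at most \<open>c / 2\<close>.\<close>
  define d where "d = c / (2 * K)"
  have d: "d > 0" using c K by (simp add: d_def)
  have near: "norm (char M t) \<ge> c / 2" if "norm (char M s) \<ge> c" "\<bar>s - t\<bar> \<le> d" for s t
  proof -
    have "norm (char M s - char M t) \<le> K * d"
      using char_lipschitz[of s t] that(2) K d
      by (intro order_trans[OF char_lipschitz] mult_mono) (auto simp: K_def)
    moreover have "K * d = c / 2" using K by (simp add: d_def)
    ultimately show ?thesis using that(1) norm_triangle_ineq2[of "char M s" "char M t"] by linarith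
  qed
  have [measurable]: "char M \<in> borel_measurable borel" by simp
  have "(\<lambda>n. \<integral>t. indicator {t. real n < \<bar>t\<bar>} t * norm (char M t) ^ m \<partial>lborel) \<longlonglongrightarrow> (\<integral>t. 0 \<partial>(lborel :: real measure))"
  proof (rule integral_dominated_convergence[where w="\<lambda>t. norm (char M t) ^ m"])
    show "AE t in lborel. (\<lambda>n. indicator {t. real n < \<bar>t\<bar>} t * norm (char M t) ^ m) \<longlonglongrightarrow> 0"
    proof (intro AE_I2 tendsto_eventually)
      fix t :: real
      show "\<forall>\<^sub>F n in sequentially. indicator {t. real n < \<bar>t\<bar>} t * norm (char M t) ^ m = 0"
        using eventually_ge_at_top[of "nat \<lceil>\<bar>t\<bar>\<rceil>"]
        by eventually_elim (auto simp: indicator_def)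
    qed
  qed (use integrable_char_power in \<open>auto simp: indicator_def\<close>)
  then have "\<forall>\<^sub>F n in sequentially. (\<integral>t. indicator {t. real n < \<bar>t\<bar>} t * norm (char M t) ^ m \<partial>lborel) < 2 * d * (c/2)^m"
    using c d by (intro order_tendstoD) auto
  then obtain n where n: "(\<integral>t. indicator {t. real n < \<bar>t\<bar>} t * norm (char M t) ^ m \<partial>lborel) < 2 * d * (c/2)^m"
    by (auto simp: eventually_at_top_linorder)
  \<comment> \<open>The margin \<open>d\<close> keeps the interval around \<open>s\<close> outside
    \<open>[-n, n]\<close>; the extra 1 makes the inequality strict.\<close>
  obtain s where s: "\<bar>s\<bar> \<ge> real n + d + 1" "norm (char M s) \<ge> c"
    using neg by (auto simp: not_less)
  have "2 * d * (c/2)^m = (\<integral>t. indicator {s-d..s+d} t * (c/2)^m \<partial>lborel)"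
    using d by simp
  also have "\<dots> \<le> (\<integral>t. indicator {t. real n < \<bar>t\<bar>} t * norm (char M t) ^ m \<partial>lborel)"
  proof (rule integral_mono)
    show "integrable lborel (\<lambda>t. indicator {t. real n < \<bar>t\<bar>} t * norm (char M t) ^ m)"
      by (rule Bochner_Integration.integrable_bound[OF integrable_char_power]) (auto simp: indicator_def)
    show "indicator {s-d..s+d} t * (c/2)^m \<le> indicator {t. real n < \<bar>t\<bar>} t * norm (char M t) ^ m" for t
    proof (cases "t \<in> {s-d..s+d}")
      case True
      then have "norm (char M t) \<ge> c/2" using near[OF s(2), of t] by (auto simp: abs_le_iff)
      then have "(c/2)^m \<le> norm (char M t) ^ m" using c by (intro power_mono) auto
      moreover have "real n < \<bar>t\<bar>" using True s(1) by auto
      ultimately show ?thesis using True by simp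
    qed simp
  qed (use d in auto)
  finally show False using n by simp
qed

text \<open>If the modulus were 1, \<open>iexp (s * x)\<close> would be almost surely a constant
  \<open>u\<close> of modulus 1, so \<open>char M\<close> would have modulus 1 at every multiple of
  \<open>s\<close>, against the decay at infinity.\<close>

lemma norm_char_less_1:
  assumes "s \<noteq> 0"
  shows "norm (char M s) < 1"
proof (rule ccontr)
  assume "\<not> norm (char M s) < 1"
  then have eq1: "norm (char M s) = 1" using cmod_char_le_1[of s] by simp
  define u where "u = char M s"
  have u: "norm u = 1" "u * cnj u = 1" using eq1 by (simp_all add: u_def complex_norm_square[symmetric])
  have int: "integrable M (\<lambda>x. iexp (v * x))" for v :: real
    by (intro integrable_iexp) auto
  have intc: "integrable M (\<lambda>x. cnj u * iexp (s * x))" by (intro integrable_mult_right int)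
  have "(\<integral>x. Re (cnj u * iexp (s * x)) \<partial>M) = Re (\<integral>x. cnj u * iexp (s * x) \<partial>M)"
    by (rule integral_Re[OF intc])
  also have "\<dots> = 1" using u by (simp add: u_def char_def mult.commute)
  finally have "(\<integral>x. 1 - Re (cnj u * iexp (s * x)) \<partial>M) = 0"
    using integrable_Re[OF intc] prob_space by (subst Bochner_Integration.integral_diff) (auto simp del: space_eq_univ)
  moreover have le: "Re (cnj u * iexp (s * x)) \<le> 1" for x
    using complex_Re_le_cmod[of "cnj u * iexp (s * x)"] u by (simp add: norm_mult)
  ultimately have "AE x in M. 1 - Re (cnj u * iexp (s * x)) = 0"
    using integrable_Re[OF intc] by (subst (asm) integral_nonneg_eq_0_iff_AE) auto
  then have ae: "AE x in M. iexp (s * x) = u"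
  proof eventually_elim
    case (elim x)
    have "norm (cnj u * iexp (s * x)) = 1" using u by (simp add: norm_mult)
    moreover have "w = 1" if "Re w = 1" "norm w = 1" for w
      using cmod_power2[of w] that by (intro complex_eqI) auto
    moreover have "Re (cnj u * iexp (s * x)) = 1" using elim by linarith
    ultimately have "cnj u * iexp (s * x) = 1" by blast
    then have "u * (cnj u * iexp (s * x)) = u" by simp
    then show ?case using u by (simp add: mult.assoc[symmetric])
  qed
  have pow: "norm (char M (real k * s)) = 1" for k :: nat
  proof -
    have "char M (real k * s) = (\<integral>x. u ^ k \<partial>M)"
      unfolding char_def
    proof (rule integral_cong_AE)
      show "AE x in M. iexp (real k * s * x) = u ^ k"
        using ae
      proof eventually_elim
        case (elim x)
        have "iexp (real k * s * x) = iexp (s * x) ^ k"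
          by (subst exp_of_nat_mult[symmetric]) (simp add: mult_ac)
        then show ?case using elim by simp
      qed
    qed auto
    then show ?thesis using u prob_space by (simp add: norm_power del: space_eq_univ)
  qed
  obtain A where A: "\<And>t. \<bar>t\<bar> \<ge> A \<Longrightarrow> norm (char M t) < 1"
    using char_vanishes_at_infinity[of 1] by auto
  obtain k :: nat where k: "real k > A / \<bar>s\<bar>" using reals_Archimedean2 by blast
  then have "\<bar>real k * s\<bar> \<ge> A" using assms by (simp add: abs_mult field_simps)
  from A[OF this] pow show False by simp
qed

text \<open>Decay handles large arguments and compactness the rest. The factor \<open>q\<close> is
  what makes high frequencies geometrically small in the local limit theorem.\<close>

lemma norm_char_bounded_away:
  assumes r: "r > 0"
  shows "\<exists>q. 0 \<le> q \<and> q < 1 \<and> (\<forall>s. \<bar>s\<bar> \<ge> r \<longrightarrow> norm (char M s) \<le> q)"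
proof -
  obtain A where A: "\<And>t. \<bar>t\<bar> \<ge> A \<Longrightarrow> norm (char M t) < 1/2"
    using char_vanishes_at_infinity[of "1/2"] by auto
  let ?S = "{-\<bar>A\<bar>-r..-r} \<union> {r..\<bar>A\<bar>+r}"
  have "continuous_on ?S (\<lambda>t. norm (char M t))"
    by (intro continuous_on_norm continuous_at_imp_continuous_on ballI isCont_char)
  then obtain t0 where t0: "t0 \<in> ?S" "\<And>t. t \<in> ?S \<Longrightarrow> norm (char M t) \<le> norm (char M t0)"
    using continuous_attains_sup[of ?S "\<lambda>t. norm (char M t)"] r by force
  have "norm (char M t0) < 1" using t0(1) r by (intro norm_char_less_1) auto
  moreover have "norm (char M s) \<le> max (1/2) (norm (char M t0))" if "\<bar>s\<bar> \<ge> r" for s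
  proof (cases "s \<in> ?S")
    case True
    then show ?thesis using t0(2)[of s] by simp
  next
    case False
    then have "\<bar>s\<bar> \<ge> A" using that r by auto
    then show ?thesis using A[of s] by simp
  qed
  ultimately show ?thesis by (intro exI[of _ "max (1/2) (norm (char M t0))"]) auto
qed

section \<open>Second order expansion and the central limit theorem on the Fourier side\<close>

definition taylor_error :: "real \<Rightarrow> real" where
  "taylor_error s = expectation (\<lambda>x. min (6 * x\<^sup>2) (\<bar>s\<bar> * \<bar>x\<bar> ^ 3))"

text \<open>In \<open>taylor_error\<close> the cubic term gives smallness as \<open>s\<close> tends
  to 0 and the quadratic one an integrable majorant, so the remainder is o(t^2) with two moments
  only.\<close>

lemma char_taylor:
  "norm (char M t - (1 - t\<^sup>2 / 2)) \<le> t\<^sup>2 / 6 * taylor_error t"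
  using char_approx3[of 1 t] integrable_id mean_zero integrable_square second_moment
  by (simp add: taylor_error_def)

lemma taylor_error_tendsto:
  assumes X: "X \<longlonglongrightarrow> 0"
  shows "(\<lambda>n. taylor_error (X n)) \<longlonglongrightarrow> 0"
proof -
  have "(\<lambda>n. expectation (\<lambda>x. min (6 * x\<^sup>2) (\<bar>X n\<bar> * \<bar>x\<bar> ^ 3))) \<longlonglongrightarrow> expectation (\<lambda>x. 0)"
  proof (rule integral_dominated_convergence[where w="\<lambda>x. 6 * x\<^sup>2"])
    show "AE x in M. (\<lambda>n. min (6 * x\<^sup>2) (\<bar>X n\<bar> * \<bar>x\<bar> ^ 3)) \<longlonglongrightarrow> 0"
    proof (intro AE_I2)
      fix x
      have "(\<lambda>n. min (6 * x\<^sup>2) (\<bar>X n\<bar> * \<bar>x\<bar> ^ 3)) \<longlonglongrightarrow> min (6 * x\<^sup>2) (\<bar>0\<bar> * \<bar>x\<bar> ^ 3)"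
        by (intro tendsto_intros X)
      then show "(\<lambda>n. min (6 * x\<^sup>2) (\<bar>X n\<bar> * \<bar>x\<bar> ^ 3)) \<longlonglongrightarrow> 0" by simp
    qed
  qed (use integrable_square in auto)
  then show ?thesis by (simp add: taylor_error_def)
qed

lemma norm_char_le_gaussian:
  "\<exists>r>0. \<forall>s. \<bar>s\<bar> \<le> r \<longrightarrow> norm (char M s) \<le> exp (- s\<^sup>2 / 4)"
proof -
  have "(taylor_error \<longlongrightarrow> 0) (at 0)"
    unfolding tendsto_at_iff_sequentially comp_def using taylor_error_tendsto by auto
  \<comment> \<open>With \<open>3/2\<close> the remainder is at most \<open>s^2 / 4\<close>, which
    leaves \<open>1 - s^2 / 4\<close> out of \<open>1 - s^2 / 2\<close>.\<close>
  then have "\<forall>\<^sub>F s in at 0. taylor_error s < 3/2" by (intro order_tendstoD) auto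
  then obtain d where d: "d > 0" "\<And>s. s \<noteq> 0 \<Longrightarrow> \<bar>s\<bar> < d \<Longrightarrow> taylor_error s < 3/2"
    unfolding eventually_at by (auto simp: dist_real_def)
  have "norm (char M s) \<le> exp (- s\<^sup>2 / 4)" if s: "\<bar>s\<bar> \<le> min (d/2) 1" for s
  proof (cases "s = 0")
    case True then show ?thesis by (simp add: char_zero)
  next
    case False
    have "taylor_error s < 3/2" using d(2)[of s] False s d(1) by auto
    then have "s\<^sup>2 / 6 * taylor_error s \<le> s\<^sup>2 / 6 * (3/2)" by (intro mult_left_mono) auto
    then have "s\<^sup>2 / 6 * taylor_error s \<le> s\<^sup>2 / 4" by simp
    moreover have "norm (char M s) \<le> norm (char M s - (1 - s\<^sup>2 / 2)) + norm (1 - s\<^sup>2 / 2)"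
    proof -
      have "norm (char M s) \<le> norm (char M s - (1 - s\<^sup>2 / 2)) + norm (complex_of_real (1 - s\<^sup>2 / 2))"
        using norm_triangle_ineq[of "char M s - (1 - s\<^sup>2 / 2)" "complex_of_real (1 - s\<^sup>2 / 2)"] by simp
      then show ?thesis by (simp only: norm_of_real real_norm_def)
    qed
    moreover have "s\<^sup>2 \<le> 1" using s by (simp add: abs_square_le_1)
    ultimately have "norm (char M s) \<le> 1 - s\<^sup>2 / 4" using char_taylor[of s] unfolding real_norm_def by linarith
    also have "\<dots> \<le> exp (- s\<^sup>2 / 4)" using exp_ge_add_one_self[of "- s\<^sup>2 / 4"] by simp
    finally show ?thesis .
  qed
  then show ?thesis using d(1) by (intro exI[of _ "min (d/2) 1"]) auto
qed

lemma char_power_tendsto: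
  "(\<lambda>n. char M (t / sqrt (real n)) ^ n) \<longlonglongrightarrow> complex_of_real (exp (- t\<^sup>2 / 2))"
proof -
  define b where "b n = 1 - t\<^sup>2 / 2 / real n" for n
  have bl: "(\<lambda>n. b n ^ n) \<longlonglongrightarrow> exp (- t\<^sup>2 / 2)"
    using tendsto_exp_limit_sequentially[of "- t\<^sup>2 / 2"] by (simp add: b_def)
  have z: "(\<lambda>n. t / sqrt (real n)) \<longlonglongrightarrow> 0"
    by (intro tendsto_divide_0[OF tendsto_const] filterlim_at_top_imp_at_infinity
        filterlim_compose[OF sqrt_at_top filterlim_real_sequentially])
  have "(\<lambda>n. t\<^sup>2 / 6 * taylor_error (t / sqrt (real n))) \<longlonglongrightarrow> t\<^sup>2 / 6 * 0"
    by (intro tendsto_intros taylor_error_tendsto z)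
  then have e0: "(\<lambda>n. t\<^sup>2 / 6 * taylor_error (t / sqrt (real n))) \<longlonglongrightarrow> 0" by simp
  have "\<forall>\<^sub>F n in sequentially. norm (char M (t / sqrt (real n)) ^ n - complex_of_real (b n ^ n)) \<le> t\<^sup>2 / 6 * taylor_error (t / sqrt (real n))"
    \<comment> \<open>Once \<open>n\<close> exceeds \<open>t^2\<close>, \<open>b n\<close> has
      modulus at most 1, as the comparison of \<open>n\<close>-th powers by \<open>n\<close> times
      the difference requires.\<close>
    using eventually_ge_at_top[of "Suc (nat \<lceil>t\<^sup>2\<rceil>)"]
  proof eventually_elim
    case (elim n)
    then have n: "n > 0" "real n \<ge> t\<^sup>2" by linarith+
    have "\<bar>b n\<bar> \<le> 1" using n by (auto simp: b_def abs_le_iff field_simps)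
    then have "norm (char M (t / sqrt (real n)) ^ n - complex_of_real (b n) ^ n) \<le> n * norm (char M (t / sqrt (real n)) - b n)"
      by (intro norm_power_diff cmod_char_le_1) auto
    also have "\<dots> \<le> n * ((t / sqrt (real n))\<^sup>2 / 6 * taylor_error (t / sqrt (real n)))"
      using char_taylor[of "t / sqrt (real n)"] n
      by (intro mult_left_mono) (auto simp: b_def power_divide mult_ac)
    also have "\<dots> = t\<^sup>2 / 6 * taylor_error (t / sqrt (real n))"
      using n by (simp add: power_divide)
    finally show ?case by simp
  qed
  then have "(\<lambda>n. char M (t / sqrt (real n)) ^ n - complex_of_real (b n ^ n)) \<longlonglongrightarrow> 0"
    by (rule Lim_null_comparison[OF _ e0])
  from tendsto_add[OF this tendsto_of_real[OF bl]] show ?thesis by simp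
qed


text \<open>Three ranges of \<open>t\<close>. Up to \<open>r * sqrt n\<close> the Gaussian majorant
  allows dominated convergence. Beyond it \<open>m\<close> of the \<open>n\<close> factors are kept
  for integrability and the other \<open>n - m\<close> are at most \<open>q\<close> each; what then
  remains is the Gaussian tail.\<close>

lemma integral_char_power_diff_tendsto:
  "(\<lambda>n. \<integral>t. norm (char M (t / sqrt (real n)) ^ n - complex_of_real (exp (- t\<^sup>2 / 2))) \<partial>lborel) \<longlonglongrightarrow> 0"
  "\<forall>\<^sub>F n in sequentially. integrable lborel (\<lambda>t. char M (t / sqrt (real n)) ^ n)"
proof -
  obtain r where r: "r > 0" "\<And>s. \<bar>s\<bar> \<le> r \<Longrightarrow> norm (char M s) \<le> exp (- s\<^sup>2 / 4)"
    using norm_char_le_gaussian by blast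
  obtain q where q: "0 \<le> q" "q < 1" "\<And>s. \<bar>s\<bar> \<ge> r \<Longrightarrow> norm (char M s) \<le> q"
    using norm_char_bounded_away[OF r(1)] by blast
  have [measurable]: "char M \<in> borel_measurable borel" by simp
  define I where "I = (\<integral>t. norm (char M t) ^ m \<partial>lborel)"
  define E where "E t = exp (- t\<^sup>2 / 2)" for t :: real
  have intE: "integrable lborel E" unfolding E_def using integrable_gaussian[of 1] by simp
  have int4: "integrable lborel (\<lambda>t::real. exp (- t\<^sup>2 / 4))"
    using integrable_gaussian[of "1 / sqrt 2"] by (simp add: power_divide)
  have affine: "0 + 1 / sqrt (real n) * t = t / sqrt (real n)" for n and t :: real by simp
  have intc: "integrable lborel (\<lambda>t. norm (char M (t / sqrt (real n))) ^ m)" if "n > 0" for n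
    using lborel_integrable_real_affine[OF integrable_char_power, of "1 / sqrt (real n)" 0, unfolded affine] that
    by (metis divide_eq_0_iff of_nat_0_less_iff order_less_irrefl real_sqrt_eq_zero_cancel_iff zero_neq_one)
  \<comment> \<open>Rescaling the integrable power costs a factor \<open>sqrt n\<close>, which the
    geometric factor \<open>q ^ (n - m)\<close> absorbs.\<close>
  have Ic: "(\<integral>t. norm (char M (t / sqrt (real n))) ^ m \<partial>lborel) = sqrt (real n) * I" if "n > 0" for n
  proof -
    have "I = \<bar>1 / sqrt (real n)\<bar> *\<^sub>R (\<integral>t. norm (char M (t / sqrt (real n))) ^ m \<partial>lborel)"
      unfolding I_def by (subst lborel_integral_real_affine[of "1 / sqrt (real n)" _ 0]) (use that affine in auto)
    moreover define J where "J = (\<integral>t. norm (char M (t / sqrt (real n))) ^ m \<partial>lborel)"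
    ultimately show ?thesis unfolding J_def[symmetric] using that by simp
  qed
  define G where "G n t = indicator {t. \<bar>t\<bar> \<le> r * sqrt (real n)} t *\<^sub>R (char M (t / sqrt (real n)) ^ n - complex_of_real (E t))" for n t
  have bound: "norm (char M (t / sqrt (real n)) ^ n - complex_of_real (E t)) \<le>
     norm (G n t) + q ^ (n - m) * norm (char M (t / sqrt (real n))) ^ m + indicator {t. \<bar>t\<bar> > r * sqrt (real n)} t * E t"
    if n: "n \<ge> Suc m" for n t
  proof (cases "\<bar>t\<bar> \<le> r * sqrt (real n)")
    case True
    then show ?thesis using q by (simp add: G_def)
  next
    case False
    then have "\<bar>t / sqrt (real n)\<bar> \<ge> r" using n by (simp add: field_simps)
    from q(3)[OF this] have "norm (char M (t / sqrt (real n))) ^ (n - m) \<le> q ^ (n - m)"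
      by (intro power_mono) auto
    then have "norm (char M (t / sqrt (real n))) ^ (n - m) * norm (char M (t / sqrt (real n))) ^ m \<le> q ^ (n - m) * norm (char M (t / sqrt (real n))) ^ m"
      by (intro mult_right_mono) auto
    then have "norm (char M (t / sqrt (real n)) ^ n) \<le> q ^ (n - m) * norm (char M (t / sqrt (real n))) ^ m"
      using n by (simp add: norm_power power_add[symmetric])
    moreover have "norm (char M (t / sqrt (real n)) ^ n - complex_of_real (E t)) \<le> norm (char M (t / sqrt (real n)) ^ n) + E t"
      using norm_triangle_ineq4[of "char M (t / sqrt (real n)) ^ n" "complex_of_real (E t)"] by (simp add: E_def)
    ultimately show ?thesis using False by (simp add: G_def)
  qed
  have Gle: "norm (G n t) \<le> exp (- t\<^sup>2 / 4) + E t" for n t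
  proof (cases "\<bar>t\<bar> \<le> r * sqrt (real n) \<and> n > 0")
    case True
    then have "norm (char M (t / sqrt (real n))) \<le> exp (- (t / sqrt (real n))\<^sup>2 / 4)"
      by (intro r(2)) (auto simp: field_simps)
    then have "norm (char M (t / sqrt (real n))) ^ n \<le> exp (- (t / sqrt (real n))\<^sup>2 / 4) ^ n"
      by (intro power_mono) auto
    also have "\<dots> = exp (- t\<^sup>2 / 4)" using True by (simp add: exp_of_nat_mult[symmetric] power_divide)
    finally show ?thesis using True
      norm_triangle_ineq4[of "char M (t / sqrt (real n)) ^ n" "complex_of_real (E t)"]
      by (simp add: G_def E_def norm_power)
  next
    case False
    then show ?thesis by (cases "n = 0") (auto simp: G_def E_def indicator_def)
  qed
  have [measurable]: "E \<in> borel_measurable borel" unfolding E_def by measurable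
  have [measurable]: "G n \<in> borel_measurable borel" for n unfolding G_def by measurable
  have intG: "integrable lborel (\<lambda>t. norm (G n t))" for n
  proof (rule integrable_le[OF Bochner_Integration.integrable_add[OF int4 intE]])
    show "norm (norm (G n t)) \<le> exp (- t\<^sup>2 / 4) + E t" for t using Gle[of n t] by simp
  qed measurable
  have E_tail: "integrable lborel (\<lambda>t. indicator {t. \<bar>t\<bar> > r * sqrt (real n)} t * E t)" for n
    by (rule integrable_le[OF intE]) (auto simp: indicator_def E_def)
  have sqrt_inf: "\<forall>\<^sub>F n in sequentially. \<bar>t\<bar> \<le> r * sqrt (real n)" for t
  proof -
    have "filterlim (\<lambda>n. r * sqrt (real n)) at_top sequentially" 
      by (intro filterlim_tendsto_pos_mult_at_top[OF tendsto_const r(1)]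
        filterlim_compose[OF sqrt_at_top filterlim_real_sequentially])
    then show ?thesis unfolding filterlim_at_top by blast
  qed
  have lim1: "(\<lambda>n. \<integral>t. norm (G n t) \<partial>lborel) \<longlonglongrightarrow> (\<integral>t. 0 \<partial>(lborel :: real measure))"
  proof (rule integral_dominated_convergence[where w="\<lambda>t. exp (- t\<^sup>2 / 4) + E t"])
    show "AE t in lborel. (\<lambda>n. norm (G n t)) \<longlonglongrightarrow> 0"
    proof (rule AE_I2)
      fix t :: real
      have le: "norm (norm (G n t)) \<le> norm (char M (t / sqrt (real n)) ^ n - complex_of_real (E t))" for n
        unfolding G_def norm_scaleR norm_mult real_norm_def abs_mult abs_norm_cancel by (rule mult_left_le_one_le) (auto split: split_indicator)
      have "(\<lambda>n. norm (char M (t / sqrt (real n)) ^ n - complex_of_real (E t))) \<longlonglongrightarrow> 0"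
        unfolding E_def by (rule tendsto_norm_zero[OF LIM_zero[OF char_power_tendsto]])
      then show "(\<lambda>n. norm (G n t)) \<longlonglongrightarrow> 0"
        by (rule Lim_null_comparison[OF always_eventually, rotated]) (rule allI, rule le)
    qed
    show "AE t in lborel. norm (norm (G n t)) \<le> exp (- t\<^sup>2 / 4) + E t" for n
      using Gle[of n] by (intro AE_I2) simp
    show "integrable lborel (\<lambda>t. exp (- t\<^sup>2 / 4) + E t)"
      by (rule Bochner_Integration.integrable_add[OF int4 intE])
  qed measurable
  have lim2: "(\<lambda>n. q ^ (n - m) * (sqrt (real n) * I)) \<longlonglongrightarrow> 0"
  proof (rule LIMSEQ_offset[where k=m])
    have "(\<lambda>n. sqrt (real (n + m)) * q ^ n) \<longlonglongrightarrow> 0"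
    proof (rule Lim_null_comparison[OF always_eventually])
      show "\<forall>n. norm (sqrt (real (n + m)) * q ^ n) \<le> real n * q ^ n + real m * q ^ n"
      proof
        fix n
        have "sqrt (real (n + m)) \<le> real (n + m)"
          by (intro real_le_lsqrt) (auto simp: power2_eq_square simp flip: of_nat_add of_nat_mult)
        from mult_right_mono[OF this, of "q ^ n"] q show "norm (sqrt (real (n + m)) * q ^ n) \<le> real n * q ^ n + real m * q ^ n"
          by (simp add: abs_mult algebra_simps)
      qed
      have "(\<lambda>n. real n * q ^ n + real m * q ^ n) \<longlonglongrightarrow> 0 + real m * 0"
        using q by (intro tendsto_intros powser_times_n_limit_0 LIMSEQ_power_zero) auto
      then show "(\<lambda>n. real n * q ^ n + real m * q ^ n) \<longlonglongrightarrow> 0" by simp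
    qed
    from tendsto_mult_right[OF this, of I] show "(\<lambda>n. q ^ (n + m - m) * (sqrt (real (n + m)) * I)) \<longlonglongrightarrow> 0"
      by (simp add: mult_ac)
  qed
  have lim3: "(\<lambda>n. \<integral>t. indicator {t. \<bar>t\<bar> > r * sqrt (real n)} t * E t \<partial>lborel) \<longlonglongrightarrow> (\<integral>t. 0 \<partial>(lborel :: real measure))"
  proof (rule integral_dominated_convergence[where w=E])
    show "AE t in lborel. (\<lambda>n. indicator {t. \<bar>t\<bar> > r * sqrt (real n)} t * E t) \<longlonglongrightarrow> 0"
    proof (intro AE_I2 tendsto_eventually)
      fix t :: real
      show "\<forall>\<^sub>F n in sequentially. indicator {t. \<bar>t\<bar> > r * sqrt (real n)} t * E t = 0"
        using sqrt_inf[of t] by eventually_elim simp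
    qed
  qed (use intE in \<open>auto simp: indicator_def E_def\<close>)
  have intsum: "integrable lborel (\<lambda>t. norm (G n t) + q ^ (n - m) * norm (char M (t / sqrt (real n))) ^ m + indicator {t. \<bar>t\<bar> > r * sqrt (real n)} t * E t)"
    if "n \<ge> Suc m" for n
    using that by (intro Bochner_Integration.integrable_add integrable_mult_right intc intG E_tail) simp
  have intD: "integrable lborel (\<lambda>t. norm (char M (t / sqrt (real n)) ^ n - complex_of_real (E t)))"
    if n: "n \<ge> Suc m" for n
  proof (rule integrable_le[OF intsum[OF n]])
    show "norm (norm (char M (t / sqrt (real n)) ^ n - complex_of_real (E t))) \<le>
      norm (G n t) + q ^ (n - m) * norm (char M (t / sqrt (real n))) ^ m + indicator {t. \<bar>t\<bar> > r * sqrt (real n)} t * E t" for t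
      using bound[OF n, of t] by simp
  qed measurable
  have le: "(\<integral>t. norm (char M (t / sqrt (real n)) ^ n - complex_of_real (E t)) \<partial>lborel) \<le>
     (\<integral>t. norm (G n t) \<partial>lborel) + q ^ (n - m) * (sqrt (real n) * I) + (\<integral>t. indicator {t. \<bar>t\<bar> > r * sqrt (real n)} t * E t \<partial>lborel)"
    if n: "n \<ge> Suc m" for n
  proof -
    have "(\<integral>t. norm (char M (t / sqrt (real n)) ^ n - complex_of_real (E t)) \<partial>lborel) \<le>
      (\<integral>t. norm (G n t) + q ^ (n - m) * norm (char M (t / sqrt (real n))) ^ m + indicator {t. \<bar>t\<bar> > r * sqrt (real n)} t * E t \<partial>lborel)"
      by (rule integral_mono[OF intD[OF n] intsum[OF n]]) (rule bound[OF n])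
    also have "\<dots> = (\<integral>t. norm (G n t) \<partial>lborel) + q ^ (n - m) * (\<integral>t. norm (char M (t / sqrt (real n))) ^ m \<partial>lborel) + (\<integral>t. indicator {t. \<bar>t\<bar> > r * sqrt (real n)} t * E t \<partial>lborel)"
    proof -
      have c: "integrable lborel (\<lambda>t. q ^ (n - m) * norm (char M (t / sqrt (real n))) ^ m)"
        using n by (intro integrable_mult_right intc) simp
      show ?thesis
        unfolding Bochner_Integration.integral_add[OF Bochner_Integration.integrable_add[OF intG c] E_tail]
          Bochner_Integration.integral_add[OF intG c] integral_mult_right_zero ..
    qed
    finally show ?thesis using n Ic[of n] by simp
  qed
  show "(\<lambda>n. \<integral>t. norm (char M (t / sqrt (real n)) ^ n - complex_of_real (exp (- t\<^sup>2 / 2))) \<partial>lborel) \<longlonglongrightarrow> 0"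
  proof (rule tendsto_sandwich[OF _ _ tendsto_const])
    show "\<forall>\<^sub>F n in sequentially. (\<integral>t. norm (char M (t / sqrt (real n)) ^ n - complex_of_real (exp (- t\<^sup>2 / 2))) \<partial>lborel) \<le> 
       (\<integral>t. norm (G n t) \<partial>lborel) + q ^ (n - m) * (sqrt (real n) * I) + (\<integral>t. indicator {t. \<bar>t\<bar> > r * sqrt (real n)} t * E t \<partial>lborel)"
      using eventually_ge_at_top[of "Suc m"] by eventually_elim (use le in \<open>simp add: E_def\<close>)
    show "(\<lambda>n. (\<integral>t. norm (G n t) \<partial>lborel) + q ^ (n - m) * (sqrt (real n) * I) + (\<integral>t. indicator {t. \<bar>t\<bar> > r * sqrt (real n)} t * E t \<partial>lborel)) \<longlonglongrightarrow> 0"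
      using tendsto_add[OF tendsto_add[OF lim1 lim2] lim3] by simp
  qed simp
  show "\<forall>\<^sub>F n in sequentially. integrable lborel (\<lambda>t. char M (t / sqrt (real n)) ^ n)"
    using eventually_ge_at_top[of "Suc m"]
  proof eventually_elim
    case (elim n)
    have "integrable lborel (\<lambda>t. char M (t / sqrt (real n)) ^ n - complex_of_real (E t))"
      using intD[OF elim] by (subst (asm) integrable_norm_iff) auto
    from Bochner_Integration.integrable_add[OF this integrable_of_real[OF intE]] show ?case by simp
  qed
qed

end

section \<open>Random walks with bounded densities\<close>

locale bounded_density_walk = prob_space M
  for M :: "'a measure" and X :: "nat \<Rightarrow> 'a \<Rightarrow> real" and f :: "real \<Rightarrow> real" and n\<^sub>0 :: nat and C\<^sub>0 :: real +
  assumes indep: "indep_vars (\<lambda>_. borel) X {1..}"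
    and f_nonneg: "0 \<le> f t"
    and X_density: "1 \<le> i \<Longrightarrow> distributed M lborel (X i) (\<lambda>t. ennreal (f t))"
    and X_mean: "1 \<le> i \<Longrightarrow> integrable M (X i) \<and> (\<integral>\<omega>. X i \<omega> \<partial>M) = 0"
    and X_square: "1 \<le> i \<Longrightarrow> integrable M (\<lambda>\<omega>. (X i \<omega>)\<^sup>2) \<and> (\<integral>\<omega>. (X i \<omega>)\<^sup>2 \<partial>M) = 1"
    and n0_pos: "1 \<le> n\<^sub>0" and density_bounded: "AE t in lborel. walk_density f n\<^sub>0 t \<le> C\<^sub>0"
begin

definition \<mu> :: "real measure" where "\<mu> = density lborel (\<lambda>t. ennreal (f t))"

lemma f_measurable [measurable]: "f \<in> borel_measurable borel"
proof -
  have "(\<lambda>t. enn2real (ennreal (f t))) \<in> borel_measurable lborel"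
    using distributed_borel_measurable[OF X_density[of 1]] by measurable
  then show ?thesis using f_nonneg by simp
qed

lemma sets_\<mu> [simp, measurable_cong]: "sets \<mu> = sets borel"
  and space_\<mu> [simp]: "space \<mu> = UNIV"
  by (simp_all add: \<mu>_def)

lemma X_measurable: "1 \<le> i \<Longrightarrow> X i \<in> borel_measurable M"
  using distributed_measurable[OF X_density, of i] by simp

lemma distr_X: "1 \<le> i \<Longrightarrow> distr M borel (X i) = \<mu>"
  unfolding \<mu>_def distributed_distr_eq_density[OF X_density, symmetric]
  by (intro distr_cong) auto

lemma walk_0 [simp]: "walk X 0 \<omega> = 0"
  and walk_Suc: "walk X (Suc n) \<omega> = walk X n \<omega> + X (Suc n) \<omega>"
  by (simp_all add: walk_def)

lemma walk_measurable [measurable]: "walk X n \<in> borel_measurable M"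
  unfolding walk_def[abs_def] by (intro borel_measurable_sum X_measurable) auto

lemma expectation_X:
  fixes F :: "real \<Rightarrow> 'b::{banach,second_countable_topology}"
  assumes "1 \<le> i" "F \<in> borel_measurable borel"
  shows "(\<integral>\<omega>. F (X i \<omega>) \<partial>M) = (\<integral>t. F t \<partial>\<mu>)"
  unfolding distr_X[OF assms(1), symmetric] using X_measurable[OF assms(1)] assms(2)
  by (subst integral_distr) auto

lemma integrable_X_iff:
  fixes F :: "real \<Rightarrow> 'b::{banach,second_countable_topology}"
  assumes "1 \<le> i" "F \<in> borel_measurable borel"
  shows "integrable M (\<lambda>\<omega>. F (X i \<omega>)) = integrable \<mu> F"
  unfolding distr_X[OF assms(1), symmetric] using X_measurable[OF assms(1)] assms(2)
  by (subst integrable_distr_eq) auto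

lemma integrable_\<mu>: "integrable \<mu> (\<lambda>x. x)" "integrable \<mu> (\<lambda>x. x\<^sup>2)"
  and integral_\<mu>: "(\<integral>x. x \<partial>\<mu>) = 0" "(\<integral>x. x\<^sup>2 \<partial>\<mu>) = 1"
proof -
  have m: "(\<lambda>x::real. x) \<in> borel_measurable borel" "(\<lambda>x::real. x\<^sup>2) \<in> borel_measurable borel"
    by measurable
  show "integrable \<mu> (\<lambda>x. x)" "integrable \<mu> (\<lambda>x. x\<^sup>2)" "(\<integral>x. x \<partial>\<mu>) = 0" "(\<integral>x. x\<^sup>2 \<partial>\<mu>) = 1"
    using X_mean[of 1] X_square[of 1] integrable_X_iff[OF order_refl m(1)] integrable_X_iff[OF order_refl m(2)]
      expectation_X[OF order_refl m(1)] expectation_X[OF order_refl m(2)] by simp_all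
qed

lemma indep_X_walk: "indep_var borel (X (Suc n)) borel (walk X n)"
proof -
  have "indep_var borel (X (Suc n)) borel (\<lambda>\<omega>. \<Sum>i\<in>{1..n}. X i \<omega>)"
    by (rule indep_vars_sum) (use indep_vars_subset[OF indep] in auto)
  then show ?thesis by (simp only: walk_def[abs_def])
qed

lemma walk_density_measurable [measurable]: "walk_density f n \<in> borel_measurable borel"
proof (induction n rule: induct_nat_012)
  case (ge2 n)
  note [measurable] = ge2(2)
  show ?case unfolding walk_density.simps by measurable
qed auto

lemma walk_density_nonneg: "0 \<le> walk_density f n t"
proof (induction n arbitrary: t rule: induct_nat_012)
  case (ge2 n)
  then show ?case by (auto intro!: Bochner_Integration.integral_nonneg mult_nonneg_nonneg f_nonneg)
qed (auto simp: f_nonneg)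

text \<open>The convolution theorem yields an extended-valued density \<open>h\<close>. Its total
  mass is 1, so it is finite almost everywhere, and there it agrees with the Bochner integral in
  \<open>walk_density\<close>; the default value 0 is confined to a null set.\<close>

lemma walk_distributed: "1 \<le> n \<Longrightarrow> distributed M lborel (walk X n) (\<lambda>t. ennreal (walk_density f n t))"
proof (induction n rule: nat_induct_at_least)
  case base
  have "walk X 1 = X 1" by (auto simp: walk_def)
  then show ?case using X_density[of 1] by simp
next
  case (Suc n)
  define h where "h x = (\<integral>\<^sup>+y. ennreal (f (x - y)) * ennreal (walk_density f n y) \<partial>lborel)" for x
  have "distributed M lborel (\<lambda>\<omega>. X (Suc n) \<omega> + walk X n \<omega>) h"
    unfolding h_def
    by (intro distributed_convolution indep_X_walk X_density Suc) auto
  then have dh: "distributed M lborel (walk X (Suc n)) h"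
    by (simp add: walk_Suc[abs_def] add.commute)
  have hm [measurable]: "h \<in> borel_measurable borel" unfolding h_def by measurable
  have "(\<integral>\<^sup>+x. h x \<partial>lborel) = 1"
  proof -
    have "emeasure (density lborel h) UNIV = emeasure (distr M lborel (walk X (Suc n))) UNIV"
      using distributed_distr_eq_density[OF dh] by simp
    also have "\<dots> = 1" by (subst emeasure_distr) (auto simp: emeasure_space_1)
    finally show ?thesis by (subst (asm) emeasure_density) (auto simp: hm)
  qed
  then have "AE x in lborel. h x \<noteq> \<infinity>" by (intro nn_integral_noteq_infinite) auto
  then have ae: "AE x in lborel. h x = ennreal (walk_density f (Suc n) x)"
  proof eventually_elim
    case (elim x)
    have eq: "h x = (\<integral>\<^sup>+y. ennreal (walk_density f n y * f (x - y)) \<partial>lborel)"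
      unfolding h_def by (simp add: ennreal_mult' f_nonneg walk_density_nonneg mult.commute)
    have "integrable lborel (\<lambda>y. walk_density f n y * f (x - y))"
      using elim eq by (intro integrableI_nonneg) (auto simp: f_nonneg walk_density_nonneg top.not_eq_extremum)
    then have "h x = ennreal (\<integral>y. walk_density f n y * f (x - y) \<partial>lborel)"
      unfolding eq by (intro nn_integral_eq_integral) (auto simp: f_nonneg walk_density_nonneg)
    also have "(\<integral>y. walk_density f n y * f (x - y) \<partial>lborel) = walk_density f (Suc n) x"
      using Suc(1) by (cases n) auto
    finally show ?case .
  qed
  have "density lborel h = density lborel (\<lambda>x. ennreal (walk_density f (Suc n) x))"
    using ae hm by (intro density_cong) auto
  then show ?case using dh unfolding distributed_def by auto
qed

section \<open>Laws of the partial sums and pointwise inversion of their densities\<close>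

definition law :: "nat \<Rightarrow> real measure" where "law n = distr M borel (walk X n)"

lemma sets_law [simp, measurable_cong]: "sets (law n) = sets borel"
  and space_law [simp]: "space (law n) = UNIV"
  by (simp_all add: law_def)

lemma law_eq_density: "1 \<le> n \<Longrightarrow> law n = density lborel (\<lambda>t. ennreal (walk_density f n t))"
  unfolding distributed_distr_eq_density[OF walk_distributed, symmetric] law_def
  by (intro distr_cong) auto

lemma real_distribution_law: "real_distribution (law n)"
  unfolding law_def by (rule real_distribution_distr) simp

lemma real_distribution_\<mu>: "real_distribution \<mu>"
  unfolding distr_X[of 1, OF order_refl, symmetric] by (rule real_distribution_distr) (simp add: X_measurable)

sublocale \<mu>: real_distribution \<mu> by (rule real_distribution_\<mu>)

lemma char_law: "char (law n) t = char \<mu> t ^ n"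
proof -
  have "char (law n) t = (\<Prod>i\<in>{1..n}. char (distr M borel (X i)) t)"
    unfolding law_def walk_def[abs_def]
    by (rule char_distr_sum) (rule indep_vars_subset[OF indep], auto)
  also have "\<dots> = (\<Prod>i\<in>{1..n}. char \<mu> t)" by (intro prod.cong refl) (simp add: distr_X)
  finally show ?thesis by simp
qed

text \<open>A bounded density puts the characteristic function of \<open>law n\<^sub>0\<close>,
  which is the \<open>n\<^sub>0\<close>-th power of \<open>char \<mu>\<close>, into L^2; hence the
  exponent \<open>2 * n\<^sub>0\<close>.\<close>

sublocale \<mu>: smooth_law \<mu> "2 * n\<^sub>0"
proof
  interpret L: real_distribution "law n\<^sub>0" by (rule real_distribution_law)
  have "integrable lborel (\<lambda>t. (norm (char (law n\<^sub>0) t))\<^sup>2)"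
    by (rule L.char_square_integrable[OF law_eq_density[OF n0_pos] _ _ density_bounded])
       (auto simp: walk_density_nonneg)
  then show "integrable lborel (\<lambda>t. norm (char \<mu> t) ^ (2 * n\<^sub>0))"
    by (simp add: char_law norm_power power_mult[symmetric] mult.commute)
qed (use integrable_\<mu> integral_\<mu> in auto)

lemma char_power_integrable:
  assumes "2 * n\<^sub>0 \<le> n"
  shows "integrable lborel (\<lambda>t. char \<mu> t ^ n)"
proof (rule integrable_le[OF \<mu>.integrable_char_power])
  show "norm (char \<mu> t ^ n) \<le> norm (char \<mu> t) ^ (2 * n\<^sub>0)" for t
    unfolding norm_power by (rule power_decreasing[OF assms]) (auto intro: \<mu>.cmod_char_le_1)
qed measurable

lemma walk_density_AE_inversion:
  assumes n: "2 * n\<^sub>0 \<le> n"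
  shows "AE x in lborel. walk_density f n x = Re (inv_fourier (\<lambda>t. char \<mu> t ^ n) x)"
proof -
  interpret L: real_distribution "law n" by (rule real_distribution_law)
  have c: "char (law n) = (\<lambda>t. char \<mu> t ^ n)" by (simp add: char_law fun_eq_iff)
  have "AE x in lborel. walk_density f n x = Re (inv_fourier (char (law n)) x)"
    by (rule L.char_inversion_density) (use n n0_pos char_power_integrable[OF n] in \<open>auto simp: c walk_density_nonneg intro!: law_eq_density\<close>)
  then show ?thesis by (simp only: c)
qed

text \<open>One more convolution turns the a.e. identity into one at every point, because the
  recursion integrates the previous density. Point values matter: the bridge evaluates its densities
  at 0 and at \<open>- u\<close>.\<close>

lemma walk_density_inversion:
  assumes n: "2 * n\<^sub>0 \<le> n"
  shows "walk_density f (Suc n) x = Re (inv_fourier (\<lambda>t. char \<mu> t ^ Suc n) x)"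
proof -
  define \<phi> where "\<phi> t = char \<mu> t ^ n" for t
  have \<phi>: "integrable lborel \<phi>" unfolding \<phi>_def by (rule char_power_integrable[OF n])
  define F where "F x = inv_fourier \<phi> x" for x
  have [measurable]: "F \<in> borel_measurable borel"
    unfolding F_def
    by (auto intro!: borel_measurable_continuous_onI continuous_at_imp_continuous_on continuous_inv_fourier \<phi>)
  have w: "integrable lborel (\<lambda>t. iexp (- (t * x)) * \<phi> t)" by (rule integrable_inv_fourier[OF \<phi>])
  have "walk_density f (Suc n) x = (\<integral>u. walk_density f n u * f (x - u) \<partial>lborel)"
    using n n0_pos by (cases n) auto
  also have "\<dots> = (\<integral>u. f (x - u) * Re (F u) \<partial>lborel)"
  proof (rule integral_cong_AE)
    show "AE u in lborel. walk_density f n u * f (x - u) = f (x - u) * Re (F u)"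
      using walk_density_AE_inversion[OF n]
      by eventually_elim (simp only: F_def \<phi>_def[abs_def] mult.commute)
  qed measurable
  also have "\<dots> = (\<integral>y. f y * Re (F (x - y)) \<partial>lborel)"
    using lborel_integral_real_affine[of "-1" "\<lambda>u. f (x - u) * Re (F u)" x] by simp
  also have "\<dots> = (\<integral>y. Re (F (x - y)) \<partial>\<mu>)"
    unfolding \<mu>_def by (subst integral_density) (auto simp: f_nonneg)
  also have "\<dots> = Re (\<integral>y. F (x - y) \<partial>\<mu>)"
  proof (rule integral_Re, rule \<mu>.integrable_const_bound)
    show "AE y in \<mu>. norm (F (x - y)) \<le> (\<integral>t. norm (\<phi> t) \<partial>lborel) / (2 * pi)"
    proof (rule AE_I2)
      fix y
      have "norm (\<integral>t. iexp (- (t * (x - y))) * \<phi> t \<partial>lborel) \<le> (\<integral>t. norm (iexp (- (t * (x - y))) * \<phi> t) \<partial>lborel)"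
        by (rule integral_norm_bound)
      then have "norm (\<integral>t. iexp (- (t * (x - y))) * \<phi> t \<partial>lborel) \<le> (\<integral>t. norm (\<phi> t) \<partial>lborel)"
        by (simp add: norm_mult)
      then show "norm (F (x - y)) \<le> (\<integral>t. norm (\<phi> t) \<partial>lborel) / (2 * pi)"
        by (simp add: F_def inv_fourier_def norm_mult norm_divide divide_right_mono)
    qed
  qed measurable
  also have "(\<integral>y. F (x - y) \<partial>\<mu>) = (\<integral>y. 1 / (2 * pi) * (\<integral>t. iexp (t * y) * (iexp (- (t * x)) * \<phi> t) \<partial>lborel) \<partial>\<mu>)"
  proof (intro Bochner_Integration.integral_cong refl)
    fix y
    have "(\<integral>t. iexp (- (t * (x - y))) * \<phi> t \<partial>lborel) = (\<integral>t. iexp (t * y) * (iexp (- (t * x)) * \<phi> t) \<partial>lborel)"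
    proof (intro Bochner_Integration.integral_cong refl)
      fix t
      have "- (t * (x - y)) = t * y + - (t * x)" by (simp add: algebra_simps)
      then have "iexp (- (t * (x - y))) = iexp (t * y) * iexp (- (t * x))"
        by (metis exp_add of_real_add distrib_left)
      then show "iexp (- (t * (x - y))) * \<phi> t = iexp (t * y) * (iexp (- (t * x)) * \<phi> t)"
        by (simp only: mult.assoc)
    qed
    then show "F (x - y) = 1 / (2 * pi) * (\<integral>t. iexp (t * y) * (iexp (- (t * x)) * \<phi> t) \<partial>lborel)"
      unfolding F_def inv_fourier_def by (simp only:)
  qed
  \<comment> \<open>Averaging \<open>iexp (t * y)\<close> over the extra increment supplies the
    missing factor \<open>char \<mu> t\<close>.\<close>
  also have "\<dots> = 1 / (2 * pi) * (\<integral>t. char \<mu> t * (iexp (- (t * x)) * \<phi> t) \<partial>lborel)"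
    unfolding \<mu>.char_parseval[OF w] by (rule integral_mult_right_zero)
  also have "\<dots> = inv_fourier (\<lambda>t. char \<mu> t ^ Suc n) x"
    unfolding inv_fourier_def \<phi>_def power_Suc by (simp only: mult_ac)
  finally show ?thesis .
qed

section \<open>Local limit theorem\<close>

lemma inv_fourier_gaussian: "inv_fourier (\<lambda>t. complex_of_real (exp (- t\<^sup>2 / 2))) y = complex_of_real (std_normal_density y)"
proof -
  have "(\<integral>t. iexp (- (t * y)) * complex_of_real (exp (- t\<^sup>2 / 2)) \<partial>lborel) = complex_of_real (2 * pi * normal_density 0 1 (- y))"
    using fourier_gaussian[of 1 "- y"] by (simp only: mult_1 mult_minus_right zero_less_one simp_thms)
  moreover have "normal_density 0 1 (- y) = normal_density 0 1 y" by (simp add: normal_density_def)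
  ultimately show ?thesis unfolding inv_fourier_def by simp
qed

lemma inv_fourier_scale:
  assumes "s > 0"
  shows "s * inv_fourier \<phi> (s * y) = inv_fourier (\<lambda>t. \<phi> (t / s)) y"
proof -
  have a: "0 + 1 / s * t = t / s" for t by simp
  have b: "- (t / s * (s * y)) = - (t * y)" for t using assms by simp
  have "(\<integral>t. iexp (- (t * (s * y))) * \<phi> t \<partial>lborel) = \<bar>1 / s\<bar> *\<^sub>R (\<integral>t. iexp (- (t / s * (s * y))) * \<phi> (t / s) \<partial>lborel)"
    by (subst lborel_integral_real_affine[of "1 / s" _ 0]) (use assms in \<open>simp_all only: a, simp_all\<close>)
  then have "(\<integral>t. iexp (- (t * (s * y))) * \<phi> t \<partial>lborel) = (1 / s) *\<^sub>R (\<integral>t. iexp (- (t * y)) * \<phi> (t / s) \<partial>lborel)"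
    using assms by (simp only: b abs_of_pos zero_less_divide_iff zero_less_one simp_thms)
  then show ?thesis unfolding inv_fourier_def using assms by (simp add: scaleR_conv_of_real)
qed

definition llt_error :: "nat \<Rightarrow> real" where
  "llt_error n = (\<integral>t. norm (char \<mu> (t / sqrt (real n)) ^ n - complex_of_real (exp (- t\<^sup>2 / 2))) \<partial>lborel) / (2 * pi)"

lemma llt_error_tendsto: "llt_error \<longlonglongrightarrow> 0"
  using tendsto_divide[OF \<mu>.integral_char_power_diff_tendsto(1) tendsto_const[of "2 * pi"]]
  unfolding llt_error_def[abs_def] by simp

lemma llt_error_nonneg: "0 \<le> llt_error n"
  unfolding llt_error_def by (intro divide_nonneg_nonneg Bochner_Integration.integral_nonneg) auto

text \<open>The L^1 norm of the difference of the rescaled characteristic functions bounds its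
  inverse transform for all \<open>y\<close> at once. Uniformity is essential, as \<open>y\<close>
  will be replaced by the random endpoint of the killed walk.\<close>

theorem local_limit_theorem:
  "\<forall>\<^sub>F n in sequentially. \<forall>y. \<bar>sqrt (real n) * walk_density f n (sqrt (real n) * y) - std_normal_density y\<bar> \<le> llt_error n"
  using \<mu>.integral_char_power_diff_tendsto(2) eventually_ge_at_top[of "Suc (2 * n\<^sub>0)"]
proof eventually_elim
  case (elim n)
  show ?case
  proof
    fix y
    define s where "s = sqrt (real n)"
    have s: "s > 0" using elim unfolding s_def by simp
    define \<phi> where "\<phi> t = char \<mu> (t / s) ^ n" for t
    define E where "E t = complex_of_real (exp (- t\<^sup>2 / 2))" for t
    have i\<phi>: "integrable lborel \<phi>" using elim(1) unfolding \<phi>_def s_def .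
    have iE: "integrable lborel E" unfolding E_def using integrable_gaussian[of 1] by (intro integrable_of_real) simp
    obtain n' where n': "n = Suc n'" "2 * n\<^sub>0 \<le> n'" using elim(2) by (cases n) auto
    have "s * walk_density f n (s * y) = Re (s * inv_fourier (\<lambda>t. char \<mu> t ^ n) (s * y))"
      using walk_density_inversion[OF n'(2), of "s * y"] n' by simp
    also have "\<dots> = Re (inv_fourier \<phi> y)" unfolding inv_fourier_scale[OF s] \<phi>_def ..
    finally have "s * walk_density f n (s * y) - std_normal_density y = Re (inv_fourier \<phi> y - inv_fourier E y)"
      using inv_fourier_gaussian[of y] unfolding E_def by simp
    also have "inv_fourier \<phi> y - inv_fourier E y = 1 / (2 * pi) * (\<integral>t. iexp (- (t * y)) * \<phi> t - iexp (- (t * y)) * E t \<partial>lborel)"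
      unfolding inv_fourier_def Bochner_Integration.integral_diff[OF integrable_inv_fourier[OF i\<phi>] integrable_inv_fourier[OF iE]]
      by (simp only: right_diff_distrib)
    finally have "\<bar>s * walk_density f n (s * y) - std_normal_density y\<bar> \<le> norm (1 / (2 * pi) * (\<integral>t. iexp (- (t * y)) * \<phi> t - iexp (- (t * y)) * E t \<partial>lborel))"
      by (simp only: abs_Re_le_cmod)
    also have "\<dots> = norm (\<integral>t. iexp (- (t * y)) * \<phi> t - iexp (- (t * y)) * E t \<partial>lborel) / (2 * pi)"
      by (simp add: norm_mult norm_divide)
    also have "\<dots> \<le> (\<integral>t. norm (iexp (- (t * y)) * \<phi> t - iexp (- (t * y)) * E t) \<partial>lborel) / (2 * pi)"
      by (intro divide_right_mono integral_norm_bound) simp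
    also have "(\<integral>t. norm (iexp (- (t * y)) * \<phi> t - iexp (- (t * y)) * E t) \<partial>lborel) = (\<integral>t. norm (\<phi> t - E t) \<partial>lborel)"
      unfolding right_diff_distrib[symmetric] norm_mult by simp
    finally show "\<bar>sqrt (real n) * walk_density f n (sqrt (real n) * y) - std_normal_density y\<bar> \<le> llt_error n"
      unfolding llt_error_def \<phi>_def E_def s_def .
  qed
qed

end

text \<open>Integrate \<open>(a s - a t) * (b s - b t)\<close>, which is nonnegative, over two
  independent points. This is Harris' inequality in one variable, and it drives the induction over
  increments.\<close>

lemma (in real_distribution) chebyshev_integral_inequality:
  fixes a b :: "real \<Rightarrow> real"
  assumes a: "mono a" "\<And>x. \<bar>a x\<bar> \<le> A" and b: "mono b" "\<And>x. \<bar>b x\<bar> \<le> B"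
  shows "expectation a * expectation b \<le> expectation (\<lambda>x. a x * b x)"
proof -
  have [measurable]: "a \<in> borel_measurable M" "b \<in> borel_measurable M"
    using borel_measurable_mono[OF a(1)] borel_measurable_mono[OF b(1)] by auto
  have ia: "integrable M a" by (rule integrable_const_bound[where B=A]) (use a in auto)
  have ib: "integrable M b" by (rule integrable_const_bound[where B=B]) (use b in auto)
  have iab: "integrable M (\<lambda>x. a x * b x)"
    by (rule integrable_const_bound[where B="A * B"])
       (use a b in \<open>auto simp: abs_mult intro!: mult_mono order_trans[OF abs_ge_zero a(2)]\<close>)
  have in0: "0 \<le> expectation (\<lambda>x. a x * b x) - b t * expectation a - a t * expectation b + a t * b t" for t
  proof -
    have "0 \<le> (\<integral>s. (a s - a t) * (b s - b t) \<partial>M)"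
    proof (rule Bochner_Integration.integral_nonneg)
      show "0 \<le> (a s - a t) * (b s - b t)" for s
        using monoD[OF a(1), of s t] monoD[OF a(1), of t s] monoD[OF b(1), of s t] monoD[OF b(1), of t s]
        by (cases "s \<le> t") (auto intro: mult_nonneg_nonneg mult_nonpos_nonpos)
    qed
    also have "(\<integral>s. (a s - a t) * (b s - b t) \<partial>M) = (\<integral>s. (a s * b s - b t * a s) - (a t * b s - a t * b t) \<partial>M)"
      by (intro Bochner_Integration.integral_cong refl) (simp add: algebra_simps)
    also have "\<dots> = expectation (\<lambda>x. a x * b x) - b t * expectation a - (a t * expectation b - a t * b t)"
      using iab ia ib prob_space by simp
    finally show ?thesis by simp
  qed
  have "0 \<le> (\<integral>t. (expectation (\<lambda>x. a x * b x) - b t * expectation a) - (a t * expectation b - a t * b t) \<partial>M)"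
    by (rule Bochner_Integration.integral_nonneg) (use in0 in \<open>simp add: algebra_simps\<close>)
  also have "\<dots> = expectation (\<lambda>x. a x * b x) - expectation b * expectation a
     - (expectation a * expectation b - expectation (\<lambda>x. a x * b x))"
    using iab ia ib prob_space by simp
  finally show ?thesis by (simp add: mult.commute)
qed

lemma integrable_bounded_mult:
  fixes H :: "real \<Rightarrow> real"
  assumes p: "integrable lborel p" and [measurable]: "H \<in> borel_measurable borel" and B: "\<And>x. \<bar>H x\<bar> \<le> B"
  shows "integrable lborel (\<lambda>y. H y * p y)"
proof (rule integrable_le)
  show "integrable lborel (\<lambda>y. B * \<bar>p y\<bar>)" using p by auto
  show "norm (H y * p y) \<le> B * \<bar>p y\<bar>" for y using B by (auto simp: abs_mult intro: mult_right_mono)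
qed (use p in measurable)

section \<open>Central limit theorem in total variation\<close>

context bounded_density_walk
begin

text \<open>For \<open>n >= 1\<close>, twice the total variation distance to the normal law.
  Convergence in this sense asks no regularity of test functions and is uniform over those with a
  common bound; below they vary with the starting point and the scale.\<close>

definition tv :: "nat \<Rightarrow> real" where
  "tv n = (\<integral>y. \<bar>sqrt (real n) * walk_density f n (sqrt (real n) * y) - std_normal_density y\<bar> \<partial>lborel)"

lemma walk_density_integrable:
  assumes "1 \<le> n"
  shows "integrable lborel (walk_density f n)" "(\<integral>y. walk_density f n y \<partial>lborel) = 1"
proof -
  have "(\<integral>\<^sup>+y. ennreal (walk_density f n y) \<partial>lborel) = emeasure (law n) UNIV"
    unfolding law_eq_density[OF assms] by (subst emeasure_density) auto
  also have "\<dots> = 1" using prob_space.emeasure_space_1[OF real_distribution.axioms(1)[OF real_distribution_law]] by simp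
  finally have 1: "(\<integral>\<^sup>+y. ennreal (walk_density f n y) \<partial>lborel) = 1" .
  then show "integrable lborel (walk_density f n)"
    by (intro integrableI_nonneg) (auto simp: walk_density_nonneg)
  show "(\<integral>y. walk_density f n y \<partial>lborel) = 1"
    using 1 by (subst integral_eq_nn_integral) (auto simp: walk_density_nonneg)
qed

lemma scaled_density_integrable:
  assumes "1 \<le> n"
  shows "integrable lborel (\<lambda>y. sqrt (real n) * walk_density f n (sqrt (real n) * y))"
    "(\<integral>y. sqrt (real n) * walk_density f n (sqrt (real n) * y) \<partial>lborel) = 1"
proof -
  have s: "sqrt (real n) > 0" using assms by simp
  have a: "0 + sqrt (real n) * y = sqrt (real n) * y" for y by simp
  show "integrable lborel (\<lambda>y. sqrt (real n) * walk_density f n (sqrt (real n) * y))"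
    using lborel_integrable_real_affine[OF walk_density_integrable(1)[OF assms], of "sqrt (real n)" 0, unfolded a] s
    by (intro integrable_mult_right) simp
  show "(\<integral>y. sqrt (real n) * walk_density f n (sqrt (real n) * y) \<partial>lborel) = 1"
    using lborel_integral_real_affine[of "sqrt (real n)" "walk_density f n" 0, unfolded a] s
      walk_density_integrable(2)[OF assms] by simp
qed

text \<open>Scheffe's argument: for probability densities, \<open>\<integral>\<bar>p - q\<bar> = 2 \<integral>max 0 (q - p)\<close>, and the
  latter integrand is dominated by \<open>q\<close>.\<close>

lemma tv_tendsto: "tv \<longlonglongrightarrow> 0"
proof -
  define p where "p n y = sqrt (real n) * walk_density f n (sqrt (real n) * y)" for n y
  have [measurable]: "p n \<in> borel_measurable borel" for n unfolding p_def by measurable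
  have p0: "0 \<le> p n y" for n y unfolding p_def by (simp add: walk_density_nonneg)
  have ip: "integrable lborel (p n)" "(\<integral>y. p n y \<partial>lborel) = 1" if "1 \<le> n" for n
    using scaled_density_integrable[OF that] unfolding p_def[abs_def] by auto
  have lim: "(\<lambda>n. \<integral>y. max 0 (std_normal_density y - p n y) \<partial>lborel) \<longlonglongrightarrow> (\<integral>y. 0 \<partial>(lborel :: real measure))"
  proof (rule integral_dominated_convergence[where w=std_normal_density])
    show "AE y in lborel. (\<lambda>n. max 0 (std_normal_density y - p n y)) \<longlonglongrightarrow> 0"
    proof (rule AE_I2)
      fix y
      show "(\<lambda>n. max 0 (std_normal_density y - p n y)) \<longlonglongrightarrow> 0"
      proof (rule Lim_null_comparison[OF _ llt_error_tendsto])
        show "\<forall>\<^sub>F n in sequentially. norm (max 0 (std_normal_density y - p n y)) \<le> llt_error n"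
          using local_limit_theorem
        proof eventually_elim
          case (elim n)
          from elim[rule_format, of y] llt_error_nonneg[of n] show ?case unfolding p_def by auto
        qed
      qed
    qed
    show "AE y in lborel. norm (max 0 (std_normal_density y - p n y)) \<le> std_normal_density y" for n
      using p0[of n] by (intro AE_I2) (auto simp: max_def)
  qed auto
  have "\<forall>\<^sub>F n in sequentially. tv n = 2 * (\<integral>y. max 0 (std_normal_density y - p n y) \<partial>lborel)"
    using eventually_ge_at_top[of 1]
  proof eventually_elim
    case (elim n)
    have im: "integrable lborel (\<lambda>y. max 0 (std_normal_density y - p n y))"
      using ip(1)[OF elim] by (intro integrable_max) auto
    have "tv n = (\<integral>y. 2 * max 0 (std_normal_density y - p n y) + (p n y - std_normal_density y) \<partial>lborel)"
      unfolding tv_def p_def[symmetric] by (intro Bochner_Integration.integral_cong refl) (auto simp: max_def abs_if)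
    also have "\<dots> = 2 * (\<integral>y. max 0 (std_normal_density y - p n y) \<partial>lborel) + ((\<integral>y. p n y \<partial>lborel) - 1)"
      using im ip(1)[OF elim] by (subst Bochner_Integration.integral_add) auto
    finally show ?case using ip(2)[OF elim] by simp
  qed
  moreover have "(\<lambda>n. 2 * (\<integral>y. max 0 (std_normal_density y - p n y) \<partial>lborel)) \<longlonglongrightarrow> 0"
    using tendsto_mult_left[OF lim, of 2] by simp
  ultimately show ?thesis by (simp add: tendsto_cong)
qed

lemma integrable_bounded_walk:
  fixes F :: "real \<Rightarrow> real"
  assumes [measurable]: "F \<in> borel_measurable borel" and "\<And>x. \<bar>F x\<bar> \<le> B"
  shows "integrable M (\<lambda>\<omega>. F (walk X n \<omega>))"
  by (rule integrable_const_bound[where B=B]) (use assms in auto)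

lemma clt_total_variation:
  fixes H :: "real \<Rightarrow> real"
  assumes n: "1 \<le> n" and [measurable]: "H \<in> borel_measurable borel" and B: "\<And>x. \<bar>H x\<bar> \<le> B"
  shows "\<bar>(\<integral>\<omega>. H (walk X n \<omega> / sqrt (real n)) \<partial>M) - (\<integral>y. H y * std_normal_density y \<partial>lborel)\<bar> \<le> B * tv n"
proof -
  define p where "p y = sqrt (real n) * walk_density f n (sqrt (real n) * y)" for y
  have p: "integrable lborel p" using scaled_density_integrable(1)[OF n] unfolding p_def[abs_def] .
  have s: "sqrt (real n) > 0" using n by simp
  have "(\<integral>\<omega>. H (walk X n \<omega> / sqrt (real n)) \<partial>M) = (\<integral>x. H (x / sqrt (real n)) \<partial>law n)"
    unfolding law_def by (subst integral_distr) auto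
  also have "\<dots> = (\<integral>x. walk_density f n x * H (x / sqrt (real n)) \<partial>lborel)"
    unfolding law_eq_density[OF n] by (subst integral_density) (auto simp: walk_density_nonneg)
  also have "\<dots> = \<bar>sqrt (real n)\<bar> *\<^sub>R (\<integral>x. walk_density f n (0 + sqrt (real n) * x) * H ((0 + sqrt (real n) * x) / sqrt (real n)) \<partial>lborel)"
    by (rule lborel_integral_real_affine) (use s in simp)
  also have "\<dots> = (\<integral>x. sqrt (real n) * (walk_density f n (0 + sqrt (real n) * x) * H ((0 + sqrt (real n) * x) / sqrt (real n))) \<partial>lborel)"
    using s by simp
  also have "\<dots> = (\<integral>y. H y * p y \<partial>lborel)"
    using s unfolding p_def by (intro Bochner_Integration.integral_cong refl) simp
  finally have eq: "(\<integral>\<omega>. H (walk X n \<omega> / sqrt (real n)) \<partial>M) = (\<integral>y. H y * p y \<partial>lborel)" .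
  have i1: "integrable lborel (\<lambda>y. H y * p y)" by (rule integrable_bounded_mult[OF p _ B]) measurable
  have i2: "integrable lborel (\<lambda>y. H y * std_normal_density y)"
    by (rule integrable_bounded_mult[OF integrable_normal_density[OF zero_less_one] assms(2) B])
  have id: "integrable lborel (\<lambda>y. \<bar>p y - std_normal_density y\<bar>)" using p by auto
  have "\<bar>(\<integral>y. H y * p y \<partial>lborel) - (\<integral>y. H y * std_normal_density y \<partial>lborel)\<bar> = \<bar>\<integral>y. H y * (p y - std_normal_density y) \<partial>lborel\<bar>"
    unfolding right_diff_distrib Bochner_Integration.integral_diff[OF i1 i2] ..
  also have "\<dots> \<le> (\<integral>y. \<bar>H y * (p y - std_normal_density y)\<bar> \<partial>lborel)" by (rule integral_abs_bound)
  also have "\<dots> \<le> (\<integral>y. B * \<bar>p y - std_normal_density y\<bar> \<partial>lborel)"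
  proof (rule integral_mono)
    show "integrable lborel (\<lambda>y. \<bar>H y * (p y - std_normal_density y)\<bar>)"
      unfolding right_diff_distrib using i1 i2 by auto
    show "\<bar>H y * (p y - std_normal_density y)\<bar> \<le> B * \<bar>p y - std_normal_density y\<bar>" for y
      unfolding abs_mult by (rule mult_right_mono[OF B]) simp
  qed (use id in auto)
  also have "\<dots> = B * tv n" unfolding tv_def p_def by simp
  finally show ?thesis unfolding eq .
qed

lemma walk_second_moment:
  "integrable M (\<lambda>\<omega>. (walk X r \<omega>)\<^sup>2)" "integrable M (walk X r)" "(\<integral>\<omega>. walk X r \<omega> \<partial>M) = 0" "(\<integral>\<omega>. (walk X r \<omega>)\<^sup>2 \<partial>M) = real r"
proof -
  have "integrable M (\<lambda>\<omega>. (walk X r \<omega>)\<^sup>2) \<and> integrable M (walk X r) \<and> (\<integral>\<omega>. walk X r \<omega> \<partial>M) = 0 \<and> (\<integral>\<omega>. (walk X r \<omega>)\<^sup>2 \<partial>M) = real r"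
  proof (induction r)
    case (Suc r)
    have iX: "integrable M (X (Suc r))" "(\<integral>\<omega>. X (Suc r) \<omega> \<partial>M) = 0" using X_mean[of "Suc r"] by auto
    have iX2: "integrable M (\<lambda>\<omega>. (X (Suc r) \<omega>)\<^sup>2)" "(\<integral>\<omega>. (X (Suc r) \<omega>)\<^sup>2 \<partial>M) = 1" using X_square[of "Suc r"] by auto
    have iS: "integrable M (walk X r)" "(\<integral>\<omega>. walk X r \<omega> \<partial>M) = 0" "integrable M (\<lambda>\<omega>. (walk X r \<omega>)\<^sup>2)" "(\<integral>\<omega>. (walk X r \<omega>)\<^sup>2 \<partial>M) = real r"
      using Suc by auto
    have ip: "integrable M (\<lambda>\<omega>. X (Suc r) \<omega> * walk X r \<omega>)"
      by (rule indep_var_integrable[OF indep_X_walk iX(1) iS(1)])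
    have ep: "(\<integral>\<omega>. X (Suc r) \<omega> * walk X r \<omega> \<partial>M) = 0"
      using indep_var_lebesgue_integral[OF indep_X_walk iX(1) iS(1)] iX(2) by simp
    have sq: "(walk X (Suc r) \<omega>)\<^sup>2 = ((walk X r \<omega>)\<^sup>2 + 2 * (X (Suc r) \<omega> * walk X r \<omega>)) + (X (Suc r) \<omega>)\<^sup>2" for \<omega>
      unfolding walk_Suc by (simp add: power2_sum)
    have i2: "integrable M (\<lambda>\<omega>. (walk X r \<omega>)\<^sup>2 + 2 * (X (Suc r) \<omega> * walk X r \<omega>))"
      by (intro Bochner_Integration.integrable_add integrable_mult_right ip iS)
    have "(\<integral>\<omega>. (walk X (Suc r) \<omega>)\<^sup>2 \<partial>M) = (real r + 2 * 0) + 1"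
      unfolding sq Bochner_Integration.integral_add[OF i2 iX2(1)]
        Bochner_Integration.integral_add[OF iS(3) integrable_mult_right[OF ip]] integral_mult_right_zero ep iS(4) iX2(2) ..
    moreover have "integrable M (\<lambda>\<omega>. (walk X (Suc r) \<omega>)\<^sup>2)" unfolding sq by (intro Bochner_Integration.integrable_add i2 iX2)
    moreover have "integrable M (walk X (Suc r))" unfolding walk_Suc[abs_def] by (intro Bochner_Integration.integrable_add iS iX)
    moreover have "(\<integral>\<omega>. walk X (Suc r) \<omega> \<partial>M) = 0"
      unfolding walk_Suc Bochner_Integration.integral_add[OF iS(1) iX(1)] iS(2) iX(2) by simp
    ultimately show ?case by simp
  qed simp
  then show "integrable M (\<lambda>\<omega>. (walk X r \<omega>)\<^sup>2)" "integrable M (walk X r)" "(\<integral>\<omega>. walk X r \<omega> \<partial>M) = 0" "(\<integral>\<omega>. (walk X r \<omega>)\<^sup>2 \<partial>M) = real r"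
    by auto
qed

section \<open>Averages over the free walk\<close>

definition avg :: "nat \<Rightarrow> (real \<Rightarrow> real) \<Rightarrow> real \<Rightarrow> real" where
  "avg r F x = (\<integral>\<omega>. F (x + walk X r \<omega>) \<partial>M)"

lemma avg_0 [simp]: "avg 0 F x = F x"
  using prob_space by (simp add: avg_def)

lemma avg_measurable [measurable]:
  assumes [measurable]: "F \<in> borel_measurable borel"
  shows "avg r F \<in> borel_measurable borel"
  unfolding avg_def[abs_def] by measurable

lemma avg_law:
  assumes [measurable]: "F \<in> borel_measurable borel"
  shows "avg r F x = (\<integral>y. F (x + y) \<partial>law r)"
  unfolding avg_def law_def by (subst integral_distr) auto

lemma avg_bounded:
  assumes [measurable]: "F \<in> borel_measurable borel" and B: "\<And>x. \<bar>F x\<bar> \<le> B"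
  shows "\<bar>avg r F x\<bar> \<le> B"
proof -
  have i: "integrable M (\<lambda>\<omega>. F (x + walk X r \<omega>))"
    by (rule integrable_const_bound[where B=B]) (use B in auto)
  have "\<bar>avg r F x\<bar> \<le> (\<integral>\<omega>. \<bar>F (x + walk X r \<omega>)\<bar> \<partial>M)" unfolding avg_def by (rule integral_abs_bound)
  also have "\<dots> \<le> B" by (rule integral_le_const) (use i B in auto)
  finally show ?thesis .
qed

text \<open>The increment split off is the last of the block, yet it will serve as the next step of
  the killed walk. The increments are independent with common law \<open>\<mu>\<close>, so their
  order is immaterial.\<close>

lemma avg_Suc:
  assumes [measurable]: "F \<in> borel_measurable borel" and B: "\<And>x. \<bar>F x\<bar> \<le> B"
  shows "avg (Suc r) F x = (\<integral>t. avg r F (x + t) \<partial>\<mu>)"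
proof -
  interpret L: real_distribution "law r" by (rule real_distribution_law)
  interpret P: pair_prob_space \<mu> "law r" ..
  have J: "distr M (borel \<Otimes>\<^sub>M borel) (\<lambda>\<omega>. (X (Suc r) \<omega>, walk X r \<omega>)) = \<mu> \<Otimes>\<^sub>M law r"
    using indep_X_walk[of r] unfolding indep_var_distribution_eq law_def by (simp add: distr_X)
  have [measurable]: "X (Suc r) \<in> borel_measurable M" by (rule X_measurable) simp
  have i: "integrable (\<mu> \<Otimes>\<^sub>M law r) (\<lambda>p. F (x + fst p + snd p))"
    by (rule P.integrable_const_bound[where B=B]) (use B in auto)
  have "avg (Suc r) F x = (\<integral>\<omega>. F (x + X (Suc r) \<omega> + walk X r \<omega>) \<partial>M)"
    unfolding avg_def by (simp add: walk_Suc ac_simps)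
  also have "\<dots> = (\<integral>p. F (x + fst p + snd p) \<partial>distr M (borel \<Otimes>\<^sub>M borel) (\<lambda>\<omega>. (X (Suc r) \<omega>, walk X r \<omega>)))"
    by (subst integral_distr) auto
  also have "\<dots> = (\<integral>t. (\<integral>s. F (x + t + s) \<partial>law r) \<partial>\<mu>)"
    unfolding J using P.integral_fst'[OF i] by simp
  finally show ?thesis by (simp add: avg_law)
qed

lemma avg_mono:
  assumes "mono F" and B: "\<And>x. \<bar>F x\<bar> \<le> B"
  shows "mono (avg r F)"
proof
  fix x y :: real assume xy: "x \<le> y"
  have [measurable]: "F \<in> borel_measurable borel" by (rule borel_measurable_mono[OF assms(1)])
  have i: "integrable M (\<lambda>\<omega>. F (z + walk X r \<omega>))" for z
    by (rule integrable_const_bound[where B=B]) (use B in auto)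
  show "avg r F x \<le> avg r F y"
    unfolding avg_def using xy by (intro integral_mono i monoD[OF assms(1)]) simp
qed

end

section \<open>Walks killed at a moving boundary\<close>

locale boundary_walk = bounded_density_walk M X f n\<^sub>0 C\<^sub>0
  for M :: "'a measure" and X f n\<^sub>0 C\<^sub>0 +
  fixes g :: "nat \<Rightarrow> real"
  assumes g_small: "g \<in> o(\<lambda>i. sqrt (real i))"
    and alive_pos: "1 \<le> n \<Longrightarrow> 0 < measure M (survival_event M X g n)"
begin

abbreviation alive :: "nat \<Rightarrow> 'a set" where "alive \<equiv> survival_event M X g"

lemma alive_eq: "alive n = {\<omega> \<in> space M. \<forall>j\<in>{1..n}. g j < walk X j \<omega>}"
proof -
  have "enat n < hitting_time X g \<omega> \<longleftrightarrow> (\<forall>j\<in>{1..n}. g j < walk X j \<omega>)" for \<omega>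
  proof -
    \<comment> \<open>An infimum is characterised by its lower bounds, so the strict inequality is
      first turned into a weak one at \<open>Suc n\<close>.\<close>
    have "enat n < hitting_time X g \<omega> \<longleftrightarrow> enat (Suc n) \<le> hitting_time X g \<omega>"
      by (rule Suc_ile_eq[symmetric])
    also have "\<dots> \<longleftrightarrow> (\<forall>i. 1 \<le> i \<and> walk X i \<omega> \<le> g i \<longrightarrow> Suc n \<le> i)"
      unfolding hitting_time_def le_INF_iff by auto
    also have "\<dots> \<longleftrightarrow> (\<forall>j\<in>{1..n}. g j < walk X j \<omega>)"
      by (meson atLeastAtMost_iff linorder_not_less not_less_eq_eq)
    finally show ?thesis .
  qed
  then show ?thesis unfolding survival_event_def by simp
qed

lemma alive_sets [measurable]: "alive n \<in> sets M"
  unfolding alive_eq by measurable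

lemma alive_0: "alive 0 = space M"
  by (auto simp: alive_eq)

lemma alive_Suc: "alive (Suc n) = {\<omega> \<in> alive n. g (Suc n) < walk X (Suc n) \<omega>}"
  unfolding alive_eq by (auto simp: atLeastAtMostSuc_conv)

lemma alive_antimono: "m \<le> n \<Longrightarrow> alive n \<subseteq> alive m"
  unfolding alive_eq by auto

lemma alive_above: "1 \<le> n \<Longrightarrow> \<omega> \<in> alive n \<Longrightarrow> g n < walk X n \<omega>"
  unfolding alive_eq by auto

section \<open>Survival probabilities and the Markov property of the killed walk\<close>

definition q :: "nat \<Rightarrow> real" where "q n = measure M (alive n)"

definition K :: "nat \<Rightarrow> (real \<Rightarrow> real) \<Rightarrow> real" where
  "K n F = (\<integral>\<omega>. indicator (alive n) \<omega> * F (walk X n \<omega>) \<partial>M)"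

lemma q_nonneg: "0 \<le> q n"
  by (simp add: q_def)

lemma q_antimono: "m \<le> n \<Longrightarrow> q n \<le> q m"
  unfolding q_def by (intro finite_measure_mono alive_antimono) auto

lemma q_pos: "0 < q n"
  using alive_pos[of "Suc n"] q_antimono[of n "Suc n"] unfolding q_def by simp

lemma integral_alive: "(\<integral>\<omega>. indicator (alive n) \<omega> * c \<partial>M) = c * q n"
  unfolding q_def by simp

lemma integrable_alive:
  fixes F :: "'a \<Rightarrow> real"
  assumes "integrable M F"
  shows "integrable M (\<lambda>\<omega>. indicator (alive n) \<omega> * F \<omega>)"
  using integrable_mult_indicator[OF alive_sets assms, of n] by simp

text \<open>Markov property at time \<open>n\<close>: endpoint and survival are functions of the
  first \<open>n\<close> increments, hence jointly independent of the next one, which Fubini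
  integrates out.\<close>

lemma alive_indep:
  fixes F :: "real \<Rightarrow> real \<Rightarrow> real"
  assumes F [measurable]: "case_prod F \<in> borel_measurable (borel \<Otimes>\<^sub>M borel)"
    and int: "integrable M (\<lambda>\<omega>. F (walk X n \<omega>) (X (Suc n) \<omega>))"
  shows "(\<integral>\<omega>. indicator (alive n) \<omega> * F (walk X n \<omega>) (X (Suc n) \<omega>) \<partial>M) =
    (\<integral>\<omega>. indicator (alive n) \<omega> * (\<integral>t. F (walk X n \<omega>) t \<partial>\<mu>) \<partial>M)"
proof -
  have F' [measurable]: "(\<lambda>x. F (h x) (k x)) \<in> borel_measurable N" 
    if "h \<in> borel_measurable N" "k \<in> borel_measurable N" for h k and N :: "'b measure"
    using measurable_compose[OF measurable_Pair[OF that] F] by simp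
  \<comment> \<open>Survival as a product of indicators makes endpoint and survival a single
    measurable map on the coordinate space.\<close>
  define Y1 where "Y1 x = (\<Sum>i=1..n. x i, \<Prod>j\<in>{1..n}. indicator {g j<..} (\<Sum>i=1..j. x i) :: real)" for x :: "nat \<Rightarrow> real"
  define Y where "Y \<omega> = (walk X n \<omega>, indicator (alive n) \<omega> :: real)" for \<omega>
  have [measurable]: "X (Suc n) \<in> borel_measurable M" by (rule X_measurable) simp
  have Y1 [measurable]: "Y1 \<in> measurable (PiM {1..n} (\<lambda>_. borel)) (borel \<Otimes>\<^sub>M borel)"
  proof -
    have s: "(\<lambda>x. \<Sum>i=1..j. x i) \<in> borel_measurable (PiM {1..n} (\<lambda>_. borel :: real measure))" if "j \<le> n" for j
      using that by (intro borel_measurable_sum measurable_component_singleton) auto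
    have ind: "(\<lambda>y. indicator {g j<..} y :: real) \<in> borel_measurable borel" for j by measurable
    show ?thesis unfolding Y1_def
      by (intro measurable_Pair s order_refl borel_measurable_prod measurable_compose[OF s ind]) auto
  qed
  have "indep_var (PiM {1..n} (\<lambda>_. borel)) (\<lambda>\<omega>. restrict (\<lambda>i. X i \<omega>) {1..n}) (PiM {Suc n} (\<lambda>_. borel)) (\<lambda>\<omega>. restrict (\<lambda>i. X i \<omega>) {Suc n})"
    by (rule indep_var_restrict[OF indep]) auto
  then have ind: "indep_var (borel \<Otimes>\<^sub>M borel) (Y1 \<circ> (\<lambda>\<omega>. restrict (\<lambda>i. X i \<omega>) {1..n})) (borel \<Otimes>\<^sub>M borel) ((\<lambda>x. (x (Suc n), 0)) \<circ> (\<lambda>\<omega>. restrict (\<lambda>i. X i \<omega>) {Suc n}))"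
    by (rule indep_var_compose[OF _ Y1]) (intro measurable_Pair measurable_component_singleton measurable_const, auto)
  define Z where "Z = Y1 \<circ> (\<lambda>\<omega>. restrict (\<lambda>i. X i \<omega>) {1..n})"
  have ZY: "Z \<omega> = Y \<omega>" if space: "\<omega> \<in> space M" for \<omega>
  proof -
    have s: "(\<Sum>i=1..j. restrict (\<lambda>i. X i \<omega>) {1..n} i) = walk X j \<omega>" if "j \<le> n" for j
      unfolding walk_def using that by (intro sum.cong) auto
    have "(\<Prod>j\<in>{1..n}. indicator {g j<..} (\<Sum>i=1..j. restrict (\<lambda>i. X i \<omega>) {1..n} i)) = (\<Prod>j\<in>{1..n}. indicator {g j<..} (walk X j \<omega>) :: real)"
      using s by (intro prod.cong) auto
    also have "\<dots> = indicator (alive n) \<omega>"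
    proof (cases "\<omega> \<in> alive n")
      case True
      then show ?thesis by (auto simp: alive_eq)
    next
      case False
      then obtain j where "j \<in> {1..n}" "\<not> g j < walk X j \<omega>" using space by (auto simp: alive_eq)
      then show ?thesis using False by (auto simp: prod_zero_iff intro!: bexI[of _ j])
    qed
    finally show ?thesis unfolding Z_def Y1_def Y_def comp_def using s[of n] by simp
  qed
  have Z [measurable]: "Z \<in> measurable M (borel \<Otimes>\<^sub>M borel)"
    using ind unfolding Z_def by (rule indep_var_rv1)
  \<comment> \<open>\<open>indep_var\<close> requires equal value types, hence the dummy component.\<close>
  define W where "W \<omega> = (X (Suc n) \<omega>, 0::real)" for \<omega>
  have [measurable]: "W \<in> measurable M (borel \<Otimes>\<^sub>M borel)" unfolding W_def by measurable
  have ind': "indep_var (borel \<Otimes>\<^sub>M borel) Z (borel \<Otimes>\<^sub>M borel) W"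
    using ind by (simp add: Z_def comp_def W_def[abs_def])
  define Q where "Q = distr M (borel \<Otimes>\<^sub>M borel) Z"
  interpret Q: prob_space Q unfolding Q_def by (rule prob_space_distr) simp
  have [measurable_cong]: "sets Q = sets (borel \<Otimes>\<^sub>M borel)" by (simp add: Q_def)
  define R where "R = distr M (borel \<Otimes>\<^sub>M borel) W"
  interpret R: prob_space R unfolding R_def by (rule prob_space_distr) simp
  have [measurable_cong]: "sets R = sets (borel \<Otimes>\<^sub>M borel)" by (simp add: R_def)
  interpret P: pair_prob_space Q R ..
  have J: "Q \<Otimes>\<^sub>M R = distr M ((borel \<Otimes>\<^sub>M borel) \<Otimes>\<^sub>M (borel \<Otimes>\<^sub>M borel)) (\<lambda>\<omega>. (Z \<omega>, W \<omega>))"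
    using ind' unfolding indep_var_distribution_eq Q_def R_def by simp
  define H where "H p = snd (fst p) * F (fst (fst p)) (fst (snd p))" for p :: "(real \<times> real) \<times> real \<times> real"
  have [measurable]: "H \<in> borel_measurable ((borel \<Otimes>\<^sub>M borel) \<Otimes>\<^sub>M (borel \<Otimes>\<^sub>M borel))" unfolding H_def by measurable
  have HZ: "H (Z \<omega>, W \<omega>) = indicator (alive n) \<omega> * F (walk X n \<omega>) (X (Suc n) \<omega>)" if "\<omega> \<in> space M" for \<omega>
    using ZY[OF that] by (simp add: H_def Y_def W_def)
  have "integrable M (\<lambda>\<omega>. H (Z \<omega>, W \<omega>))"
    using integrable_alive[OF int, of n] HZ by (subst Bochner_Integration.integrable_cong[OF refl HZ]) auto
  then have iH: "integrable (Q \<Otimes>\<^sub>M R) H"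
    unfolding J by (subst integrable_distr_eq) auto
  have "(\<integral>\<omega>. indicator (alive n) \<omega> * F (walk X n \<omega>) (X (Suc n) \<omega>) \<partial>M) = (\<integral>\<omega>. H (Z \<omega>, W \<omega>) \<partial>M)"
    by (rule Bochner_Integration.integral_cong) (simp_all add: HZ)
  also have "\<dots> = (\<integral>p. H p \<partial>(Q \<Otimes>\<^sub>M R))"
    unfolding J by (subst integral_distr) auto
  also have "\<dots> = (\<integral>y. (\<integral>w. H (y, w) \<partial>R) \<partial>Q)"
    by (rule P.integral_fst'[OF iH, symmetric])
  also have "\<dots> = (\<integral>\<omega>. (\<integral>w. H (Z \<omega>, w) \<partial>R) \<partial>M)"
    unfolding Q_def by (subst integral_distr) auto
  also have "\<dots> = (\<integral>\<omega>. indicator (alive n) \<omega> * (\<integral>t. F (walk X n \<omega>) t \<partial>\<mu>) \<partial>M)"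
  proof (rule Bochner_Integration.integral_cong[OF refl])
    fix \<omega> assume "\<omega> \<in> space M"
    have Hz: "(\<lambda>w. H (z, w)) \<in> borel_measurable (borel \<Otimes>\<^sub>M borel)" for z
      unfolding H_def fst_conv snd_conv by (intro borel_measurable_times F') auto
    have "(\<integral>w. H (Z \<omega>, w) \<partial>R) = (\<integral>\<omega>'. H (Z \<omega>, W \<omega>') \<partial>M)"
      unfolding R_def by (subst integral_distr[OF _ Hz]) auto
    also have "\<dots> = snd (Z \<omega>) * (\<integral>\<omega>'. F (fst (Z \<omega>)) (X (Suc n) \<omega>') \<partial>M)"
      by (simp add: H_def W_def)
    also have "(\<integral>\<omega>'. F (fst (Z \<omega>)) (X (Suc n) \<omega>') \<partial>M) = (\<integral>t. F (fst (Z \<omega>)) t \<partial>\<mu>)"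
      by (rule expectation_X) auto
    finally show "(\<integral>w. H (Z \<omega>, w) \<partial>R) = indicator (alive n) \<omega> * (\<integral>t. F (walk X n \<omega>) t \<partial>\<mu>)"
      using ZY[OF \<open>\<omega> \<in> space M\<close>] by (simp add: Y_def)
  qed
  finally show ?thesis .
qed

lemma alive_step:
  fixes F :: "real \<Rightarrow> real"
  assumes [measurable]: "F \<in> borel_measurable borel"
    and int: "integrable M (\<lambda>\<omega>. F (walk X (Suc n) \<omega>))"
  shows "(\<integral>\<omega>. indicator (alive n) \<omega> * F (walk X (Suc n) \<omega>) \<partial>M) = K n (\<lambda>x. \<integral>t. F (x + t) \<partial>\<mu>)"
  using alive_indep[of "\<lambda>x t. F (x + t)" n] int unfolding K_def walk_Suc by simp

lemma alive_indep_X: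
  fixes b :: "real \<Rightarrow> real"
  assumes [measurable]: "b \<in> borel_measurable borel" and int: "integrable \<mu> b"
  shows "(\<integral>\<omega>. indicator (alive n) \<omega> * b (X (Suc n) \<omega>) \<partial>M) = q n * (\<integral>t. b t \<partial>\<mu>)"
proof -
  have "integrable M (\<lambda>\<omega>. b (X (Suc n) \<omega>))" using int by (subst integrable_X_iff) auto
  with alive_indep[of "\<lambda>x t. b t" n] show ?thesis by (simp add: integral_alive mult.commute q_def)
qed

text \<open>The one-step form of optional stopping. The mean changes only on paths killed at this
  step. Their mass \<open>q n - q (Suc n)\<close> telescopes over many steps, while exceptional
  jumps, collected in \<open>b\<close>, are independent of the past and cost \<open>q n\<close>
  times an integral over one increment.\<close>

lemma killed_step:
  fixes F b :: "real \<Rightarrow> real"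
  assumes [measurable]: "F \<in> borel_measurable borel" "b \<in> borel_measurable borel"
    and int: "integrable M (\<lambda>\<omega>. F (walk X (Suc n) \<omega>))" and intb: "integrable \<mu> b"
    and n: "1 \<le> n" and b: "\<And>t. 0 \<le> b t"
    and bound: "\<And>x t. g n < x \<Longrightarrow> x + t \<le> g (Suc n) \<Longrightarrow> \<bar>F (x + t)\<bar> \<le> a + b t"
  shows "\<bar>K n (\<lambda>x. \<integral>t. F (x + t) \<partial>\<mu>) - K (Suc n) F\<bar> \<le> a * (q n - q (Suc n)) + q n * (\<integral>t. b t \<partial>\<mu>)"
proof -
  have [measurable]: "X (Suc n) \<in> borel_measurable M" by (rule X_measurable) simp
  have i1: "integrable M (\<lambda>\<omega>. indicator (alive n) \<omega> * F (walk X (Suc n) \<omega>))"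
    and i2: "integrable M (\<lambda>\<omega>. indicator (alive (Suc n)) \<omega> * F (walk X (Suc n) \<omega>))"
    by (rule integrable_alive[OF int])+
  have ib: "integrable M (\<lambda>\<omega>. indicator (alive n) \<omega> * b (X (Suc n) \<omega>))"
    by (rule integrable_alive) (use intb in \<open>subst integrable_X_iff, auto\<close>)
  have ia: "integrable M (\<lambda>\<omega>. indicator (alive m) \<omega> * a)" for m by (rule integrable_alive) simp
  have diff: "K n (\<lambda>x. \<integral>t. F (x + t) \<partial>\<mu>) - K (Suc n) F =
    (\<integral>\<omega>. indicator (alive n) \<omega> * F (walk X (Suc n) \<omega>) - indicator (alive (Suc n)) \<omega> * F (walk X (Suc n) \<omega>) \<partial>M)"
    unfolding alive_step[OF assms(1) int, symmetric] Bochner_Integration.integral_diff[OF i1 i2] K_def[of "Suc n" F] ..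
  have "\<bar>K n (\<lambda>x. \<integral>t. F (x + t) \<partial>\<mu>) - K (Suc n) F\<bar> \<le>
      (\<integral>\<omega>. \<bar>indicator (alive n) \<omega> * F (walk X (Suc n) \<omega>) - indicator (alive (Suc n)) \<omega> * F (walk X (Suc n) \<omega>)\<bar> \<partial>M)"
    unfolding diff by (rule integral_abs_bound)
  also have "\<dots> \<le> (\<integral>\<omega>. (indicator (alive n) \<omega> * a - indicator (alive (Suc n)) \<omega> * a) + indicator (alive n) \<omega> * b (X (Suc n) \<omega>) \<partial>M)"
  proof (rule integral_mono)
    fix \<omega> assume "\<omega> \<in> space M"
    show "\<bar>indicator (alive n) \<omega> * F (walk X (Suc n) \<omega>) - indicator (alive (Suc n)) \<omega> * F (walk X (Suc n) \<omega>)\<bar> \<le>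
      (indicator (alive n) \<omega> * a - indicator (alive (Suc n)) \<omega> * a) + indicator (alive n) \<omega> * b (X (Suc n) \<omega>)"
    proof (cases "\<omega> \<in> alive n")
      case True
      show ?thesis
      proof (cases "\<omega> \<in> alive (Suc n)")
        case False
        then have "walk X n \<omega> + X (Suc n) \<omega> \<le> g (Suc n)" using True by (auto simp: alive_Suc walk_Suc)
        from bound[OF alive_above[OF n True] this] show ?thesis
          using True False by (simp add: walk_Suc)
      qed (use True b in simp)
    next
      case False
      then have "\<omega> \<notin> alive (Suc n)" using alive_antimono[of n "Suc n"] by auto
      then show ?thesis using False by simp
    qed
  qed (use i1 i2 ia ib in auto)
  also have "\<dots> = (\<integral>\<omega>. indicator (alive n) \<omega> * a \<partial>M) - (\<integral>\<omega>. indicator (alive (Suc n)) \<omega> * a \<partial>M) + q n * (\<integral>t. b t \<partial>\<mu>)"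
    using ia ib alive_indep_X[OF assms(2) intb, of n]
    by (simp del: integral_indicator)
  also have "\<dots> = a * (q n - q (Suc n)) + q n * (\<integral>t. b t \<partial>\<mu>)"
    unfolding integral_alive by (simp add: right_diff_distrib)
  finally show ?thesis .
qed

text \<open>Ignoring the boundary at step \<open>Suc n\<close> only increases a nonnegative
  functional, and a centred increment of variance 1 adds 1 to the square.\<close>

lemma K_square_Suc: "K (Suc n) (\<lambda>x. x\<^sup>2) \<le> K n (\<lambda>x. x\<^sup>2) + q n"
proof -
  have "K (Suc n) (\<lambda>x. x\<^sup>2) \<le> (\<integral>\<omega>. indicator (alive n) \<omega> * (walk X (Suc n) \<omega>)\<^sup>2 \<partial>M)"
    unfolding K_def
  proof (rule integral_mono)
    show "indicator (alive (Suc n)) \<omega> * (walk X (Suc n) \<omega>)\<^sup>2 \<le> indicator (alive n) \<omega> * (walk X (Suc n) \<omega>)\<^sup>2" for \<omega>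
      using alive_antimono[of n "Suc n"] by (auto simp: indicator_def)
  qed (intro integrable_alive walk_second_moment(1))+
  also have "\<dots> = K n (\<lambda>x. \<integral>t. (x + t)\<^sup>2 \<partial>\<mu>)"
    by (rule alive_step) (use walk_second_moment(1) in auto)
  also have "(\<lambda>x. \<integral>t. (x + t)\<^sup>2 \<partial>\<mu>) = (\<lambda>x. x\<^sup>2 + 1)"
  proof
    fix x
    have "(\<integral>t. (x + t)\<^sup>2 \<partial>\<mu>) = (\<integral>t. (x\<^sup>2 + 2 * x * t) + t\<^sup>2 \<partial>\<mu>)" by (simp add: power2_sum ac_simps)
    also have "\<dots> = x\<^sup>2 + 1" using integrable_\<mu> integral_\<mu> \<mu>.prob_space by simp
    finally show "(\<integral>t. (x + t)\<^sup>2 \<partial>\<mu>) = x\<^sup>2 + 1" .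
  qed
  also have "K n (\<lambda>x. x\<^sup>2 + 1) = K n (\<lambda>x. x\<^sup>2) + q n"
  proof -
    have "integrable M (\<lambda>\<omega>. indicator (alive n) \<omega> * (walk X n \<omega>)\<^sup>2)" "integrable M (\<lambda>\<omega>. indicator (alive n) \<omega> * (1::real))"
      by (intro integrable_alive walk_second_moment(1), rule integrable_alive) simp
    from Bochner_Integration.integral_add[OF this] show ?thesis
      unfolding K_def distrib_left integral_alive by simp
  qed
  finally show ?thesis .
qed

lemma K_square_le_sum: "K n (\<lambda>x. x\<^sup>2) \<le> (\<Sum>i<n. q i)"
proof (induction n)
  case (Suc n)
  then show ?case using K_square_Suc[of n] by simp
qed (simp add: K_def)

text \<open>The backward semigroup of the killed walk: the mean of \<open>F\<close> after
  \<open>j\<close> more steps from \<open>x\<close> at time \<open>i\<close>, restricted to staying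
  above \<open>g\<close> at times \<open>i + 1\<close> to \<open>i + j\<close>. The recursion
  exposes one increment at a time, as Harris' inequality needs.\<close>

fun backward :: "nat \<Rightarrow> nat \<Rightarrow> (real \<Rightarrow> real) \<Rightarrow> real \<Rightarrow> real" where
  "backward 0 i F x = F x"
| "backward (Suc j) i F x = (\<integral>t. indicator {g (Suc i)<..} (x + t) * backward j (Suc i) F (x + t) \<partial>\<mu>)"

text \<open>Raising the starting point raises the whole path, which helps survival and increases
  \<open>F\<close> at the end.\<close>

lemma backward_props:
  assumes F: "mono F" "\<And>x. 0 \<le> F x" "\<And>x. F x \<le> 1"
  shows "mono (backward j i F) \<and> (\<forall>x. 0 \<le> backward j i F x \<and> backward j i F x \<le> 1)"
proof (induction j arbitrary: i)
  case (Suc j)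
  define H where "H y = indicator {g (Suc i)<..} y * backward j (Suc i) F y" for y
  have H01: "0 \<le> H y" "H y \<le> 1" for y using Suc[of "Suc i"] by (auto simp: H_def indicator_def)
  have Hm: "mono H" using Suc[of "Suc i"] by (auto simp: H_def indicator_def mono_def intro: order_trans)
  have [measurable]: "H \<in> borel_measurable borel" by (rule borel_measurable_mono[OF Hm])
  have i: "integrable \<mu> (\<lambda>t. H (x + t))" for x
    by (rule \<mu>.integrable_const_bound[where B=1]) (use H01 in auto)
  have eq: "backward (Suc j) i F x = (\<integral>t. H (x + t) \<partial>\<mu>)" for x by (simp add: H_def)
  have "mono (backward (Suc j) i F)" unfolding mono_def eq
    by (auto intro!: integral_mono i monoD[OF Hm])
  moreover have "0 \<le> backward (Suc j) i F x" for x unfolding eq using H01 by (intro Bochner_Integration.integral_nonneg) auto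
  moreover have "backward (Suc j) i F x \<le> 1" for x unfolding eq using H01 i by (intro \<mu>.integral_le_const) auto
  ultimately show ?case by blast
qed (use F in \<open>auto simp: mono_def\<close>)

text \<open>Duality: one step of the evolution can be moved from the killed law to the function it
  is applied to.\<close>

lemma K_backward:
  assumes F: "mono F" "\<And>x. 0 \<le> F x" "\<And>x. F x \<le> 1"
  shows "K i (backward j i F) = K (i + j) F"
proof (induction j arbitrary: i)
  case (Suc j)
  define H where "H y = indicator {g (Suc i)<..} y * backward j (Suc i) F y" for y
  note bp = backward_props[OF F, of j "Suc i"]
  have [measurable]: "backward j (Suc i) F \<in> borel_measurable borel" by (rule borel_measurable_mono) (use bp in blast)
  have [measurable]: "H \<in> borel_measurable borel" unfolding H_def by measurable
  have iH: "integrable M (\<lambda>\<omega>. H (walk X (Suc i) \<omega>))"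
    by (rule integrable_bounded_walk[where B=1]) (use bp in \<open>auto simp: H_def indicator_def\<close>)
  have "backward (Suc j) i F = (\<lambda>x. \<integral>t. H (x + t) \<partial>\<mu>)" by (rule ext) (simp add: H_def)
  then have "K i (backward (Suc j) i F) = K i (\<lambda>x. \<integral>t. H (x + t) \<partial>\<mu>)" by simp
  also have "\<dots> = (\<integral>\<omega>. indicator (alive i) \<omega> * H (walk X (Suc i) \<omega>) \<partial>M)"
    by (rule alive_step[symmetric]) (use iH in auto)
  also have "\<dots> = K (Suc i) (backward j (Suc i) F)"
    unfolding K_def by (rule Bochner_Integration.integral_cong) (auto simp: H_def alive_Suc indicator_def)
  also have "\<dots> = K (Suc i + j) F" by (rule Suc.IH)
  finally show ?case by (simp only: add_Suc add_Suc_right)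
next
  case 0
  have "backward 0 i F = F" by (rule ext) simp
  then show ?case by simp
qed

text \<open>Harris' inequality: survival is an increasing event, hence positively correlated with
  increasing functions of the endpoint.\<close>

lemma backward_harris:
  assumes F: "mono F" "\<And>x. 0 \<le> F x" "\<And>x. F x \<le> 1"
  shows "backward j i (\<lambda>_. 1) x * avg j F x \<le> backward j i F x"
proof (induction j arbitrary: i x)
  case (Suc j)
  note bp = backward_props[OF F, of j "Suc i"]
  have b1: "mono (backward j (Suc i) (\<lambda>_. 1))" "0 \<le> backward j (Suc i) (\<lambda>_. 1) y" "backward j (Suc i) (\<lambda>_. 1) y \<le> 1" for y
    using backward_props[of "\<lambda>_. 1" j "Suc i"] by (auto simp: mono_def)
  have Fb: "\<bar>F x\<bar> \<le> 1" for x using F(2)[of x] F(3)[of x] by simp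
  have [measurable]: "F \<in> borel_measurable borel" by (rule borel_measurable_mono[OF F(1)])
  have [measurable]: "backward j (Suc i) F \<in> borel_measurable borel" by (rule borel_measurable_mono) (use bp in blast)
  have [measurable]: "backward j (Suc i) (\<lambda>_. 1) \<in> borel_measurable borel" by (rule borel_measurable_mono[OF b1(1)])
  \<comment> \<open>In the single increment \<open>t\<close>, \<open>a\<close> is the survival part
    and \<open>b\<close> the endpoint part. Both are monotone, so Chebyshev's inequality decouples
    their means, and the induction hypothesis acts under the integral.\<close>
  define a where "a t = indicator {g (Suc i)<..} (x + t) * backward j (Suc i) (\<lambda>_. 1) (x + t)" for t
  define b where "b t = avg j F (x + t)" for t
  have am: "mono a" using b1 by (auto simp: a_def indicator_def mono_def intro: order_trans)
  have a1: "\<bar>a t\<bar> \<le> 1" for t using b1(2)[of "x + t"] b1(3)[of "x + t"] by (auto simp: a_def indicator_def)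
  have bm: "mono b" using avg_mono[OF F(1) Fb] unfolding b_def mono_def by auto
  have b1': "\<bar>b t\<bar> \<le> 1" for t unfolding b_def by (rule avg_bounded[OF _ Fb]) measurable
  have [measurable]: "a \<in> borel_measurable borel" "b \<in> borel_measurable borel"
    by (rule borel_measurable_mono[OF am] borel_measurable_mono[OF bm])+
  have "backward (Suc j) i (\<lambda>_. 1) x * avg (Suc j) F x = (\<integral>t. a t \<partial>\<mu>) * (\<integral>t. b t \<partial>\<mu>)"
    unfolding a_def b_def using avg_Suc[OF _ Fb] by simp
  also have "\<dots> \<le> (\<integral>t. a t * b t \<partial>\<mu>)"
    by (rule \<mu>.chebyshev_integral_inequality[OF am a1 bm b1'])
  also have "\<dots> \<le> (\<integral>t. indicator {g (Suc i)<..} (x + t) * backward j (Suc i) F (x + t) \<partial>\<mu>)"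
  proof (rule integral_mono)
    have "\<bar>a t * b t\<bar> \<le> 1" for t unfolding abs_mult using a1[of t] b1'[of t] by (simp add: mult_le_one)
    then show "integrable \<mu> (\<lambda>t. a t * b t)"
      by (intro \<mu>.integrable_const_bound[where B=1]) auto
    show "integrable \<mu> (\<lambda>t. indicator {g (Suc i)<..} (x + t) * backward j (Suc i) F (x + t))"
      by (intro \<mu>.integrable_const_bound[where B=1]) (use bp in \<open>auto simp: indicator_def\<close>)
    show "a t * b t \<le> indicator {g (Suc i)<..} (x + t) * backward j (Suc i) F (x + t)" for t
      using Suc.IH[of "Suc i" "x + t"] unfolding a_def b_def by (auto simp: indicator_def)
  qed
  finally show ?case by simp
qed simp

lemma survival_positively_correlated:
  assumes F: "mono F" "\<And>x. 0 \<le> F x" "\<And>x. F x \<le> 1"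
  shows "q n * (\<integral>\<omega>. F (walk X n \<omega>) \<partial>M) \<le> K n F"
proof -
  have K0: "K 0 H = H 0" for H unfolding K_def by (simp add: alive_0 prob_space)
  have "q n = K n (\<lambda>_. 1)" unfolding K_def using integral_alive[of n 1] by simp
  also have "\<dots> = backward n 0 (\<lambda>_. 1) 0" using K_backward[of "\<lambda>_. 1" 0 n] by (simp add: K0 mono_def)
  finally have 1: "q n = backward n 0 (\<lambda>_. 1) 0" .
  have 2: "K n F = backward n 0 F 0" using K_backward[OF F, of 0 n] by (simp add: K0)
  show ?thesis using backward_harris[OF F, of n 0 0] unfolding 1 2 avg_def by simp
qed

end

section \<open>Slow variation\<close>

context bounded_density_walk
begin

text \<open>Lindeberg's truncated second moment. Up to powers of \<eta> it dominates
  \<open>n\<close> times the tail probability and \<open>sqrt n\<close> times the absolute tail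
  moment beyond \<open>\<eta> * sqrt n\<close>.\<close>

definition tail2 :: "real \<Rightarrow> nat \<Rightarrow> real" where
  "tail2 \<eta> n = (\<integral>t. indicator {t. \<eta> * sqrt (real n) < \<bar>t\<bar>} t * t\<^sup>2 \<partial>\<mu>)"

lemma tail2_tendsto:
  assumes "\<eta> > 0"
  shows "tail2 \<eta> \<longlonglongrightarrow> 0"
proof -
  have "(\<lambda>n. \<integral>t. indicator {t. \<eta> * sqrt (real n) < \<bar>t\<bar>} t * t\<^sup>2 \<partial>\<mu>) \<longlonglongrightarrow> (\<integral>t. 0 \<partial>\<mu>)"
  proof (rule integral_dominated_convergence[where w="\<lambda>t. t\<^sup>2"])
    show "AE t in \<mu>. (\<lambda>n. indicator {t. \<eta> * sqrt (real n) < \<bar>t\<bar>} t * t\<^sup>2) \<longlonglongrightarrow> 0"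
    proof (intro AE_I2 tendsto_eventually)
      fix t :: real
      have "filterlim (\<lambda>n. \<eta> * sqrt (real n)) at_top sequentially"
        by (intro filterlim_tendsto_pos_mult_at_top[OF tendsto_const assms]
          filterlim_compose[OF sqrt_at_top filterlim_real_sequentially])
      then have "\<forall>\<^sub>F n in sequentially. \<bar>t\<bar> \<le> \<eta> * sqrt (real n)" unfolding filterlim_at_top by blast
      then show "\<forall>\<^sub>F n in sequentially. indicator {t. \<eta> * sqrt (real n) < \<bar>t\<bar>} t * t\<^sup>2 = 0"
        by eventually_elim simp
    qed
    show "AE t in \<mu>. norm (indicator {t. \<eta> * sqrt (real n) < \<bar>t\<bar>} t * t\<^sup>2) \<le> t\<^sup>2" for n
      by (rule AE_I2) (simp add: indicator_def)
  qed (simp_all add: integrable_\<mu>)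
  then show ?thesis unfolding tail2_def[abs_def] by simp
qed

lemma integrable_tail: "integrable \<mu> (\<lambda>t. indicator {t. c < \<bar>t\<bar>} t * \<bar>t\<bar>)"
  "integrable \<mu> (\<lambda>t. indicator {t. c < \<bar>t\<bar>} t * t\<^sup>2)"
proof -
  show "integrable \<mu> (\<lambda>t. indicator {t. c < \<bar>t\<bar>} t * \<bar>t\<bar>)"
    by (rule integrable_le[OF integrable_abs[OF integrable_\<mu>(1)]]) (measurable, simp add: indicator_def)
  show "integrable \<mu> (\<lambda>t. indicator {t. c < \<bar>t\<bar>} t * t\<^sup>2)"
    by (rule integrable_le[OF integrable_\<mu>(2)]) (measurable, simp add: indicator_def)
qed

lemma tail_prob_le:
  assumes "\<eta> > 0"
  shows "real n * (\<integral>t. indicator {t. \<eta> * sqrt (real n) < \<bar>t\<bar>} t \<partial>\<mu>) \<le> tail2 \<eta> n / \<eta>\<^sup>2"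
proof -
  have "\<eta>\<^sup>2 * (real n * (\<integral>t. indicator {t. \<eta> * sqrt (real n) < \<bar>t\<bar>} t \<partial>\<mu>)) =
      (\<integral>t. (\<eta>\<^sup>2 * real n) * indicator {t. \<eta> * sqrt (real n) < \<bar>t\<bar>} t \<partial>\<mu>)" by simp
  also have "\<dots> \<le> tail2 \<eta> n"
    unfolding tail2_def
  proof (rule integral_mono)
    fix t
    have "(\<eta> * sqrt (real n))\<^sup>2 \<le> \<bar>t\<bar>\<^sup>2" if "\<eta> * sqrt (real n) < \<bar>t\<bar>"
      by (rule power_mono) (use that assms in auto)
    then show "(\<eta>\<^sup>2 * real n) * indicator {t. \<eta> * sqrt (real n) < \<bar>t\<bar>} t \<le> indicator {t. \<eta> * sqrt (real n) < \<bar>t\<bar>} t * t\<^sup>2"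
      by (auto simp: indicator_def power_mult_distrib)
  next
    show "integrable \<mu> (\<lambda>t. (\<eta>\<^sup>2 * real n) * indicator {t. \<eta> * sqrt (real n) < \<bar>t\<bar>} t)"
      by (rule \<mu>.integrable_const_bound[where B="\<eta>\<^sup>2 * real n"]) (auto simp: indicator_def)
  qed (rule integrable_tail)
  finally show ?thesis using assms by (simp add: field_simps)
qed

lemma tail_abs_le:
  assumes "\<eta> > 0"
  shows "sqrt (real n) * (\<integral>t. indicator {t. \<eta> * sqrt (real n) < \<bar>t\<bar>} t * \<bar>t\<bar> \<partial>\<mu>) \<le> tail2 \<eta> n / \<eta>"
proof -
  have "\<eta> * (sqrt (real n) * (\<integral>t. indicator {t. \<eta> * sqrt (real n) < \<bar>t\<bar>} t * \<bar>t\<bar> \<partial>\<mu>)) =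
      (\<integral>t. (\<eta> * sqrt (real n)) * (indicator {t. \<eta> * sqrt (real n) < \<bar>t\<bar>} t * \<bar>t\<bar>) \<partial>\<mu>)" by simp
  also have "\<dots> \<le> tail2 \<eta> n"
    unfolding tail2_def
  proof (rule integral_mono)
    fix t
    have "\<eta> * sqrt (real n) * \<bar>t\<bar> \<le> \<bar>t\<bar> * \<bar>t\<bar>" if "\<eta> * sqrt (real n) < \<bar>t\<bar>"
      by (rule mult_right_mono) (use that in auto)
    then show "(\<eta> * sqrt (real n)) * (indicator {t. \<eta> * sqrt (real n) < \<bar>t\<bar>} t * \<bar>t\<bar>) \<le> indicator {t. \<eta> * sqrt (real n) < \<bar>t\<bar>} t * t\<^sup>2"
      by (auto simp: indicator_def power2_eq_square)
  next
    show "integrable \<mu> (\<lambda>t. (\<eta> * sqrt (real n)) * (indicator {t. \<eta> * sqrt (real n) < \<bar>t\<bar>} t * \<bar>t\<bar>))"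
      by (intro integrable_mult_right integrable_tail)
  qed (rule integrable_tail)
  finally show ?thesis using assms by (simp add: field_simps)
qed

end

section \<open>Increments and growth of L\<close>

context boundary_walk
begin

abbreviation D :: "nat \<Rightarrow> real" where "D n \<equiv> K n (\<lambda>x. x)"
abbreviation L :: "nat \<Rightarrow> real" where "L \<equiv> L_fun M X g"

lemma L_eq: "L n = D n - g n * q n"
proof -
  have "L n = (\<integral>\<omega>. indicator (alive n) \<omega> * walk X n \<omega> - indicator (alive n) \<omega> * g n \<partial>M)"
    unfolding L_fun_def by (intro Bochner_Integration.integral_cong refl) (simp add: algebra_simps)
  also have "\<dots> = D n - (\<integral>\<omega>. indicator (alive n) \<omega> * g n \<partial>M)"
    unfolding K_def by (intro Bochner_Integration.integral_diff integrable_alive walk_second_moment(2)) simp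
  finally show ?thesis unfolding integral_alive .
qed

lemma g_bound:
  assumes "\<eta> > 0"
  shows "\<exists>N. \<forall>i\<ge>N. \<bar>g i\<bar> \<le> \<eta> * sqrt (real i)"
proof -
  have "\<forall>\<^sub>F i in sequentially. norm (g i) \<le> \<eta> * norm (sqrt (real i))"
    using landau_o.smallD[OF g_small assms] .
  then show ?thesis by (simp add: eventually_at_top_linorder)
qed

text \<open>The walk is a martingale, so \<open>D\<close> changes only by the endpoints of paths
  killed at this step. Coming from above \<open>g i\<close> and landing below
  \<open>g (Suc i)\<close>, such an endpoint is within \<open>2 * G\<close> of 0 unless the jump
  exceeds \<open>G\<close>.\<close>

lemma D_step:
  assumes i: "1 \<le> i" and G: "\<bar>g i\<bar> \<le> G" "\<bar>g (Suc i)\<bar> \<le> G"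
  shows "\<bar>D (Suc i) - D i\<bar> \<le> 2 * G * (q i - q (Suc i)) + q i * (\<integral>t. indicator {t. G < \<bar>t\<bar>} t * \<bar>t\<bar> \<partial>\<mu>)"
proof -
  have "(\<lambda>x. \<integral>t. x + t \<partial>\<mu>) = (\<lambda>x. x)"
    using integrable_\<mu> integral_\<mu> \<mu>.prob_space by (intro ext) simp
  moreover have "\<bar>K i (\<lambda>x. \<integral>t. x + t \<partial>\<mu>) - D (Suc i)\<bar> \<le> 2 * G * (q i - q (Suc i)) + q i * (\<integral>t. indicator {t. G < \<bar>t\<bar>} t * \<bar>t\<bar> \<partial>\<mu>)"
  proof (rule killed_step[OF _ _ _ _ i])
    show "integrable \<mu> (\<lambda>t. indicator {t. G < \<bar>t\<bar>} t * \<bar>t\<bar>)" by (rule integrable_tail)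
    fix x t assume "g i < x" "x + t \<le> g (Suc i)"
    then show "\<bar>x + t\<bar> \<le> 2 * G + indicator {t. G < \<bar>t\<bar>} t * \<bar>t\<bar>"
      using G by (auto simp: indicator_def abs_le_iff)
  qed (auto intro: walk_second_moment(2))
  ultimately show ?thesis by (simp add: abs_minus_commute)
qed

text \<open>The killed mass telescopes, so the overshoot bound \<open>2 * G\<close> is paid once
  instead of \<open>j\<close> times; only the large jumps accumulate.\<close>

lemma D_diff:
  assumes m: "1 \<le> m" and G: "\<And>i. m \<le> i \<Longrightarrow> i \<le> m + j \<Longrightarrow> \<bar>g i\<bar> \<le> G"
  shows "\<bar>D (m + j) - D m\<bar> \<le> 2 * G * (q m - q (m + j)) + real j * q m * (\<integral>t. indicator {t. G < \<bar>t\<bar>} t * \<bar>t\<bar> \<partial>\<mu>)"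
  using G
proof (induction j)
  case (Suc j)
  let ?I = "\<integral>t. indicator {t. G < \<bar>t\<bar>} t * \<bar>t\<bar> \<partial>\<mu>"
  have I0: "0 \<le> ?I" by (intro Bochner_Integration.integral_nonneg) auto
  have "\<bar>D (m + j) - D m\<bar> \<le> 2 * G * (q m - q (m + j)) + real j * q m * ?I"
    by (rule Suc.IH) (use Suc.prems in auto)
  moreover have "\<bar>D (Suc (m + j)) - D (m + j)\<bar> \<le> 2 * G * (q (m + j) - q (Suc (m + j))) + q (m + j) * ?I"
    by (rule D_step) (use m Suc.prems in auto)
  moreover have "q (m + j) * ?I \<le> q m * ?I" by (intro mult_right_mono q_antimono I0) simp
  ultimately have "\<bar>D (Suc (m + j)) - D m\<bar> \<le> 2 * G * (q m - q (m + j)) + real j * q m * ?I + (2 * G * (q (m + j) - q (Suc (m + j))) + q m * ?I)"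
    by linarith
  then show ?case by (simp add: algebra_simps)
qed simp

lemma L_diff:
  assumes "\<eta> > 0"
  shows "\<exists>N. \<forall>m n. N \<le> m \<longrightarrow> m \<le> n \<longrightarrow> \<bar>L n - L m\<bar> \<le> \<eta> * sqrt (real n) * q m"
proof -
  \<comment> \<open>Five shares: two for overshoots, one for large jumps, and one each for the
    boundary terms \<open>g n * q n\<close> and \<open>g m * q m\<close>.\<close>
  define e where "e = \<eta> / 5"
  have e: "e > 0" using assms by (simp add: e_def)
  obtain N1 where N1: "\<And>i. i \<ge> N1 \<Longrightarrow> \<bar>g i\<bar> \<le> e * sqrt (real i)" using g_bound[OF e] by auto
  \<comment> \<open>The square is there because \<open>tail_abs_le\<close> divides by
    \<open>e\<close>.\<close>
  have "\<forall>\<^sub>F n in sequentially. tail2 e n < e * e"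
    using tail2_tendsto[OF e] e by (intro order_tendstoD) auto
  then obtain N2 where N2: "\<And>n. n \<ge> N2 \<Longrightarrow> tail2 e n < e * e" by (auto simp: eventually_at_top_linorder)
  have "\<bar>L n - L m\<bar> \<le> \<eta> * sqrt (real n) * q m" if mn: "max (max N1 N2) 1 \<le> m" "m \<le> n" for m n
  proof -
    let ?I = "\<integral>t. indicator {t. e * sqrt (real n) < \<bar>t\<bar>} t * \<bar>t\<bar> \<partial>\<mu>"
    have gi: "\<bar>g i\<bar> \<le> e * sqrt (real n)" if "m \<le> i" "i \<le> n" for i
    proof -
      have "\<bar>g i\<bar> \<le> e * sqrt (real i)" using N1 mn that by simp
      also have "\<dots> \<le> e * sqrt (real n)" using that e by (intro mult_left_mono) auto
      finally show ?thesis .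
    qed
    obtain j where j: "n = m + j" using mn le_Suc_ex by blast
    have D1: "\<bar>D n - D m\<bar> \<le> 2 * (e * sqrt (real n)) * (q m - q n) + real j * q m * ?I"
      using D_diff[of m j "e * sqrt (real n)"] gi mn j by auto
    have I0: "0 \<le> ?I" by (intro Bochner_Integration.integral_nonneg) auto
    have "sqrt (real n) * ?I \<le> e"
    proof -
      have "sqrt (real n) * ?I \<le> tail2 e n / e" by (rule tail_abs_le[OF e])
      also have "\<dots> \<le> e" using N2[of n] mn e by (simp add: field_simps)
      finally show ?thesis .
    qed
    then have "sqrt (real n) * (sqrt (real n) * ?I) \<le> sqrt (real n) * e" by (intro mult_left_mono) auto
    then have "real n * ?I \<le> e * sqrt (real n)" by (simp add: mult.assoc[symmetric] mult.commute)
    moreover have "real j * ?I \<le> real n * ?I" using j I0 by (intro mult_right_mono) auto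
    ultimately have "q m * (real j * ?I) \<le> q m * (e * sqrt (real n))"
      by (intro mult_left_mono q_nonneg) simp
    then have jI: "real j * q m * ?I \<le> e * sqrt (real n) * q m" by (simp add: mult_ac)
    have es: "0 \<le> e * sqrt (real n)" using e by simp
    have "(e * sqrt (real n)) * (q m - q n) \<le> (e * sqrt (real n)) * q m"
      using es q_nonneg[of n] by (intro mult_left_mono) auto
    then have D2: "\<bar>D n - D m\<bar> \<le> 3 * (e * sqrt (real n) * q m)" using D1 jI by linarith
    have "\<bar>g n * q n\<bar> \<le> e * sqrt (real n) * q m" "\<bar>g m * q m\<bar> \<le> e * sqrt (real n) * q m"
      unfolding abs_mult using gi[of n] gi[of m] mn q_antimono[of m n] q_nonneg es by (auto intro!: mult_mono)
    then have "\<bar>L n - L m\<bar> \<le> 5 * (e * sqrt (real n) * q m)" unfolding L_eq using D2 by linarith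
    then show ?thesis by (simp add: e_def)
  qed
  then show ?thesis by blast
qed

text \<open>Harris' inequality for the event that the endpoint is at least \<open>sqrt n\<close>:
  given survival it is at least as likely as for the free walk, where its probability tends to
  \<open>p\<close>, and on it the walk exceeds \<open>g n\<close> by at least half of
  \<open>sqrt n\<close>.\<close>

lemma L_ge:
  "\<exists>c>0. \<exists>N. \<forall>n\<ge>N. c * sqrt (real n) * q n \<le> L n"
proof -
  define p where "p = (\<integral>y. indicator {1..} y * std_normal_density y \<partial>lborel)"
  have p: "p > 0"
  proof -
    have "0 < (\<integral>y. indicator {1..2::real} y * std_normal_density 2 \<partial>lborel)"
      by (simp add: normal_density_pos)
    also have "\<dots> \<le> p" unfolding p_def
    proof (rule integral_mono)
      show "integrable lborel (\<lambda>y. indicator {1..} y * std_normal_density y)"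
        by (rule integrable_bounded_mult[where B=1]) auto
      fix y :: real
      have "std_normal_density 2 \<le> std_normal_density y" if "1 \<le> y" "y \<le> 2"
        using that power_mono[of y 2 2] unfolding std_normal_density_def by (intro mult_left_mono) auto
      then show "indicator {1..2} y * std_normal_density 2 \<le> indicator {1..} y * std_normal_density y"
        by (auto simp: indicator_def normal_density_nonneg)
    qed auto
    finally show ?thesis .
  qed
  have "\<forall>\<^sub>F n in sequentially. tv n < p / 2" using tv_tendsto p by (intro order_tendstoD) auto
  then obtain N1 where N1: "\<And>n. n \<ge> N1 \<Longrightarrow> tv n < p / 2" by (auto simp: eventually_at_top_linorder)
  obtain N2 where N2: "\<And>i. i \<ge> N2 \<Longrightarrow> \<bar>g i\<bar> \<le> 1/2 * sqrt (real i)" using g_bound[of "1/2"] by auto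
  \<comment> \<open>One factor \<open>1/2\<close> absorbs the error of the normal approximation, the
    other the boundary value \<open>g n\<close>.\<close>
  have "p / 4 * sqrt (real n) * q n \<le> L n" if n: "n \<ge> max (max N1 N2) 1" for n
  proof -
    define F where "F x = (indicator {sqrt (real n)..} x :: real)" for x
    have s: "sqrt (real n) > 0" using n by simp
    have F: "mono F" "\<And>x. 0 \<le> F x" "\<And>x. F x \<le> 1" by (auto simp: F_def mono_def indicator_def)
    have "(\<integral>\<omega>. F (walk X n \<omega>) \<partial>M) = (\<integral>\<omega>. indicator {1..} (walk X n \<omega> / sqrt (real n)) \<partial>M)"
      unfolding F_def using s by (intro Bochner_Integration.integral_cong refl) (auto simp: indicator_def field_simps)
    moreover have "\<bar>(\<integral>\<omega>. indicator {1..} (walk X n \<omega> / sqrt (real n)) \<partial>M) - p\<bar> \<le> 1 * tv n"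
      unfolding p_def by (rule clt_total_variation) (use n in \<open>auto simp: indicator_def\<close>)
    ultimately have "p / 2 \<le> (\<integral>\<omega>. F (walk X n \<omega>) \<partial>M)" using N1[of n] n by auto
    then have "q n * (p / 2) \<le> q n * (\<integral>\<omega>. F (walk X n \<omega>) \<partial>M)" by (intro mult_left_mono q_nonneg)
    also have "\<dots> \<le> K n F" by (rule survival_positively_correlated[OF F])
    finally have 1: "sqrt (real n) / 2 * (q n * (p / 2)) \<le> sqrt (real n) / 2 * K n F" by (intro mult_left_mono) auto
    have "sqrt (real n) / 2 * K n F = (\<integral>\<omega>. indicator (alive n) \<omega> * (sqrt (real n) / 2 * F (walk X n \<omega>)) \<partial>M)"
      unfolding K_def by (subst integral_mult_right_zero[symmetric]) (simp add: mult_ac)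
    also have "\<dots> \<le> L n" unfolding L_fun_def
    proof (rule integral_mono)
      have [measurable]: "F \<in> borel_measurable borel" by (rule borel_measurable_mono[OF F(1)])
      show "integrable M (\<lambda>\<omega>. indicator (alive n) \<omega> * (sqrt (real n) / 2 * F (walk X n \<omega>)))"
        by (intro integrable_alive integrable_mult_right integrable_bounded_walk[where B=1]) (use F in auto)
      show "integrable M (\<lambda>\<omega>. (walk X n \<omega> - g n) * indicator (alive n) \<omega>)"
        using integrable_alive[of "\<lambda>\<omega>. walk X n \<omega> - g n" n] walk_second_moment(2) by (simp add: mult.commute)
      fix \<omega> assume "\<omega> \<in> space M"
      show "indicator (alive n) \<omega> * (sqrt (real n) / 2 * F (walk X n \<omega>)) \<le> (walk X n \<omega> - g n) * indicator (alive n) \<omega>"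
        using alive_above[of n \<omega>] n N2[of n] by (auto simp: F_def indicator_def)
    qed
    finally show ?thesis using 1 by (simp add: mult_ac)
  qed
  then have "\<exists>N. \<forall>n\<ge>N. p / 4 * sqrt (real n) * q n \<le> L n" by blast
  then show ?thesis using p by (intro exI[of _ "p/4"] conjI) simp_all
qed

text \<open>Survivors lie strictly above the boundary, so a vanishing integral would make survival a
  null event. At time 0 no boundary condition is imposed, hence \<open>1 <= n\<close>.\<close>

lemma L_pos: assumes "1 \<le> n" shows "0 < L n"
proof (rule ccontr)
  assume neg: "\<not> 0 < L n"
  have nn: "0 \<le> (walk X n \<omega> - g n) * indicator (alive n) \<omega>" for \<omega>
    using alive_above[OF assms, of \<omega>] by (auto simp: indicator_def)
  have int: "integrable M (\<lambda>\<omega>. (walk X n \<omega> - g n) * indicator (alive n) \<omega>)"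
    using integrable_alive[of "\<lambda>\<omega>. walk X n \<omega> - g n" n] walk_second_moment(2) by (simp add: mult.commute)
  have "0 \<le> L n" unfolding L_fun_def by (rule Bochner_Integration.integral_nonneg) (rule nn)
  then have "L n = 0" using neg by linarith
  then have "AE \<omega> in M. (walk X n \<omega> - g n) * indicator (alive n) \<omega> = 0"
    unfolding L_fun_def using integral_nonneg_eq_0_iff_AE[OF int] nn by simp
  then have "AE \<omega> in M. \<omega> \<notin> alive n"
  proof eventually_elim
    case (elim \<omega>)
    then show ?case using alive_above[OF assms, of \<omega>] by (auto simp: indicator_def split: if_splits)
  qed
  then have "measure M (alive n) = 0" by (subst prob_eq_0) auto
  then show False using q_pos[of n] by (simp add: q_def)
qed

text \<open>\<open>L_diff\<close> bounds the increment by a small multiple of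
  \<open>sqrt n * q m\<close>, and \<open>L_ge\<close> turns this into a multiple of
  \<open>L m\<close>, at the price of \<open>sqrt l\<close> for replacing \<open>sqrt n\<close> by
  \<open>sqrt m\<close>.\<close>

lemma L_slowly_varying:
  assumes "\<eta> > 0" "1 \<le> l"
  shows "\<exists>N. \<forall>m n. N \<le> m \<longrightarrow> m \<le> n \<longrightarrow> n \<le> l * m \<longrightarrow> \<bar>L n - L m\<bar> \<le> \<eta> * L m"
proof -
  obtain c N1 where c: "c > 0" "\<And>n. n \<ge> N1 \<Longrightarrow> c * sqrt (real n) * q n \<le> L n" using L_ge by auto
  define e where "e = \<eta> * c / sqrt (real l)"
  have e: "e > 0" using assms c by (simp add: e_def)
  obtain N2 where N2: "\<And>m n. N2 \<le> m \<Longrightarrow> m \<le> n \<Longrightarrow> \<bar>L n - L m\<bar> \<le> e * sqrt (real n) * q m"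
    using L_diff[OF e] by auto
  have "\<bar>L n - L m\<bar> \<le> \<eta> * L m" if mn: "max N1 N2 \<le> m" "m \<le> n" "n \<le> l * m" for m n
  proof -
    have "sqrt (real n) \<le> sqrt (real l * real m)" using mn(3) by (simp flip: of_nat_mult)
    then have s: "sqrt (real n) \<le> sqrt (real l) * sqrt (real m)" by (simp add: real_sqrt_mult)
    have "\<bar>L n - L m\<bar> \<le> e * sqrt (real n) * q m" using N2 mn by simp
    also have "\<dots> \<le> e * (sqrt (real l) * sqrt (real m)) * q m"
      using s e q_nonneg[of m] by (intro mult_right_mono mult_left_mono) auto
    also have "\<dots> = \<eta> * (c * sqrt (real m) * q m)" using assms by (simp add: e_def)
    also have "\<dots> \<le> \<eta> * L m" using c(2)[of m] mn assms by (intro mult_left_mono) auto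
    finally show ?thesis .
  qed
  then show ?thesis by blast
qed

text \<open>A Karamata type bound by halving. The block from \<open>n div 2\<close> to
  \<open>n\<close> costs a fixed multiple of \<open>sqrt n * L n\<close>; since
  \<open>sqrt (n / 2)\<close> is smaller than \<open>sqrt n\<close> by a definite factor while
  \<open>L\<close> hardly changes, the recursion contracts.\<close>

lemma sum_q_le:
  "\<exists>C N. \<forall>n\<ge>N. (\<Sum>i<n. q i) \<le> C * (sqrt (real n) * L n)"
proof -
  obtain c N1 where c: "c > 0" "\<And>n. n \<ge> N1 \<Longrightarrow> c * sqrt (real n) * q n \<le> L n" using L_ge by auto
  obtain N2 where N2: "\<And>m n. N2 \<le> m \<Longrightarrow> m \<le> n \<Longrightarrow> n \<le> 3 * m \<Longrightarrow> \<bar>L n - L m\<bar> \<le> 1/10 * L m"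
    using L_slowly_varying[of "1/10" 3] by auto
  define N where "N = max (max N1 N2) 1"
  define T where "T n = (\<Sum>i<n. q i)" for n
  have T0: "0 \<le> T n" for n unfolding T_def by (intro sum_nonneg q_nonneg)
  define r where "r n = T n / (sqrt (real n) * L n)" for n
  \<comment> \<open>The contraction factor is \<open>3/4 * 10/9 = 5/6\<close>, and
    \<open>(C + 2 / c) * 5/6\<close> is at most \<open>C\<close> from \<open>C = 10 / c\<close> on.
    The sum covers the starting range up to \<open>2 * N + 1\<close>, beyond which
    \<open>n div 2\<close> is at least \<open>N\<close> and the induction applies.\<close>
  define C where "C = 10 / c + (\<Sum>n\<in>{N..2 * N + 1}. r n)"
  have pos: "0 < sqrt (real n) * L n" if "n \<ge> N" for n
    using that L_pos[of n] by (simp add: N_def)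
  have r0: "0 \<le> r n" if "n \<ge> N" for n unfolding r_def by (intro divide_nonneg_nonneg T0 less_imp_le pos that)
  have C: "10 / c \<le> C" unfolding C_def using sum_nonneg[of "{N..2*N+1}" r] r0 by auto
  have "T n \<le> C * (sqrt (real n) * L n)" if "n \<ge> N" for n
    using that
  proof (induction n rule: less_induct)
    case (less n)
    show ?case
    proof (cases "n \<le> 2 * N + 1")
      case True
      have "r n \<le> (\<Sum>n\<in>{N..2 * N + 1}. r n)"
        by (rule member_le_sum) (use True less.prems r0 in auto)
      also have "\<dots> \<le> C" unfolding C_def using c by simp
      finally have "r n * (sqrt (real n) * L n) \<le> C * (sqrt (real n) * L n)"
        by (rule mult_right_mono) (rule less_imp_le[OF pos[OF less.prems]])
      moreover have "r n * (sqrt (real n) * L n) = T n"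
        unfolding r_def using pos[OF less.prems] by (metis less_irrefl nonzero_divide_eq_eq)
      ultimately show ?thesis by linarith
    next
      case False
      define k where "k = n div 2"
      have k: "N \<le> k" "k < n" "k \<le> n" "n \<le> 3 * k" "n - k \<le> 2 * k" "2 * k \<le> n"
        using False unfolding k_def by linarith+
      have k1: "1 \<le> k" using k by (simp add: N_def)
      have IH: "T k \<le> C * (sqrt (real k) * L k)" by (rule less.IH) (use k in auto)
      have "T n = T k + (\<Sum>i\<in>{k..<n}. q i)"
        unfolding T_def using sum.atLeastLessThan_concat[of 0 k n q] k by (simp add: atLeast0LessThan)
      also have "(\<Sum>i\<in>{k..<n}. q i) \<le> real (card {k..<n}) * q k"
        by (rule sum_bounded_above) (auto intro: q_antimono)
      also have "\<dots> \<le> (2 * real k) * q k"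
        using k by (intro mult_right_mono q_nonneg) auto
      also have "(2 * real k) * q k \<le> 2 / c * (sqrt (real k) * L k)"
      proof -
        have "c * ((sqrt (real k) * sqrt (real k)) * q k) \<le> sqrt (real k) * L k"
        proof -
          have "sqrt (real k) * (c * sqrt (real k) * q k) \<le> sqrt (real k) * L k"
            by (intro mult_left_mono c(2)) (use k in \<open>auto simp: N_def\<close>)
          then show ?thesis by (simp only: mult_ac)
        qed
        then show ?thesis using c(1) by (simp add: field_simps)
      qed
      finally have "T n \<le> (C + 2 / c) * (sqrt (real k) * L k)" using IH by (simp add: algebra_simps)
      also have "\<dots> \<le> (C + 2 / c) * ((3/4 * sqrt (real n)) * (10/9 * L n))"
      proof (intro mult_left_mono mult_mono)
        have "sqrt (real k) \<le> sqrt ((3/4)\<^sup>2 * real n)"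
          using k by (intro real_sqrt_le_mono) (simp add: power2_eq_square)
        then show "sqrt (real k) \<le> 3/4 * sqrt (real n)" by (simp add: real_sqrt_mult)
        have "\<bar>L n - L k\<bar> \<le> 1/10 * L k" by (rule N2) (use k in \<open>auto simp: N_def\<close>)
        then show "L k \<le> 10/9 * L n" by linarith
        show "0 \<le> C + 2 / c" using C c by (smt (verit) divide_nonneg_nonneg)
      qed (use L_pos[OF k1] in auto)
      also have "\<dots> = ((C + 2 / c) * 5/6) * (sqrt (real n) * L n)" by simp
      also have "\<dots> \<le> C * (sqrt (real n) * L n)"
        using C by (intro mult_right_mono[OF _ less_imp_le[OF pos[OF less.prems]]]) (simp add: field_simps)
      finally show ?thesis .
    qed
  qed
  then show ?thesis unfolding T_def by blast
qed

lemma K_square_le: "\<exists>C N. \<forall>n\<ge>N. K n (\<lambda>x. x\<^sup>2) \<le> C * (sqrt (real n) * L n)"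
  using sum_q_le K_square_le_sum by (meson order_trans)

end

section \<open>Test functions and the reflection principle\<close>

lemma exp_remainder_bounds:
  fixes u :: real
  shows "0 \<le> exp u - 1 - u" "exp u - 1 - u \<le> u\<^sup>2 * exp \<bar>u\<bar>"
proof -
  show "0 \<le> exp u - 1 - u" using exp_ge_add_one_self[of u] by linarith
  have "(1 - u) * exp u \<le> exp (- u) * exp u" using exp_ge_add_one_self[of "- u"] by (intro mult_right_mono) auto
  then have e: "exp u - 1 \<le> u * exp u" by (simp add: exp_minus algebra_simps)
  have "exp u - 1 - u \<le> u * (exp u - 1)" using e by (simp add: algebra_simps)
  also have "\<dots> \<le> u\<^sup>2 * exp \<bar>u\<bar>"
  proof (cases "0 \<le> u")
    case True
    then have "u * (exp u - 1) \<le> u * (u * exp u)" using e by (intro mult_left_mono) auto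
    then show ?thesis using True by (simp add: power2_eq_square mult.assoc)
  next
    case False
    have "1 - exp u \<le> - u" using exp_ge_add_one_self[of u] by linarith
    then have "(- u) * (1 - exp u) \<le> (- u) * (- u)" using False by (intro mult_left_mono) auto
    also have "\<dots> \<le> u\<^sup>2 * exp \<bar>u\<bar>" using mult_left_mono[of 1 "exp \<bar>u\<bar>" "u\<^sup>2"] by (simp add: power2_eq_square)
    finally show ?thesis by (simp add: algebra_simps)
  qed
  finally show "exp u - 1 - u \<le> u\<^sup>2 * exp \<bar>u\<bar>" .
qed

section \<open>Gaussian smoothing of bounded test functions\<close>

definition gauss_mean :: "(real \<Rightarrow> real) \<Rightarrow> real \<Rightarrow> real" where
  "gauss_mean H w = (\<integral>y. H (w + y) * std_normal_density y \<partial>lborel)"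

text \<open>The derivative of \<open>gauss_mean H\<close> at 0, obtained by differentiating the
  shifted normal density instead of \<open>H\<close>.\<close>

definition gauss_slope :: "(real \<Rightarrow> real) \<Rightarrow> real" where
  "gauss_slope H = (\<integral>y. H y * (y * std_normal_density y) \<partial>lborel)"

lemma normal_density_shift: "std_normal_density (y - w) = normal_density w 1 y"
  by (simp add: normal_density_def)

lemma std_normal_density_tilt: "std_normal_density (y - w) = std_normal_density y * exp (w * y - w\<^sup>2 / 2)"
proof -
  have "- (y - w)\<^sup>2 / 2 = - y\<^sup>2 / 2 + (w * y - w\<^sup>2 / 2)" by (simp add: power2_diff field_simps)
  then show ?thesis unfolding std_normal_density_def by (simp only: exp_add mult.assoc)
qed

lemma integrable_std_normal_first_moment: "integrable lborel (\<lambda>y. y * std_normal_density y)"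
  using integrable_std_normal_moment[of 1] by (simp add: mult.commute)

lemma gauss_mean_measurable [measurable]:
  assumes [measurable]: "H \<in> borel_measurable borel"
  shows "gauss_mean H \<in> borel_measurable borel"
  unfolding gauss_mean_def[abs_def] by measurable

lemma gauss_mean_bounded:
  assumes [measurable]: "H \<in> borel_measurable borel" and B: "\<And>x. \<bar>H x\<bar> \<le> B"
  shows "\<bar>gauss_mean H w\<bar> \<le> B"
proof -
  have i: "integrable lborel (\<lambda>y. H (w + y) * std_normal_density y)"
    by (rule integrable_bounded_mult[OF _ _ B]) auto
  have "\<bar>gauss_mean H w\<bar> \<le> (\<integral>y. \<bar>H (w + y) * std_normal_density y\<bar> \<partial>lborel)"
    unfolding gauss_mean_def by (rule integral_abs_bound)
  also have "\<dots> \<le> (\<integral>y. B * std_normal_density y \<partial>lborel)"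
  proof (rule integral_mono)
    show "\<bar>H (w + y) * std_normal_density y\<bar> \<le> B * std_normal_density y" for y
      unfolding abs_mult abs_of_nonneg[OF normal_density_nonneg] by (rule mult_right_mono[OF B normal_density_nonneg])
  qed (use i in auto)
  finally show ?thesis by simp
qed

text \<open>All smoothness sits in the Gaussian: the shift is moved from \<open>H\<close> to the
  density, whose expansion in \<open>w\<close> has an integrable second order remainder. Beyond
  \<open>\<bar>w\<bar> = 1\<close> crude bounds suffice, as \<open>w^2\<close> dominates both 1 and
  \<open>\<bar>w\<bar>\<close>, so one constant serves for all \<open>w\<close>.\<close>

lemma gauss_mean_expansion:
  assumes [measurable]: "H \<in> borel_measurable borel" and B: "\<And>x. \<bar>H x\<bar> \<le> B"
  shows "\<exists>C\<ge>0. \<forall>w. \<bar>gauss_mean H w - gauss_slope H * w - gauss_mean H 0\<bar> \<le> C * w\<^sup>2"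
proof -
  have B0: "0 \<le> B" using B[of 0] by simp
  have nd: "integrable lborel (normal_density w 1)" for w by simp
  have iH: "integrable lborel (\<lambda>y. H y * normal_density w 1 y)" for w
    by (rule integrable_bounded_mult[OF nd _ B]) measurable
  have i1: "integrable lborel (\<lambda>y. H y * (y * std_normal_density y))"
    by (rule integrable_bounded_mult[OF integrable_std_normal_first_moment _ B]) measurable
  have U: "gauss_mean H w = (\<integral>y. H y * normal_density w 1 y \<partial>lborel)" for w
  proof -
    have a: "- w + 1 * y = y - w" for y by simp
    have "gauss_mean H w = \<bar>1\<bar> *\<^sub>R (\<integral>y. H (w + (- w + 1 * y)) * std_normal_density (- w + 1 * y) \<partial>lborel)"
      unfolding gauss_mean_def by (rule lborel_integral_real_affine) simp
    then show ?thesis by (simp only: a normal_density_shift) simp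
  qed
  \<comment> \<open>Majorant of the remainder: \<open>exp (2 * \<bar>y\<bar>)\<close> times the
    normal density is at most \<open>exp 2\<close> times the sum of the normal densities centred at
    2 and -2. A further \<open>exp 1\<close> from the exponent gives \<open>exp 3\<close>, and the
    last summand pays for the term \<open>w^2 / 2\<close>.\<close>
  define Q where "Q y = 2 * exp 3 * (normal_density 2 1 y + normal_density (-2) 1 y) + std_normal_density y / 2" for y
  have iQ: "integrable lborel Q" unfolding Q_def[abs_def] using nd
    by (intro Bochner_Integration.integrable_add integrable_mult_right integrable_divide) auto
  have Q0: "0 \<le> Q y" for y unfolding Q_def by (simp add: normal_density_nonneg)
  have key: "\<bar>normal_density w 1 y - std_normal_density y - w * (y * std_normal_density y)\<bar> \<le> w\<^sup>2 * Q y"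
    if w: "\<bar>w\<bar> \<le> 1" for w y
  proof -
    define u where "u = w * y - w\<^sup>2 / 2"
    \<comment> \<open>For \<open>\<bar>w\<bar> <= 1\<close> the tilt exponent \<open>u\<close> is at
      most \<open>\<bar>w\<bar> * v\<close> in modulus, because
      \<open>w^2 / 2 <= \<bar>w\<bar> / 2\<close>.\<close>
    define v where "v = \<bar>y\<bar> + 1/2"
    have v0: "0 \<le> v" by (simp add: v_def)
    have "\<bar>w\<^sup>2 / 2\<bar> \<le> \<bar>w\<bar> * (1/2)" using mult_left_mono[OF w, of "\<bar>w\<bar>"] by (simp add: power2_eq_square)
    moreover have "\<bar>u\<bar> \<le> \<bar>w * y\<bar> + \<bar>w\<^sup>2 / 2\<bar>" unfolding u_def by (rule abs_triangle_ineq4)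
    ultimately have uw: "\<bar>u\<bar> \<le> \<bar>w\<bar> * v" by (simp add: v_def abs_mult algebra_simps)
    also have "\<dots> \<le> v" using w v0 by (simp add: mult_left_le_one_le)
    finally have uv: "\<bar>u\<bar> \<le> v" .
    have "u\<^sup>2 \<le> (\<bar>w\<bar> * v)\<^sup>2" using power_mono[OF uw, of 2] by simp
    then have u2: "u\<^sup>2 \<le> w\<^sup>2 * v\<^sup>2" by (simp add: power_mult_distrib)
    have v2: "v\<^sup>2 \<le> 2 * exp v" using exp_lower_Taylor_quadratic[OF v0] v0 by simp
    have "0 \<le> exp u - 1 - u" by (rule exp_remainder_bounds)
    moreover have "exp u - 1 - u \<le> w\<^sup>2 * (2 * exp (2 * \<bar>y\<bar> + 1))"
    proof -
      have "exp u - 1 - u \<le> u\<^sup>2 * exp \<bar>u\<bar>" by (rule exp_remainder_bounds)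
      also have "\<dots> \<le> (w\<^sup>2 * v\<^sup>2) * exp v" by (intro mult_mono u2) (use uv in auto)
      also have "\<dots> \<le> (w\<^sup>2 * (2 * exp v)) * exp v" using v2 by (intro mult_right_mono mult_left_mono) auto
      also have "\<dots> = w\<^sup>2 * (2 * exp (v + v))" by (simp only: exp_add mult_ac)
      finally show ?thesis by (simp add: v_def)
    qed
    moreover have "w * y = u + w\<^sup>2 / 2" by (simp add: u_def)
    moreover have "0 \<le> w\<^sup>2 * (2 * exp (2 * \<bar>y\<bar> + 1))" "0 \<le> w\<^sup>2" by simp_all
    moreover have "w\<^sup>2 * (2 * exp (2 * \<bar>y\<bar> + 1) + 1/2) = w\<^sup>2 * (2 * exp (2 * \<bar>y\<bar> + 1)) + w\<^sup>2 / 2"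
      by (simp add: distrib_left)
    ultimately have r: "\<bar>exp u - 1 - w * y\<bar> \<le> w\<^sup>2 * (2 * exp (2 * \<bar>y\<bar> + 1) + 1/2)"
      unfolding abs_le_iff by linarith
    have e2: "exp (2 * \<bar>y\<bar>) * std_normal_density y \<le> exp 2 * (normal_density 2 1 y + normal_density (-2) 1 y)"
    proof -
      have p: "exp (2 * y) * std_normal_density y = exp 2 * normal_density 2 1 y"
      proof -
        have "exp 2 * normal_density 2 1 y = std_normal_density y * (exp 2 * exp (2 * y - 2\<^sup>2 / 2))"
          using std_normal_density_tilt[of y 2] normal_density_shift[of y 2] by simp
        also have "exp 2 * exp (2 * y - 2\<^sup>2 / 2) = exp (2 * y)" by (simp add: exp_add[symmetric])
        finally show ?thesis by simp
      qed
      have m: "exp (- 2 * y) * std_normal_density y = exp 2 * normal_density (-2) 1 y"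
      proof -
        have "exp 2 * normal_density (-2) 1 y = std_normal_density y * (exp 2 * exp ((-2) * y - (-2)\<^sup>2 / 2))"
          using std_normal_density_tilt[of y "-2"] normal_density_shift[of y "-2"] by simp
        also have "exp 2 * exp ((-2) * y - (-2)\<^sup>2 / 2) = exp (-2 * y)" by (simp add: exp_add[symmetric])
        finally show ?thesis by simp
      qed
      have "exp (2 * \<bar>y\<bar>) \<le> exp (2 * y) + exp (- 2 * y)" by (cases "0 \<le> y") auto
      then have "exp (2 * \<bar>y\<bar>) * std_normal_density y \<le> (exp (2 * y) + exp (- 2 * y)) * std_normal_density y"
        by (intro mult_right_mono) auto
      then show ?thesis unfolding distrib_right distrib_left p m .
    qed
    have "normal_density w 1 y - std_normal_density y - w * (y * std_normal_density y) = std_normal_density y * (exp u - 1 - w * y)"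
      using std_normal_density_tilt[of y w] normal_density_shift[of y w] by (simp add: u_def algebra_simps)
    then have "\<bar>normal_density w 1 y - std_normal_density y - w * (y * std_normal_density y)\<bar> = std_normal_density y * \<bar>exp u - 1 - w * y\<bar>"
      by (simp add: abs_mult)
    also have "\<dots> \<le> std_normal_density y * (w\<^sup>2 * (2 * exp (2 * \<bar>y\<bar> + 1) + 1/2))"
      using r by (intro mult_left_mono) auto
    also have "\<dots> = w\<^sup>2 * (2 * exp 1 * (exp (2 * \<bar>y\<bar>) * std_normal_density y) + std_normal_density y / 2)"
      by (simp add: exp_add algebra_simps)
    also have "\<dots> \<le> w\<^sup>2 * (2 * exp 1 * (exp 2 * (normal_density 2 1 y + normal_density (-2) 1 y)) + std_normal_density y / 2)"
      using e2 by (intro mult_left_mono add_right_mono) auto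
    also have "\<dots> = w\<^sup>2 * Q y"
    proof -
      have "exp 1 * exp 2 = exp (3::real)" by (simp add: exp_add[symmetric])
      then show ?thesis unfolding Q_def by (simp only: mult.assoc[symmetric]) (simp add: mult.assoc)
    qed
    finally show ?thesis .
  qed
  define IQ where "IQ = (\<integral>y. Q y \<partial>lborel)"
  have IQ0: "0 \<le> IQ" unfolding IQ_def using Q0 by (intro Bochner_Integration.integral_nonneg) auto
  have Ub: "\<bar>gauss_mean H w\<bar> \<le> B" for w
    by (rule gauss_mean_bounded[OF assms])
  \<comment> \<open>\<open>B * IQ\<close> serves the case \<open>\<bar>w\<bar> <= 1\<close>, the
    other summands the opposite case.\<close>
  define C where "C = B * IQ + 2 * B + \<bar>gauss_slope H\<bar>"
  have "\<bar>gauss_mean H w - gauss_slope H * w - gauss_mean H 0\<bar> \<le> C * w\<^sup>2" for w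
  proof (cases "\<bar>w\<bar> \<le> 1")
    case True
    have "gauss_mean H w - gauss_slope H * w - gauss_mean H 0 =
      (\<integral>y. (H y * normal_density w 1 y - w * (H y * (y * std_normal_density y))) - H y * normal_density 0 1 y \<partial>lborel)"
      using iH i1 unfolding U gauss_slope_def by simp
    also have "\<dots> = (\<integral>y. H y * (normal_density w 1 y - std_normal_density y - w * (y * std_normal_density y)) \<partial>lborel)"
      by (intro Bochner_Integration.integral_cong refl) (simp add: algebra_simps)
    finally have eq: "gauss_mean H w - gauss_slope H * w - gauss_mean H 0 = \<dots>" .
    have "\<bar>gauss_mean H w - gauss_slope H * w - gauss_mean H 0\<bar> \<le>
      (\<integral>y. \<bar>H y * (normal_density w 1 y - std_normal_density y - w * (y * std_normal_density y))\<bar> \<partial>lborel)"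
      unfolding eq by (rule integral_abs_bound)
    also have "\<dots> \<le> (\<integral>y. B * (w\<^sup>2 * Q y) \<partial>lborel)"
    proof (rule integral_mono)
      have "integrable lborel (\<lambda>y. normal_density w 1 y - std_normal_density y - w * (y * std_normal_density y))"
        by (intro Bochner_Integration.integrable_diff nd integrable_mult_right integrable_std_normal_first_moment)
      from integrable_bounded_mult[OF this assms(1) B]
      show "integrable lborel (\<lambda>y. \<bar>H y * (normal_density w 1 y - std_normal_density y - w * (y * std_normal_density y))\<bar>)"
        by (rule integrable_abs)
      show "integrable lborel (\<lambda>y. B * (w\<^sup>2 * Q y))" using iQ by (intro integrable_mult_right)
      show "\<bar>H y * (normal_density w 1 y - std_normal_density y - w * (y * std_normal_density y))\<bar> \<le> B * (w\<^sup>2 * Q y)" for y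
        unfolding abs_mult[of "H y"] by (rule mult_mono[OF B key[OF True] B0]) simp
    qed
    also have "\<dots> = B * IQ * w\<^sup>2" by (simp add: IQ_def)
    also have "\<dots> \<le> C * w\<^sup>2" unfolding C_def using B0 by (intro mult_right_mono) auto
    finally show ?thesis .
  next
    case False
    then have w1: "1 \<le> \<bar>w\<bar>" by simp
    then have w2: "1 \<le> w\<^sup>2" using power_mono[of 1 "\<bar>w\<bar>" 2] by simp
    have "\<bar>w\<bar> \<le> w\<^sup>2" using w1 mult_left_mono[of 1 "\<bar>w\<bar>" "\<bar>w\<bar>"] by (simp add: power2_eq_square abs_mult[symmetric])
    then have "\<bar>gauss_slope H * w\<bar> \<le> \<bar>gauss_slope H\<bar> * w\<^sup>2" unfolding abs_mult by (intro mult_left_mono) auto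
    moreover have "2 * B \<le> 2 * B * w\<^sup>2" using B0 w2 mult_left_mono[of 1 "w\<^sup>2" "2 * B"] by simp
    moreover have "\<bar>gauss_mean H w - gauss_slope H * w - gauss_mean H 0\<bar> \<le> 2 * B + \<bar>gauss_slope H * w\<bar>"
      using Ub[of w] Ub[of 0] by linarith
    moreover have "0 \<le> B * IQ * w\<^sup>2" using B0 IQ0 by simp
    ultimately show ?thesis unfolding C_def distrib_right by linarith
  qed
  moreover have "0 \<le> C" unfolding C_def using B0 IQ0 by simp
  ultimately show ?thesis by blast
qed

lemma integral_odd_gaussian:
  fixes H :: "real \<Rightarrow> real"
  assumes odd: "\<And>x. H (- x) = - H x"
  shows "(\<integral>y. H (c * y) * std_normal_density y \<partial>lborel) = 0"
proof -
  define I where "I = (\<integral>y. H (c * y) * std_normal_density y \<partial>lborel)"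
  have a: "0 + (- 1) * y = - y" for y :: real by simp
  have "I = \<bar>- 1\<bar> *\<^sub>R (\<integral>y. H (c * (0 + (- 1) * y)) * std_normal_density (0 + (- 1) * y) \<partial>lborel)"
    unfolding I_def by (rule lborel_integral_real_affine) simp
  also have "\<dots> = (\<integral>y. - (H (c * y) * std_normal_density y) \<partial>lborel)"
    unfolding a by (simp add: odd std_normal_density_def)
  also have "\<dots> = - I" unfolding I_def by simp
  finally show ?thesis unfolding I_def by simp
qed

section \<open>Free averages of odd test functions\<close>

context bounded_density_walk
begin

lemma walk_abs_moment_le: "(\<integral>\<omega>. \<bar>walk X r \<omega>\<bar> \<partial>M) \<le> real r + 1"
proof -
  have "(\<integral>\<omega>. \<bar>walk X r \<omega>\<bar> \<partial>M) \<le> (\<integral>\<omega>. (walk X r \<omega>)\<^sup>2 + 1 \<partial>M)"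
  proof (rule integral_mono)
    show "integrable M (\<lambda>\<omega>. \<bar>walk X r \<omega>\<bar>)" by (rule integrable_abs[OF walk_second_moment(2)])
    show "integrable M (\<lambda>\<omega>. (walk X r \<omega>)\<^sup>2 + 1)" by (intro Bochner_Integration.integrable_add walk_second_moment) simp
    have "\<bar>s\<bar> \<le> s\<^sup>2 + 1" for s :: real
    proof (cases "\<bar>s\<bar> \<le> 1")
      case False
      then show ?thesis using mult_left_mono[of 1 "\<bar>s\<bar>" "\<bar>s\<bar>"] by (simp add: power2_eq_square abs_mult[symmetric])
    qed (simp add: order_trans[of _ 1])
    then show "\<bar>walk X r \<omega>\<bar> \<le> (walk X r \<omega>)\<^sup>2 + 1" for \<omega> by blast
  qed
  also have "\<dots> = real r + 1"
    using walk_second_moment(1,4)[of r] prob_space by simp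
  finally show ?thesis .
qed

lemma avg_scaled_approx:
  assumes [measurable]: "H \<in> borel_measurable borel" and B: "\<And>x. \<bar>H x\<bar> \<le> B"
    and r: "1 \<le> r"
  shows "\<bar>avg r (\<lambda>x. H (x / s)) z - (\<integral>y. H ((z + sqrt (real r) * y) / s) * std_normal_density y \<partial>lborel)\<bar> \<le> B * tv r"
proof -
  have sr: "sqrt (real r) > 0" using r by simp
  have "avg r (\<lambda>x. H (x / s)) z = (\<integral>\<omega>. H ((z + sqrt (real r) * (walk X r \<omega> / sqrt (real r))) / s) \<partial>M)"
    unfolding avg_def using sr by simp
  then show ?thesis
    using clt_total_variation[OF r, of "\<lambda>y. H ((z + sqrt (real r) * y) / s)" B] B by simp
qed

text \<open>Uniformity in \<open>r\<close> is the point. Beyond a fixed \<open>R\<close> the normal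
  approximation applies: its mean vanishes at \<open>z = 0\<close> by oddness, and the Lipschitz
  bound controls the shift by \<open>z\<close>. For smaller \<open>r\<close> the walk moves O(R) on
  average, negligible against \<open>sqrt N\<close>.\<close>

lemma avg_odd_small:
  assumes [measurable]: "H \<in> borel_measurable borel" and B: "\<And>x. \<bar>H x\<bar> \<le> B"
    and odd: "\<And>x. H (- x) = - H x" and lip: "\<And>x y. \<bar>H x - H y\<bar> \<le> l * \<bar>x - y\<bar>" and "\<theta> > 0"
  shows "\<exists>\<eta>>0. \<exists>N\<^sub>0. \<forall>N r z. N\<^sub>0 \<le> N \<longrightarrow> \<bar>z\<bar> \<le> 2 * (\<eta> * sqrt (real N)) \<longrightarrow> \<bar>avg r (\<lambda>x. H (x / sqrt (real N))) z\<bar> \<le> \<theta>"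
proof -
  have "\<bar>H 1 - H 0\<bar> \<le> l" using lip[of 1 0] by simp
  then have l0: "0 \<le> l" by linarith
  have H0: "H 0 = 0" using odd[of 0] by simp
  \<comment> \<open>Half of \<theta> is reserved for the shift, \<open>l * (2 * \<eta>)\<close>;
    \<open>l + 1\<close> in place of \<open>l\<close> covers \<open>l = 0\<close>.\<close>
  define \<eta> where "\<eta> = \<theta> / (4 * (l + 1))"
  have \<eta>: "\<eta> > 0" using assms l0 by (simp add: \<eta>_def)
  have "l * (4 * \<eta>) \<le> \<theta>" using l0 assms(5) by (simp add: \<eta>_def field_simps)
  then have l\<eta>: "l * (2 * \<eta>) \<le> \<theta> / 2" by simp
  have "(\<lambda>r. B * tv r) \<longlonglongrightarrow> B * 0" by (intro tendsto_intros tv_tendsto)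
  then have "\<forall>\<^sub>F r in sequentially. B * tv r < \<theta> / 2" using assms(5) by (intro order_tendstoD) auto
  then obtain R where R: "\<And>r. r \<ge> R \<Longrightarrow> B * tv r < \<theta> / 2" by (auto simp: eventually_at_top_linorder)
  have "filterlim (\<lambda>N. sqrt (real N)) at_top sequentially"
    by (rule filterlim_compose[OF sqrt_at_top filterlim_real_sequentially])
  then have "\<forall>\<^sub>F N in sequentially. 2 * l * (real R + 1) / \<theta> + 1 \<le> sqrt (real N)" unfolding filterlim_at_top by blast
  then obtain N0 where N0: "\<And>N. N \<ge> N0 \<Longrightarrow> 2 * l * (real R + 1) / \<theta> + 1 \<le> sqrt (real N)" by (auto simp: eventually_at_top_linorder)
  have "\<bar>avg r (\<lambda>x. H (x / sqrt (real N))) z\<bar> \<le> \<theta>" if N: "N0 \<le> N" and z: "\<bar>z\<bar> \<le> 2 * (\<eta> * sqrt (real N))" for N r z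
  proof -
    define s where "s = sqrt (real N)"
    have "0 \<le> 2 * l * (real R + 1) / \<theta>" using l0 assms(5) by simp
    then have s: "s > 0" "2 * l * (real R + 1) / \<theta> \<le> s" using N0[OF N] unfolding s_def by linarith+
    have zs: "l * (\<bar>z\<bar> / s) \<le> \<theta> / 2"
    proof -
      have "\<bar>z\<bar> / s \<le> 2 * \<eta>" using z s(1) unfolding s_def[symmetric] by (simp add: field_simps)
      then have "l * (\<bar>z\<bar> / s) \<le> l * (2 * \<eta>)" using l0 by (rule mult_left_mono)
      then show ?thesis using l\<eta> by linarith
    qed
    show ?thesis
    proof (cases "max R 1 \<le> r")
      case True
      then have r: "1 \<le> r" "R \<le> r" by auto
      have h1: "integrable lborel (\<lambda>y. H ((z + sqrt (real r) * y) / s) * std_normal_density y)" for z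
        by (rule integrable_bounded_mult[OF _ _ B]) auto
      have "(\<integral>y. H ((z + sqrt (real r) * y) / s) * std_normal_density y \<partial>lborel) =
         (\<integral>y. H ((z + sqrt (real r) * y) / s) * std_normal_density y \<partial>lborel) - (\<integral>y. H ((0 + sqrt (real r) * y) / s) * std_normal_density y \<partial>lborel)"
        using integral_odd_gaussian[of H "sqrt (real r) / s", OF odd] by simp
      also have "\<dots> = (\<integral>y. (H ((z + sqrt (real r) * y) / s) - H ((0 + sqrt (real r) * y) / s)) * std_normal_density y \<partial>lborel)"
        unfolding left_diff_distrib Bochner_Integration.integral_diff[OF h1 h1] ..
      finally have eq: "(\<integral>y. H ((z + sqrt (real r) * y) / s) * std_normal_density y \<partial>lborel) = \<dots>" .
      have "\<bar>\<integral>y. H ((z + sqrt (real r) * y) / s) * std_normal_density y \<partial>lborel\<bar> \<le>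
         (\<integral>y. \<bar>(H ((z + sqrt (real r) * y) / s) - H ((0 + sqrt (real r) * y) / s)) * std_normal_density y\<bar> \<partial>lborel)"
        unfolding eq by (rule integral_abs_bound)
      also have "\<dots> \<le> (\<integral>y. (l * (\<bar>z\<bar> / s)) * std_normal_density y \<partial>lborel)"
      proof (rule integral_mono)
        show "integrable lborel (\<lambda>y. \<bar>(H ((z + sqrt (real r) * y) / s) - H ((0 + sqrt (real r) * y) / s)) * std_normal_density y\<bar>)"
          unfolding left_diff_distrib by (intro integrable_abs Bochner_Integration.integrable_diff h1)
        fix y
        have "\<bar>H ((z + sqrt (real r) * y) / s) - H ((0 + sqrt (real r) * y) / s)\<bar> \<le> l * \<bar>(z + sqrt (real r) * y) / s - (0 + sqrt (real r) * y) / s\<bar>"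
          by (rule lip)
        also have "(z + sqrt (real r) * y) / s - (0 + sqrt (real r) * y) / s = z / s" by (simp add: add_divide_distrib)
        finally have f: "\<bar>H ((z + sqrt (real r) * y) / s) - H ((0 + sqrt (real r) * y) / s)\<bar> \<le> l * (\<bar>z\<bar> / s)" using s by simp
        show "\<bar>(H ((z + sqrt (real r) * y) / s) - H ((0 + sqrt (real r) * y) / s)) * std_normal_density y\<bar> \<le> (l * (\<bar>z\<bar> / s)) * std_normal_density y"
          unfolding abs_mult abs_of_nonneg[OF normal_density_nonneg]
          by (rule mult_right_mono[OF f normal_density_nonneg])
      qed simp
      also have "\<dots> = l * (\<bar>z\<bar> / s)" by simp
      finally show ?thesis using avg_scaled_approx[OF assms(1) B r(1), of s z] R[OF r(2)] zs unfolding s_def[symmetric] by linarith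
    next
      case False
      have iS: "integrable M (\<lambda>\<omega>. \<bar>walk X r \<omega>\<bar>)" by (rule integrable_abs[OF walk_second_moment(2)])
      have "\<bar>avg r (\<lambda>x. H (x / s)) z\<bar> \<le> (\<integral>\<omega>. \<bar>H ((z + walk X r \<omega>) / s)\<bar> \<partial>M)"
        unfolding avg_def by (rule integral_abs_bound)
      also have "\<dots> \<le> (\<integral>\<omega>. l * (\<bar>z\<bar> / s) + l / s * \<bar>walk X r \<omega>\<bar> \<partial>M)"
      proof (rule integral_mono)
        show "integrable M (\<lambda>\<omega>. \<bar>H ((z + walk X r \<omega>) / s)\<bar>)"
          by (rule integrable_const_bound[where B=B]) (use B in auto)
        show "integrable M (\<lambda>\<omega>. l * (\<bar>z\<bar> / s) + l / s * \<bar>walk X r \<omega>\<bar>)" using iS by simp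
        fix \<omega>
        have "\<bar>H ((z + walk X r \<omega>) / s)\<bar> \<le> l * \<bar>(z + walk X r \<omega>) / s\<bar>" using lip[of "(z + walk X r \<omega>) / s" 0] H0 by simp
        also have "\<dots> \<le> l * ((\<bar>z\<bar> + \<bar>walk X r \<omega>\<bar>) / s)" using s l0 by (intro mult_left_mono) (auto simp: divide_right_mono)
        finally show "\<bar>H ((z + walk X r \<omega>) / s)\<bar> \<le> l * (\<bar>z\<bar> / s) + l / s * \<bar>walk X r \<omega>\<bar>" by (simp add: add_divide_distrib algebra_simps)
      qed
      also have "\<dots> = l * (\<bar>z\<bar> / s) + l / s * (\<integral>\<omega>. \<bar>walk X r \<omega>\<bar> \<partial>M)" using iS prob_space by simp
      also have "\<dots> \<le> \<theta> / 2 + l / s * (real R + 1)"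
      proof -
        have "(\<integral>\<omega>. \<bar>walk X r \<omega>\<bar> \<partial>M) \<le> real R + 1" 
          using walk_abs_moment_le[of r] False by (simp add: max_def split: if_splits)
        then show ?thesis using zs s l0 by (intro add_mono mult_left_mono) auto
      qed
      also have "l / s * (real R + 1) \<le> \<theta> / 2"
        using s assms(5) by (simp add: field_simps)
      finally show ?thesis unfolding s_def by simp
    qed
  qed
  then show ?thesis using \<eta> by blast
qed

end

section \<open>Comparison of killed and free evolution\<close>

context boundary_walk
begin

lemma K_const: "K n (\<lambda>_. c) = c * q n"
  unfolding K_def integral_alive ..

lemma K_cmult: "K n (\<lambda>x. c * F x) = c * K n F"
  unfolding K_def by (subst integral_mult_right_zero[symmetric]) (simp only: mult.left_commute)

lemma K_mono:
  assumes "integrable M (\<lambda>\<omega>. F (walk X n \<omega>))" "integrable M (\<lambda>\<omega>. G (walk X n \<omega>))"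
    and "1 \<le> n" "\<And>x. g n < x \<Longrightarrow> F x \<le> G x"
  shows "K n F \<le> K n G"
  unfolding K_def
proof (rule integral_mono[OF integrable_alive[OF assms(1)] integrable_alive[OF assms(2)]])
  show "indicator (alive n) \<omega> * F (walk X n \<omega>) \<le> indicator (alive n) \<omega> * G (walk X n \<omega>)" for \<omega>
    using assms(4)[of "walk X n \<omega>"] alive_above[OF assms(3), of \<omega>] by (auto simp: indicator_def)
qed

lemma K_diff_le:
  assumes F: "integrable M (\<lambda>\<omega>. F (walk X n \<omega>))" and G: "integrable M (\<lambda>\<omega>. G (walk X n \<omega>))"
    and E: "integrable M (\<lambda>\<omega>. E (walk X n \<omega>))"
    and n: "1 \<le> n" and le: "\<And>x. g n < x \<Longrightarrow> \<bar>F x - G x\<bar> \<le> E x"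
  shows "\<bar>K n F - K n G\<bar> \<le> K n E"
proof -
  have "K n F - K n G = K n (\<lambda>x. F x - G x)"
    unfolding K_def right_diff_distrib
    by (rule Bochner_Integration.integral_diff[OF integrable_alive[OF F] integrable_alive[OF G], symmetric])
  moreover have "K n (\<lambda>x. F x - G x) \<le> K n E"
    using le by (intro K_mono Bochner_Integration.integrable_diff F G E n) (meson abs_le_D1)
  moreover have "K n (\<lambda>x. (- 1) * (F x - G x)) \<le> K n E"
  proof (intro K_mono integrable_mult_right Bochner_Integration.integrable_diff F G E n)
    show "- 1 * (F x - G x) \<le> E x" if "g n < x" for x using le[OF that] by (simp add: abs_le_iff)
  qed
  ultimately show ?thesis unfolding K_cmult by linarith
qed

text \<open>Along the free walk, \<open>avg (N - j) F\<close> at time \<open>m + j\<close> is a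
  martingale, so its killed mean changes only through paths killed at each step. Without a jump
  beyond \<open>G\<close> these end within \<open>2 * G\<close> of 0, where every free average is at
  most \<theta>.\<close>

lemma K_avg_diff:
  assumes F [measurable]: "F \<in> borel_measurable borel" and B: "\<And>x. \<bar>F x\<bar> \<le> B"
    and m: "1 \<le> m" and G: "\<And>i. m \<le> i \<Longrightarrow> i \<le> m + N \<Longrightarrow> \<bar>g i\<bar> \<le> G"
    and small: "\<And>r z. r \<le> N \<Longrightarrow> \<bar>z\<bar> \<le> 2 * G \<Longrightarrow> \<bar>avg r F z\<bar> \<le> \<theta>" and j: "j \<le> N"
  shows "\<bar>K m (avg N F) - K (m + j) (avg (N - j) F)\<bar> \<le>
    \<theta> * (q m - q (m + j)) + real j * q m * (B * (\<integral>t. indicator {t. G < \<bar>t\<bar>} t \<partial>\<mu>))"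
  using j
proof (induction j)
  case (Suc j)
  let ?I = "B * (\<integral>t. indicator {t. G < \<bar>t\<bar>} t \<partial>\<mu>)"
  have B0: "0 \<le> B" using B[of 0] by simp
  have G0: "0 \<le> G" using G[of m] by simp
  have \<theta>0: "0 \<le> \<theta>" using small[of 0 0] G0 by simp
  have I0: "0 \<le> ?I" using B0 by (intro mult_nonneg_nonneg Bochner_Integration.integral_nonneg) auto
  define r where "r = N - Suc j"
  have r: "N - j = Suc r" using Suc.prems by (simp add: r_def)
  have step: "\<bar>K (m + j) (\<lambda>x. \<integral>t. avg r F (x + t) \<partial>\<mu>) - K (Suc (m + j)) (avg r F)\<bar> \<le>
     \<theta> * (q (m + j) - q (Suc (m + j))) + q (m + j) * (\<integral>t. B * indicator {t. G < \<bar>t\<bar>} t \<partial>\<mu>)"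
  proof (rule killed_step)
    show "integrable M (\<lambda>\<omega>. avg r F (walk X (Suc (m + j)) \<omega>))"
      by (rule integrable_bounded_walk[OF _ avg_bounded[OF F B]]) measurable
    show "integrable \<mu> (\<lambda>t. B * indicator {t. G < \<bar>t\<bar>} t)"
      by (rule \<mu>.integrable_const_bound[where B=B]) (use B0 in \<open>auto simp: indicator_def\<close>)
    fix x t assume xt: "g (m + j) < x" "x + t \<le> g (Suc (m + j))"
    show "\<bar>avg r F (x + t)\<bar> \<le> \<theta> + B * indicator {t. G < \<bar>t\<bar>} t"
    proof (cases "G < \<bar>t\<bar>")
      case True
      then show ?thesis using avg_bounded[OF F B, of r "x + t"] \<theta>0 by simp
    next
      case False
      have "\<bar>g (m + j)\<bar> \<le> G" "\<bar>g (Suc (m + j))\<bar> \<le> G" by (rule G, use Suc.prems in simp, use Suc.prems in simp)+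
      then have "\<bar>x + t\<bar> \<le> 2 * G" using xt False G0 by linarith
      then show ?thesis using small[of r "x + t"] False by (simp add: r_def)
    qed
  qed (use m B0 in auto)
  have eq: "(\<lambda>x. \<integral>t. avg r F (x + t) \<partial>\<mu>) = avg (N - j) F"
    unfolding r by (rule ext) (rule avg_Suc[OF F B, symmetric])
  note step[unfolded eq integral_mult_right_zero]
  moreover have "\<bar>K m (avg N F) - K (m + j) (avg (N - j) F)\<bar> \<le> \<theta> * (q m - q (m + j)) + real j * q m * ?I"
    by (rule Suc.IH) (use Suc.prems in simp)
  moreover have "q (m + j) * ?I \<le> q m * ?I" by (intro mult_right_mono q_antimono I0) simp
  ultimately have "\<bar>K m (avg N F) - K (Suc (m + j)) (avg r F)\<bar> \<le>
     \<theta> * (q m - q (m + j)) + real j * q m * ?I + (\<theta> * (q (m + j) - q (Suc (m + j))) + q m * ?I)"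
    by linarith
  then show ?case unfolding r_def by (simp add: algebra_simps)
qed simp

text \<open>The error is measured by \<open>q (n div d)\<close>, which bounds all mass killed
  between the two times. The scale inside \<open>H\<close> matches the length of the free stretch,
  so that smoothing over it is by a standard normal.\<close>

lemma K_invariance:
  assumes H [measurable]: "H \<in> borel_measurable borel" and B: "\<And>x. \<bar>H x\<bar> \<le> B"
    and odd: "\<And>x. H (- x) = - H x" and lip: "\<And>x y. \<bar>H x - H y\<bar> \<le> l * \<bar>x - y\<bar>" and \<theta>: "\<theta> > 0"
    and d: "2 \<le> d"
  shows "\<forall>\<^sub>F n in sequentially. \<bar>K n (\<lambda>x. H (x / sqrt (real (n - n div d)))) -
     K (n div d) (avg (n - n div d) (\<lambda>x. H (x / sqrt (real (n - n div d)))))\<bar> \<le> \<theta> * q (n div d)"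
proof -
  have B0: "0 \<le> B" using B[of 0] by simp
  obtain \<eta> N0 where \<eta>: "\<eta> > 0" and N0: "\<And>N r z. N0 \<le> N \<Longrightarrow> \<bar>z\<bar> \<le> 2 * (\<eta> * sqrt (real N)) \<Longrightarrow> \<bar>avg r (\<lambda>x. H (x / sqrt (real N))) z\<bar> \<le> \<theta> / 2"
    using avg_odd_small[OF H B odd lip half_gt_zero[OF \<theta>]] by blast
  \<comment> \<open>Times run up to \<open>n\<close>, which is at most \<open>4 * N\<close>, so
    \<open>sqrt i <= 2 * sqrt N\<close>; the half compensates.\<close>
  obtain N1 where N1: "\<And>i. i \<ge> N1 \<Longrightarrow> \<bar>g i\<bar> \<le> \<eta> / 2 * sqrt (real i)" using g_bound[of "\<eta> / 2"] \<eta> by auto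
  have "(\<lambda>N. B * (tail2 \<eta> N / \<eta>\<^sup>2)) \<longlonglongrightarrow> B * (0 / \<eta>\<^sup>2)" by (intro tendsto_intros tail2_tendsto \<eta>) (use \<eta> in auto)
  then have "\<forall>\<^sub>F N in sequentially. B * (tail2 \<eta> N / \<eta>\<^sup>2) < \<theta> / 2" using \<theta> by (intro order_tendstoD) auto
  then obtain N2 where N2: "\<And>N. N \<ge> N2 \<Longrightarrow> B * (tail2 \<eta> N / \<eta>\<^sup>2) < \<theta> / 2" by (auto simp: eventually_at_top_linorder)
  define k where "k = max (max (max N0 N1) N2) 1"
  show ?thesis
    using eventually_ge_at_top[of "d * k"]
  proof eventually_elim
    case (elim n)
    define m where "m = n div d"
    define N where "N = n - m"
    have mk: "k \<le> m" unfolding m_def using div_le_mono[OF elim, of d] d by simp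
    have "m \<le> n div 2" unfolding m_def using d by (intro div_le_mono2) auto
    then have mN: "m \<le> N" and n: "n = m + N" "n \<le> 2 * N" unfolding N_def by linarith+
    have m1: "1 \<le> m" using mk by (simp add: k_def)
    let ?F = "\<lambda>x. H (x / sqrt (real N))"
    have gi: "\<bar>g i\<bar> \<le> \<eta> * sqrt (real N)" if "m \<le> i" "i \<le> m + N" for i
    proof -
      have "\<bar>g i\<bar> \<le> \<eta> / 2 * sqrt (real i)" using N1[of i] that mk by (simp add: k_def)
      also have "\<dots> \<le> \<eta> / 2 * sqrt (2\<^sup>2 * real N)" using that n \<eta> by (intro mult_left_mono real_sqrt_le_mono) auto
      also have "\<dots> = \<eta> * sqrt (real N)" by (simp add: real_sqrt_mult)
      finally show ?thesis .
    qed
    define P where "P = B * (\<integral>t. indicator {t. \<eta> * sqrt (real N) < \<bar>t\<bar>} t \<partial>\<mu>)"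
    have "avg (N - N) ?F = ?F" by (rule ext) simp
    moreover have "\<bar>K m (avg N ?F) - K (m + N) (avg (N - N) ?F)\<bar> \<le>
      \<theta> / 2 * (q m - q (m + N)) + real N * q m * (B * (\<integral>t. indicator {t. \<eta> * sqrt (real N) < \<bar>t\<bar>} t \<partial>\<mu>))"
    proof (rule K_avg_diff[OF _ _ m1 gi])
      show "\<bar>avg r ?F z\<bar> \<le> \<theta> / 2" if "\<bar>z\<bar> \<le> 2 * (\<eta> * sqrt (real N))" for r z
        using N0[of N z r] that mN mk by (simp add: k_def)
    qed (use B in auto)
    ultimately have diff: "\<bar>K m (avg N ?F) - K (m + N) ?F\<bar> \<le> \<theta> / 2 * (q m - q (m + N)) + real N * q m * P"
      unfolding P_def by (simp only:)
    have "real N * P \<le> \<theta> / 2"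
    proof -
      have "real N * (B * (\<integral>t. indicator {t. \<eta> * sqrt (real N) < \<bar>t\<bar>} t \<partial>\<mu>)) = B * (real N * (\<integral>t. indicator {t. \<eta> * sqrt (real N) < \<bar>t\<bar>} t \<partial>\<mu>))"
        by (simp only: mult.left_commute)
      also have "\<dots> \<le> B * (tail2 \<eta> N / \<eta>\<^sup>2)" by (intro mult_left_mono tail_prob_le \<eta> B0)
      also have "\<dots> \<le> \<theta> / 2" using N2[of N] mN mk by (simp add: k_def)
      finally show ?thesis unfolding P_def .
    qed
    then have "q m * (real N * P) \<le> q m * (\<theta> / 2)"
      by (rule mult_left_mono[OF _ q_nonneg])
    then have "real N * q m * P \<le> \<theta> / 2 * q m" by (simp only: mult_ac)
    moreover have "\<theta> / 2 * (q m - q (m + N)) \<le> \<theta> / 2 * q m" using \<theta> q_nonneg[of "m + N"] by (intro mult_left_mono) auto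
    ultimately have "\<bar>K m (avg N ?F) - K (m + N) ?F\<bar> \<le> \<theta> * q m" using diff by linarith
    then have "\<bar>K m (avg N ?F) - K n ?F\<bar> \<le> \<theta> * q m" unfolding n(1)[symmetric] .
    then show ?case unfolding N_def m_def by (simp only: abs_minus_commute)
  qed
qed

section \<open>Comparison of quantities at times n and n div d\<close>

lemma q_le_L: "\<exists>\<kappa>\<ge>0. \<forall>\<^sub>F n in sequentially. sqrt (real n) * q n \<le> \<kappa> * L n"
proof -
  obtain c N where c: "c > 0" "\<And>n. n \<ge> N \<Longrightarrow> c * sqrt (real n) * q n \<le> L n" using L_ge by auto
  have "\<forall>\<^sub>F n in sequentially. sqrt (real n) * q n \<le> (1 / c) * L n"
    using eventually_ge_at_top[of N] by eventually_elim (use c in \<open>simp add: field_simps\<close>)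
  then show ?thesis using c(1) by (intro exI[of _ "1 / c"]) auto
qed

text \<open>By \<open>L_eq\<close>, \<open>g n * q n\<close> is exactly the difference of
  \<open>D n\<close> and \<open>L n\<close>, so the two become interchangeable.\<close>

lemma g_q_small:
  assumes "\<epsilon> > 0"
  shows "\<forall>\<^sub>F n in sequentially. \<bar>g n\<bar> * q n \<le> \<epsilon> * L n"
proof -
  obtain \<kappa> where \<kappa>: "\<kappa> \<ge> 0" "\<forall>\<^sub>F n in sequentially. sqrt (real n) * q n \<le> \<kappa> * L n" using q_le_L by auto
  define e where "e = \<epsilon> / (\<kappa> + 1)"
  have e: "e > 0" using assms \<kappa> by (simp add: e_def)
  obtain N where N: "\<And>i. i \<ge> N \<Longrightarrow> \<bar>g i\<bar> \<le> e * sqrt (real i)" using g_bound[OF e] by auto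
  show ?thesis using \<kappa>(2) eventually_ge_at_top[of "max N 1"]
  proof eventually_elim
    case (elim n)
    have "\<bar>g n\<bar> * q n \<le> (e * sqrt (real n)) * q n" using N[of n] elim by (intro mult_right_mono q_nonneg) auto
    also have "\<dots> \<le> e * (\<kappa> * L n)" using elim(1) e by (simp add: mult.assoc mult_left_mono)
    also have "\<dots> \<le> e * ((\<kappa> + 1) * L n)" using e L_pos[of n] elim by (intro mult_left_mono mult_right_mono) auto
    also have "\<dots> = \<epsilon> * L n" using \<kappa> by (simp add: e_def)
    finally show ?case .
  qed
qed

lemma filterlim_div: "1 \<le> d \<Longrightarrow> filterlim (\<lambda>n. n div d) at_top sequentially" for d :: nat
  unfolding filterlim_at_top eventually_sequentially
proof
  fix Z assume d: "1 \<le> d"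
  show "\<exists>N. \<forall>n\<ge>N. Z \<le> n div d"
    using d by (intro exI[of _ "d * Z"]) (auto simp: less_eq_div_iff_mult_less_eq mult.commute)
qed

lemma L_div:
  assumes "\<epsilon> > 0" "2 \<le> d"
  shows "\<forall>\<^sub>F n in sequentially. \<bar>L (n div d) - L n\<bar> \<le> \<epsilon> * L n"
proof -
  define \<eta> where "\<eta> = min (\<epsilon> / 2) (1 / 2)"
  have \<eta>: "\<eta> > 0" "\<eta> \<le> 1/2" "2 * \<eta> \<le> \<epsilon>" using assms by (auto simp: \<eta>_def)
  \<comment> \<open>The factor 2 accommodates the remainder of the division:
    \<open>n mod d < d <= d * m\<close> as soon as \<open>m >= 1\<close>.\<close>
  obtain N where N: "\<And>m n. N \<le> m \<Longrightarrow> m \<le> n \<Longrightarrow> n \<le> (2 * d) * m \<Longrightarrow> \<bar>L n - L m\<bar> \<le> \<eta> * L m"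
    using L_slowly_varying[OF \<eta>(1), of "2 * d"] assms by auto
  have d1: "1 \<le> d" using assms by simp
  have "\<forall>\<^sub>F n in sequentially. max N 1 \<le> n div d" using filterlim_div[OF d1] unfolding filterlim_at_top by blast
  then show ?thesis
  proof eventually_elim
    case (elim n)
    define m where "m = n div d"
    have m: "1 \<le> m" "N \<le> m" "m \<le> n" using elim unfolding m_def by auto
    have "n = d * m + n mod d" unfolding m_def by simp
    also have "n mod d \<le> d * m" using mod_less_divisor[of d n] d1 m(1) mult_le_mono2[OF m(1), of d] by linarith
    finally have "n \<le> 2 * d * m" by simp
    then have 1: "\<bar>L n - L m\<bar> \<le> \<eta> * L m" using N[OF m(2,3)] by simp
    have "\<eta> * L m \<le> 1/2 * L m" using \<eta> L_pos[OF m(1)] by (intro mult_right_mono) auto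
    then have 2: "L m \<le> 2 * L n" using 1 by linarith
    have "\<eta> * L m \<le> \<eta> * (2 * L n)" using 2 \<eta> by (intro mult_left_mono) auto
    also have "\<dots> \<le> \<epsilon> * L n" using \<eta> L_pos[of n] m mult_right_mono[OF \<eta>(3), of "L n"] by (simp add: mult_ac)
    finally show ?case using 1 unfolding m_def by (simp add: abs_minus_commute)
  qed
qed

lemma D_div:
  assumes "\<epsilon> > 0" "2 \<le> d"
  shows "\<forall>\<^sub>F n in sequentially. \<bar>D (n div d) - L n\<bar> \<le> \<epsilon> * L n"
proof -
  have d1: "1 \<le> d" using assms by simp
  define e where "e = min (\<epsilon> / 4) 1"
  have e: "e > 0" "e \<le> 1" "4 * e \<le> \<epsilon>" using assms by (auto simp: e_def)
  have "\<forall>\<^sub>F n in sequentially. \<bar>g (n div d)\<bar> * q (n div d) \<le> e * L (n div d)"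
    by (rule eventually_compose_filterlim[OF g_q_small[OF e(1)] filterlim_div[OF d1]])
  then show ?thesis using L_div[OF e(1) assms(2)] eventually_ge_at_top[of 1]
  proof eventually_elim
    case (elim n)
    define m where "m = n div d"
    have Ln: "0 < L n" using elim by (intro L_pos) simp
    have "e * L n \<le> 1 * L n" using e Ln by (intro mult_right_mono) auto
    then have "L m \<le> 2 * L n" using elim(2) unfolding m_def by linarith
    then have "e * L m \<le> e * (2 * L n)" using e by (intro mult_left_mono) auto
    moreover have "D m = L m + g m * q m" unfolding L_eq by simp
    moreover have "\<bar>g m * q m\<bar> \<le> e * L m" using elim(1) q_nonneg[of m] unfolding m_def by (simp add: abs_mult)
    moreover have "\<bar>L m - L n\<bar> \<le> e * L n" using elim(2) unfolding m_def .
    moreover have "4 * e * L n \<le> \<epsilon> * L n" using e Ln by (intro mult_right_mono) auto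
    moreover have "0 \<le> e * L n" using e Ln by simp
    ultimately show ?case unfolding m_def[symmetric] by linarith
  qed
qed

text \<open>Here \<kappa> grows with \<open>d\<close>, like \<open>sqrt d\<close>. This is harmless
  because the errors it multiplies are made small after \<open>d\<close> is fixed.\<close>

lemma q_div:
  assumes "2 \<le> d"
  shows "\<exists>\<kappa>\<ge>0. \<forall>\<^sub>F n in sequentially. sqrt (real n) * q (n div d) \<le> \<kappa> * L n"
proof -
  have d1: "1 \<le> d" using assms by simp
  obtain \<kappa> where \<kappa>: "\<kappa> \<ge> 0" "\<forall>\<^sub>F n in sequentially. sqrt (real n) * q n \<le> \<kappa> * L n" using q_le_L by auto
  have "\<forall>\<^sub>F n in sequentially. sqrt (real (n div d)) * q (n div d) \<le> \<kappa> * L (n div d)"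
    by (rule eventually_compose_filterlim[OF \<kappa>(2) filterlim_div[OF d1]])
  then have "\<forall>\<^sub>F n in sequentially. sqrt (real n) * q (n div d) \<le> (sqrt (real (2 * d)) * (2 * \<kappa>)) * L n"
    using L_div[OF zero_less_one assms] eventually_ge_at_top[of d]
  proof eventually_elim
    case (elim n)
    define m where "m = n div d"
    have m1: "1 \<le> m" using elim(3) d1 unfolding m_def by (simp add: less_eq_div_iff_mult_less_eq)
    have "n = d * m + n mod d" unfolding m_def by simp
    also have "n mod d \<le> d * m" using mod_less_divisor[of d n] d1 m1 mult_le_mono2[OF m1, of d] by linarith
    finally have "n \<le> 2 * d * m" by simp
    then have "real n \<le> real (2 * d) * real m" by (simp flip: of_nat_mult)
    then have "sqrt (real n) \<le> sqrt (real (2 * d)) * sqrt (real m)" unfolding real_sqrt_mult[symmetric] by (rule real_sqrt_le_mono)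
    then have "sqrt (real n) * q m \<le> sqrt (real (2 * d)) * sqrt (real m) * q m" by (intro mult_right_mono q_nonneg)
    also have "\<dots> \<le> sqrt (real (2 * d)) * (\<kappa> * L m)" unfolding mult.assoc using elim(1) unfolding m_def by (intro mult_left_mono) auto
    also have "\<dots> \<le> sqrt (real (2 * d)) * (\<kappa> * (2 * L n))"
      using elim(2) \<kappa> unfolding m_def by (intro mult_left_mono) auto
    finally show ?case unfolding m_def by (simp only: mult_ac)
  qed
  then show ?thesis using \<kappa>(1) by (intro exI[of _ "sqrt (real (2 * d)) * (2 * \<kappa>)"]) auto
qed

text \<open>The order of quantifiers matters: \<open>C\<close> comes before \<open>d\<close>. This
  error does not vanish with \<open>n\<close>; only the gain \<open>1 / sqrt d\<close>, inherited
  from \<open>sqrt (n div d)\<close>, makes it small.\<close>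

lemma K_square_div:
  "\<exists>C\<ge>0. \<forall>d\<ge>2. \<forall>\<^sub>F n in sequentially. K (n div d) (\<lambda>x. x\<^sup>2) \<le> C / sqrt (real d) * sqrt (real n) * L n"
proof -
  obtain C N where C: "\<And>n. n \<ge> N \<Longrightarrow> K n (\<lambda>x. x\<^sup>2) \<le> C * (sqrt (real n) * L n)" using K_square_le by auto
  have "\<forall>\<^sub>F n in sequentially. K (n div d) (\<lambda>x. x\<^sup>2) \<le> (2 * \<bar>C\<bar>) / sqrt (real d) * sqrt (real n) * L n" if d: "2 \<le> d" for d
  proof -
    have d1: "1 \<le> d" using d by simp
    have "\<forall>\<^sub>F n in sequentially. max N 1 \<le> n div d" using filterlim_div[OF d1] unfolding filterlim_at_top by blast
    then show ?thesis using L_div[OF zero_less_one d]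
    proof eventually_elim
      case (elim n)
      define m where "m = n div d"
      have m: "1 \<le> m" "N \<le> m" using elim(1) by (auto simp: m_def)
      have "real m \<le> real n / real d" unfolding m_def by (rule of_nat_div_le_of_nat)
      then have s: "sqrt (real m) \<le> sqrt (real n) / sqrt (real d)" unfolding real_sqrt_divide[symmetric] by (rule real_sqrt_le_mono)
      have L2: "L m \<le> 2 * L n" using elim(2) unfolding m_def by linarith
      have "K m (\<lambda>x. x\<^sup>2) \<le> C * (sqrt (real m) * L m)" by (rule C[OF m(2)])
      also have "\<dots> \<le> \<bar>C\<bar> * (sqrt (real m) * L m)" using L_pos[OF m(1)] by (intro mult_right_mono) auto
      also have "\<dots> \<le> \<bar>C\<bar> * (sqrt (real n) / sqrt (real d) * (2 * L n))"
        using s L2 L_pos[OF m(1)] by (intro mult_left_mono mult_mono) auto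
      finally show ?case unfolding m_def by (simp add: mult_ac)
    qed
  qed
  then show ?thesis by (intro exI[of _ "2 * \<bar>C\<bar>"]) auto
qed

text \<open>Above the boundary \<open>\<bar>x\<bar> <= x + 2 * \<bar>g n\<bar>\<close>. Passing from
  \<open>D n\<close> to \<open>L n\<close> costs one more \<open>\<bar>g n\<bar> * q n\<close>, and
  the three together are at most \<open>L n\<close> by the choice of \<open>1/3\<close>.\<close>

lemma K_abs_le: "\<forall>\<^sub>F n in sequentially. K n (\<lambda>x. \<bar>x\<bar>) \<le> 2 * L n"
  using g_q_small[of "1/3", simplified] eventually_ge_at_top[of 1]
proof eventually_elim
  case (elim n)
  have i: "integrable M (\<lambda>\<omega>. walk X n \<omega> + 2 * \<bar>g n\<bar>)" using walk_second_moment(2)[of n] by simp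
  have "K n (\<lambda>x. \<bar>x\<bar>) \<le> K n (\<lambda>x. x + 2 * \<bar>g n\<bar>)"
    using elim(2) by (intro K_mono integrable_abs walk_second_moment(2) i) auto
  also have "\<dots> = D n + 2 * \<bar>g n\<bar> * q n"
  proof -
    have "integrable M (\<lambda>\<omega>. indicator (alive n) \<omega> * (2 * \<bar>g n\<bar>))" by (rule integrable_alive) simp
    from Bochner_Integration.integral_add[OF integrable_alive[OF walk_second_moment(2)] this] show ?thesis
      unfolding K_def distrib_left integral_alive .
  qed
  also have "\<dots> \<le> L n + 3 * (\<bar>g n\<bar> * q n)"
    unfolding L_eq using mult_right_mono[OF abs_ge_self[of "g n"] q_nonneg[of n]] by simp
  also have "\<dots> \<le> 2 * L n" using elim(1) by simp
  finally show ?case .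
qed


text \<open>Two kinds of error are kept apart: those vanishing as \<open>n\<close> grows with
  \<open>d\<close> fixed are collected in \<epsilon>, those that shrink only with \<open>d\<close>
  in \<open>A\<close>, which does not depend on \<open>d\<close>.\<close>

lemma scaled_limit_aux:
  assumes H [measurable]: "H \<in> borel_measurable borel" and B: "\<And>x. \<bar>H x\<bar> \<le> B"
    and odd: "\<And>x. H (- x) = - H x" and lip: "\<And>x y. \<bar>H x - H y\<bar> \<le> l * \<bar>x - y\<bar>"
  shows "\<exists>A\<ge>0. \<forall>d\<ge>2. \<forall>\<epsilon>>0. \<forall>\<^sub>F n in sequentially.
    \<bar>sqrt (real n) * K n (\<lambda>x. H (x / sqrt (real n))) - gauss_slope H * L n\<bar> \<le> (A / sqrt (real d) + \<epsilon>) * L n"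
proof -
  have "\<bar>H 1 - H 0\<bar> \<le> l" using lip[of 1 0] by simp
  then have l0: "0 \<le> l" by linarith
  define S where "S = gauss_slope H"
  have "gauss_mean H 0 = 0" using integral_odd_gaussian[of H 1, OF odd] by (simp add: gauss_mean_def)
  then obtain U where U: "U \<ge> 0" "\<And>w. \<bar>gauss_mean H w - S * w\<bar> \<le> U * w\<^sup>2"
    using gauss_mean_expansion[OF H B] unfolding S_def by auto
  obtain C where C: "C \<ge> 0" "\<And>d. d \<ge> 2 \<Longrightarrow> \<forall>\<^sub>F n in sequentially. K (n div d) (\<lambda>x. x\<^sup>2) \<le> C / sqrt (real d) * sqrt (real n) * L n"
    using K_square_div by blast
  \<comment> \<open>\<open>4 * l\<close> comes from changing the scale inside \<open>H\<close>,
    \<open>2 * U * C\<close> from the quadratic remainder of the smoothed function, and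
    \<open>2 * \<bar>S\<bar>\<close> from \<open>sn / sN\<close> not being 1.\<close>
  define A where "A = 4 * l + 2 * U * C + 2 * \<bar>S\<bar>"
  have "\<forall>\<^sub>F n in sequentially.
    \<bar>sqrt (real n) * K n (\<lambda>x. H (x / sqrt (real n))) - S * L n\<bar> \<le> (A / sqrt (real d) + \<epsilon>) * L n"
    if d: "2 \<le> d" and \<epsilon>: "\<epsilon> > 0" for d :: nat and \<epsilon> :: real
  proof -
    obtain \<kappa> where \<kappa>: "\<kappa> \<ge> 0" "\<forall>\<^sub>F n in sequentially. sqrt (real n) * q (n div d) \<le> \<kappa> * L n"
      using q_div[OF d] by blast
    \<comment> \<open>Chosen after \<open>d\<close> and hence after \<kappa>: the invariance step
      and the normal approximation each cost \<open>\<theta> * \<kappa>\<close>.\<close>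
    define \<theta> where "\<theta> = \<epsilon> / (4 * (\<kappa> + 1))"
    have \<theta>: "\<theta> > 0" "2 * (\<theta> * \<kappa>) \<le> \<epsilon> / 2" using \<epsilon> \<kappa> by (auto simp: \<theta>_def field_simps)
    define e where "e = \<epsilon> / (4 * (\<bar>S\<bar> + 1))"
    have e: "e > 0" "\<bar>S\<bar> * (2 * e) \<le> \<epsilon> / 2"
    proof -
      have p: "0 < 4 * (\<bar>S\<bar> + 1)" by (simp add: add_nonneg_pos)
      show "e > 0" unfolding e_def using \<epsilon> p by (rule divide_pos_pos)
      have "\<bar>S\<bar> * (2 * e) \<le> (\<bar>S\<bar> + 1) * (2 * e)" using \<open>e > 0\<close> by (intro mult_right_mono) auto
      also have "\<dots> = \<epsilon> / 2" using p unfolding e_def by (simp add: field_simps)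
      finally show "\<bar>S\<bar> * (2 * e) \<le> \<epsilon> / 2" .
    qed
    have N_inf: "filterlim (\<lambda>n. n - n div d) at_top sequentially"
    proof (rule filterlim_at_top_mono[OF filterlim_div[of 2]])
      have "n div d \<le> n div 2" for n using d by (intro div_le_mono2) auto
      moreover have "n div 2 \<le> n - n div 2" for n :: nat by presburger
      ultimately have "n div 2 \<le> n - n div d" for n by (meson diff_le_mono2 order_trans)
      then show "\<forall>\<^sub>F n in sequentially. n div 2 \<le> n - n div d" by simp
    qed simp
    have "(\<lambda>N. B * tv N) \<longlonglongrightarrow> B * 0" by (intro tendsto_intros tv_tendsto)
    then have "\<forall>\<^sub>F N in sequentially. B * tv N < \<theta>" using \<theta> by (intro order_tendstoD) auto
    from eventually_compose_filterlim[OF this N_inf]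
    have "\<forall>\<^sub>F n in sequentially. B * tv (n - n div d) < \<theta>" .
    then show ?thesis
      using K_invariance[OF H B odd lip \<theta>(1) d] \<kappa>(2) C(2)[OF d] D_div[OF e(1) d] K_abs_le eventually_ge_at_top[of "2 * d"]
    proof eventually_elim
      case (elim n)
      define m where "m = n div d"
      define N where "N = n - m"
      define sn where "sn = sqrt (real n)"
      define sN where "sN = sqrt (real N)"
      define \<rho> where "\<rho> = sn / sN"
      have n1: "1 \<le> n" using elim(7) d by linarith
      have m1: "1 \<le> m" unfolding m_def using div_le_mono[OF elim(7), of d] d by simp
      have "m \<le> n div 2" unfolding m_def using d by (intro div_le_mono2) auto
      then have nN: "n = m + N" "n \<le> 2 * N" unfolding N_def by linarith+
      have N1: "1 \<le> N" using nN n1 by linarith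
      have Ln: "0 < L n" by (rule L_pos[OF n1])
      have sN: "0 < sN" and sn: "0 < sn" using N1 n1 by (auto simp: sN_def sn_def)
      have sq: "sn * sn = real n" "sN * sN = real N" by (auto simp: sn_def sN_def)
      have snN: "sN \<le> sn" unfolding sN_def sn_def using nN by simp
      have "real n \<le> 4 * real N" using nN(2) by linarith
      then have "sn \<le> sqrt (4 * real N)" unfolding sn_def by (rule real_sqrt_le_mono)
      then have sn2: "sn \<le> 2 * sN" unfolding sN_def by (simp add: real_sqrt_mult)
      have dpos: "0 < real d" using d by simp
      \<comment> \<open>Multiplying by \<open>sn\<close> and enlarging that factor to
        \<open>sn + sN\<close> turns the difference of roots into \<open>n - N = m\<close>.\<close>
      have gap: "sn - sN \<le> sn / real d"
      proof -
        have "(sn - sN) * sn \<le> (sn - sN) * (sn + sN)" using snN sN by (intro mult_left_mono) auto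
        also have "\<dots> = real n - real N" using sq by (simp add: algebra_simps)
        also have "\<dots> = real m" using nN by simp
        also have "\<dots> \<le> real n / real d" unfolding m_def by (rule of_nat_div_le_of_nat)
        also have "\<dots> = sn / real d * sn" using sq by simp
        finally show ?thesis by (rule mult_right_le_imp_le[OF _ sn])
      qed
      have \<rho>: "1 \<le> \<rho>" "\<rho> \<le> 2" "\<rho> - 1 \<le> 2 / real d"
      proof -
        show "1 \<le> \<rho>" "\<rho> \<le> 2" using snN sn2 sN unfolding \<rho>_def by (auto simp: field_simps)
        have "\<rho> - 1 = (sn - sN) / sN" unfolding \<rho>_def using sN by (simp add: field_simps)
        also have "\<dots> \<le> (sn / real d) / sN" using gap sN by (intro divide_right_mono) auto
        also have "\<dots> = \<rho> / real d" unfolding \<rho>_def by simp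
        also have "\<dots> \<le> 2 / real d" using \<open>\<rho> \<le> 2\<close> dpos by (intro divide_right_mono) auto
        finally show "\<rho> - 1 \<le> 2 / real d" .
      qed
      have iH: "integrable M (\<lambda>\<omega>. H (walk X j \<omega> / s))" for j s
        using integrable_bounded_walk[of "\<lambda>x. H (x / s)" B j] B by simp
      \<comment> \<open>A chain of replacements: the scale \<open>sn\<close> by \<open>sN\<close>,
        killed evolution on the last stretch by free evolution, that by Gaussian smoothing, the
        smoothed function by its tangent at 0, and finally \<open>\<rho> * D m\<close> by
        \<open>L n\<close>.\<close>
      define a0 where "a0 = sn * K n (\<lambda>x. H (x / sn))"
      define a1 where "a1 = sn * K n (\<lambda>x. H (x / sN))"
      define a2 where "a2 = sn * K m (avg N (\<lambda>x. H (x / sN)))"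
      define a3 where "a3 = sn * K m (\<lambda>x. gauss_mean H (x / sN))"
      define a4 where "a4 = \<rho> * S * D m"
      have t1: "\<bar>a0 - a1\<bar> \<le> 4 * l / real d * L n"
      proof -
        have "\<bar>K n (\<lambda>x. H (x / sn)) - K n (\<lambda>x. H (x / sN))\<bar> \<le> K n (\<lambda>x. (l * (1 / sN - 1 / sn)) * \<bar>x\<bar>)"
        proof (rule K_diff_le[OF iH iH _ n1])
          show "integrable M (\<lambda>\<omega>. l * (1 / sN - 1 / sn) * \<bar>walk X n \<omega>\<bar>)"
            by (intro integrable_mult_right integrable_abs walk_second_moment(2))
          fix x
          have "\<bar>H (x / sn) - H (x / sN)\<bar> \<le> l * \<bar>x / sn - x / sN\<bar>" by (rule lip)
          also have "\<bar>x / sn - x / sN\<bar> = \<bar>(1 / sN - 1 / sn) * x\<bar>"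
            by (simp add: left_diff_distrib abs_minus_commute)
          also have "\<dots> = (1 / sN - 1 / sn) * \<bar>x\<bar>" unfolding abs_mult using snN sN sn by (simp add: frac_le)
          finally show "\<bar>H (x / sn) - H (x / sN)\<bar> \<le> l * (1 / sN - 1 / sn) * \<bar>x\<bar>" by (simp only: mult.assoc)
        qed
        also have "\<dots> = l * (1 / sN - 1 / sn) * K n (\<lambda>x. \<bar>x\<bar>)" by (rule K_cmult)
        also have "\<dots> \<le> l * (1 / sN - 1 / sn) * (2 * L n)"
          using elim(6) l0 snN sN sn by (intro mult_left_mono mult_nonneg_nonneg) (auto simp: frac_le)
        finally have "sn * \<bar>K n (\<lambda>x. H (x / sn)) - K n (\<lambda>x. H (x / sN))\<bar> \<le> sn * (l * (1 / sN - 1 / sn) * (2 * L n))"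
          using sn by (intro mult_left_mono) auto
        also have "\<dots> = l * (\<rho> - 1) * (2 * L n)" unfolding \<rho>_def using sn sN by (simp add: field_simps)
        also have "\<dots> \<le> l * (2 / real d) * (2 * L n)"
          using \<rho>(3) l0 Ln by (intro mult_right_mono mult_left_mono) auto
        finally show ?thesis unfolding a0_def a1_def right_diff_distrib[symmetric] abs_mult using sn by simp
      qed
      have qL: "sn * q m \<le> \<kappa> * L n" using elim(3) unfolding sn_def m_def .
      have \<theta>q: "sn * (\<theta> * q m) \<le> \<theta> * \<kappa> * L n"
        using mult_left_mono[OF qL, of \<theta>] \<theta>(1) by (simp add: mult_ac)
      have t2: "\<bar>a1 - a2\<bar> \<le> \<theta> * \<kappa> * L n"
      proof -
        have "\<bar>K n (\<lambda>x. H (x / sN)) - K m (avg N (\<lambda>x. H (x / sN)))\<bar> \<le> \<theta> * q m"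
          using elim(2) unfolding sN_def N_def m_def .
        then have "sn * \<bar>K n (\<lambda>x. H (x / sN)) - K m (avg N (\<lambda>x. H (x / sN)))\<bar> \<le> sn * (\<theta> * q m)"
          using sn by (intro mult_left_mono) auto
        then show ?thesis using \<theta>q unfolding a1_def a2_def right_diff_distrib[symmetric] abs_mult abs_of_pos[OF sn] by linarith
      qed
      have t3: "\<bar>a2 - a3\<bar> \<le> \<theta> * \<kappa> * L n"
      proof -
        have "\<bar>K m (avg N (\<lambda>x. H (x / sN))) - K m (\<lambda>x. gauss_mean H (x / sN))\<bar> \<le> K m (\<lambda>_. \<theta>)"
        proof (rule K_diff_le[OF _ _ _ m1])
          have "\<bar>avg N (\<lambda>x. H (x / sN)) y\<bar> \<le> B" for y by (rule avg_bounded) (use B in auto)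
          then show "integrable M (\<lambda>\<omega>. avg N (\<lambda>x. H (x / sN)) (walk X m \<omega>))"
            by (intro integrable_bounded_walk) measurable
          show "integrable M (\<lambda>\<omega>. gauss_mean H (walk X m \<omega> / sN))"
            using integrable_bounded_walk[of "\<lambda>x. gauss_mean H (x / sN)" B m] gauss_mean_bounded[OF H B] by simp
          fix x
          have "\<bar>avg N (\<lambda>x. H (x / sN)) x - gauss_mean H (x / sN)\<bar> \<le> B * tv N"
          proof -
            have "(x + sN * y) / sN = x / sN + y" for y using sN by (simp add: field_simps)
            then show ?thesis using avg_scaled_approx[OF H B N1, of sN x] unfolding gauss_mean_def sN_def by simp
          qed
          then show "\<bar>avg N (\<lambda>x. H (x / sN)) x - gauss_mean H (x / sN)\<bar> \<le> \<theta>"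
            using elim(1) unfolding N_def m_def by linarith
        qed simp
        then have "sn * \<bar>K m (avg N (\<lambda>x. H (x / sN))) - K m (\<lambda>x. gauss_mean H (x / sN))\<bar> \<le> sn * (\<theta> * q m)"
          unfolding K_const using sn by (intro mult_left_mono) auto
        then show ?thesis using \<theta>q unfolding a2_def a3_def right_diff_distrib[symmetric] abs_mult abs_of_pos[OF sn] by linarith
      qed
      have t4: "\<bar>a3 - a4\<bar> \<le> 2 * U * C / sqrt (real d) * L n"
      proof -
        have "\<bar>K m (\<lambda>x. gauss_mean H (x / sN)) - K m (\<lambda>x. (S / sN) * x)\<bar> \<le> K m (\<lambda>x. (U / real N) * x\<^sup>2)"
        proof (rule K_diff_le[OF _ _ _ m1])
          show "integrable M (\<lambda>\<omega>. gauss_mean H (walk X m \<omega> / sN))"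
            using integrable_bounded_walk[of "\<lambda>x. gauss_mean H (x / sN)" B m] gauss_mean_bounded[OF H B] by simp
          show "integrable M (\<lambda>\<omega>. S / sN * walk X m \<omega>)" by (intro integrable_mult_right walk_second_moment(2))
          show "integrable M (\<lambda>\<omega>. U / real N * (walk X m \<omega>)\<^sup>2)" by (intro integrable_mult_right walk_second_moment(1))
          fix x
          show "\<bar>gauss_mean H (x / sN) - S / sN * x\<bar> \<le> U / real N * x\<^sup>2"
            using U(2)[of "x / sN"] sq(2) by (simp add: power_divide power2_eq_square)
        qed
        also have "\<dots> = U / real N * K m (\<lambda>x. x\<^sup>2)" by (rule K_cmult)
        also have "\<dots> \<le> U / real N * (C / sqrt (real d) * sn * L n)"
          using elim(4) U(1) unfolding m_def sn_def by (intro mult_left_mono) auto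
        finally have "sn * \<bar>K m (\<lambda>x. gauss_mean H (x / sN)) - K m (\<lambda>x. (S / sN) * x)\<bar> \<le> sn * (U / real N * (C / sqrt (real d) * sn * L n))"
          using sn by (intro mult_left_mono) auto
        also have "\<dots> = (sn * sn / real N) * (U * C / sqrt (real d) * L n)" by (simp add: mult_ac)
        also have "\<dots> \<le> 2 * (U * C / sqrt (real d) * L n)"
        proof (rule mult_right_mono)
          show "sn * sn / real N \<le> 2" unfolding sq using nN N1 by (simp add: divide_le_eq)
          show "0 \<le> U * C / sqrt (real d) * L n" using U C Ln by simp
        qed
        also have "2 * (U * C / sqrt (real d) * L n) = 2 * U * C / sqrt (real d) * L n" by simp
        finally have 1: "\<bar>sn * K m (\<lambda>x. gauss_mean H (x / sN)) - sn * K m (\<lambda>x. (S / sN) * x)\<bar> \<le> 2 * U * C / sqrt (real d) * L n"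
          unfolding right_diff_distrib[symmetric] abs_mult abs_of_pos[OF sn] .
        have 2: "sn * K m (\<lambda>x. (S / sN) * x) = a4" unfolding K_cmult a4_def \<rho>_def by simp
        show ?thesis using 1 unfolding 2 a3_def .
      qed
      have t5: "\<bar>a4 - S * L n\<bar> \<le> (2 * \<bar>S\<bar> / real d + \<epsilon> / 2) * L n"
      proof -
        have Dm: "\<bar>D m - L n\<bar> \<le> e * L n" using elim(5) unfolding m_def .
        have "a4 - S * L n = S * (\<rho> * (D m - L n) + (\<rho> - 1) * L n)" unfolding a4_def by (simp add: algebra_simps)
        then have "\<bar>a4 - S * L n\<bar> = \<bar>S\<bar> * \<bar>\<rho> * (D m - L n) + (\<rho> - 1) * L n\<bar>" by (simp add: abs_mult)
        also have "\<dots> \<le> \<bar>S\<bar> * (2 * (e * L n) + 2 / real d * L n)"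
        proof (rule mult_left_mono)
          have "\<bar>\<rho> * (D m - L n)\<bar> \<le> 2 * (e * L n)" unfolding abs_mult using \<rho> Dm by (intro mult_mono) auto
          moreover have "\<bar>(\<rho> - 1) * L n\<bar> \<le> 2 / real d * L n" unfolding abs_mult using \<rho> Ln by (intro mult_mono) auto
          ultimately show "\<bar>\<rho> * (D m - L n) + (\<rho> - 1) * L n\<bar> \<le> 2 * (e * L n) + 2 / real d * L n" by linarith
        qed simp
        also have "\<dots> = (\<bar>S\<bar> * (2 * e) + 2 * \<bar>S\<bar> / real d) * L n" by (simp add: algebra_simps)
        also have "\<dots> \<le> (2 * \<bar>S\<bar> / real d + \<epsilon> / 2) * L n" using e Ln by (intro mult_right_mono) auto
        finally show ?thesis .
      qed
      have dd: "1 / real d \<le> 1 / sqrt (real d)"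
      proof (rule divide_left_mono)
        show "sqrt (real d) \<le> real d" using d by (intro real_le_lsqrt) (auto simp: power2_eq_square)
      qed (use dpos in auto)
      have "\<bar>a0 - S * L n\<bar> \<le> 4 * l / real d * L n + 2 * (\<theta> * \<kappa>) * L n + 2 * U * C / sqrt (real d) * L n + (2 * \<bar>S\<bar> / real d + \<epsilon> / 2) * L n"
        using t1 t2 t3 t4 t5 by linarith
      also have "\<dots> = ((4 * l + 2 * \<bar>S\<bar>) * (1 / real d) + 2 * U * C / sqrt (real d) + 2 * (\<theta> * \<kappa>) + \<epsilon> / 2) * L n"
        by (simp add: algebra_simps add_divide_distrib)
      also have "\<dots> \<le> ((4 * l + 2 * \<bar>S\<bar>) * (1 / sqrt (real d)) + 2 * U * C / sqrt (real d) + \<epsilon> / 2 + \<epsilon> / 2) * L n"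
        using dd l0 \<theta>(2) Ln by (intro mult_right_mono add_mono mult_left_mono) auto
      also have "\<dots> = (A / sqrt (real d) + \<epsilon>) * L n" unfolding A_def by (simp add: algebra_simps add_divide_distrib)
      finally show ?case unfolding a0_def sn_def .
    qed
  qed
  moreover have "0 \<le> A" unfolding A_def using l0 U C by simp
  ultimately show ?thesis unfolding S_def by blast
qed

text \<open>The quantity to be bounded does not involve \<open>d\<close>, so \<open>d\<close> can be
  chosen last, large enough for \<open>A / sqrt d <= \<epsilon> / 2\<close>.\<close>

lemma scaled_limit:
  assumes H: "H \<in> borel_measurable borel" "\<And>x. \<bar>H x\<bar> \<le> B"
    "\<And>x. H (- x) = - H x" "\<And>x y. \<bar>H x - H y\<bar> \<le> l * \<bar>x - y\<bar>" and \<epsilon>: "\<epsilon> > 0"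
  shows "\<forall>\<^sub>F n in sequentially. \<bar>sqrt (real n) * K n (\<lambda>x. H (x / sqrt (real n))) - gauss_slope H * L n\<bar> \<le> \<epsilon> * L n"
proof -
  obtain A where A: "A \<ge> 0" "\<And>d \<epsilon>. d \<ge> 2 \<Longrightarrow> \<epsilon> > 0 \<Longrightarrow> \<forall>\<^sub>F n in sequentially.
    \<bar>sqrt (real n) * K n (\<lambda>x. H (x / sqrt (real n))) - gauss_slope H * L n\<bar> \<le> (A / sqrt (real d) + \<epsilon>) * L n"
    using scaled_limit_aux[OF H] by blast
  obtain d0 :: nat where d0: "(2 * A / \<epsilon>)\<^sup>2 < real d0" using reals_Archimedean2 by blast
  define d where "d = max d0 2"
  have d: "2 \<le> d" "(2 * A / \<epsilon>)\<^sup>2 \<le> real d" using d0 by (auto simp: d_def)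
  then have "2 * A / \<epsilon> \<le> sqrt (real d)" by (intro real_le_rsqrt)
  then have "A / sqrt (real d) \<le> \<epsilon> / 2" using \<epsilon> d by (simp add: field_simps)
  then have le: "A / sqrt (real d) + \<epsilon> / 2 \<le> \<epsilon>" by linarith
  have "\<forall>\<^sub>F n in sequentially.
    \<bar>sqrt (real n) * K n (\<lambda>x. H (x / sqrt (real n))) - gauss_slope H * L n\<bar> \<le> (A / sqrt (real d) + \<epsilon> / 2) * L n"
    using A(2)[OF d(1), of "\<epsilon> / 2"] \<epsilon> by simp
  then show ?thesis using eventually_ge_at_top[of 1]
  proof eventually_elim
    case (elim n)
    have "(A / sqrt (real d) + \<epsilon> / 2) * L n \<le> \<epsilon> * L n" by (rule mult_right_mono[OF le less_imp_le[OF L_pos[OF elim(2)]]])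
    then show ?case using elim(1) by linarith
  qed
qed

text \<open>Removing the boundary on the last \<open>N\<close> steps can only increase the mean of a
  nonnegative function.\<close>

lemma K_le_avg:
  assumes F [measurable]: "F \<in> borel_measurable borel" and F01: "\<And>x. 0 \<le> F x" "\<And>x. F x \<le> B"
  shows "K (m + N) F \<le> K m (avg N F)"
proof -
  have B: "\<And>x. \<bar>F x\<bar> \<le> B" using F01 by (simp add: abs_le_iff order_trans[of _ 0])
  have "K (m + j) (avg (N - j) F) \<le> K m (avg N F)" if "j \<le> N" for j
    using that
  proof (induction j)
    case (Suc j)
    define r where "r = N - Suc j"
    have r: "N - j = Suc r" using Suc.prems by (simp add: r_def)
    have i: "integrable M (\<lambda>\<omega>. avg r F (walk X (Suc (m + j)) \<omega>))"
      by (rule integrable_bounded_walk[OF _ avg_bounded[OF F B]]) measurable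
    have a0: "0 \<le> avg r F x" for x unfolding avg_def using F01 by (intro Bochner_Integration.integral_nonneg) auto
    have "K (Suc (m + j)) (avg r F) \<le> (\<integral>\<omega>. indicator (alive (m + j)) \<omega> * avg r F (walk X (Suc (m + j)) \<omega>) \<partial>M)"
      unfolding K_def
    proof (rule integral_mono[OF integrable_alive[OF i] integrable_alive[OF i]])
      show "indicator (alive (Suc (m + j))) \<omega> * avg r F (walk X (Suc (m + j)) \<omega>) \<le> indicator (alive (m + j)) \<omega> * avg r F (walk X (Suc (m + j)) \<omega>)" for \<omega>
        using a0 alive_antimono[of "m + j" "Suc (m + j)"] by (auto simp: indicator_def)
    qed
    also have "\<dots> = K (m + j) (\<lambda>x. \<integral>t. avg r F (x + t) \<partial>\<mu>)" by (rule alive_step[OF _ i]) measurable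
    also have "(\<lambda>x. \<integral>t. avg r F (x + t) \<partial>\<mu>) = avg (N - j) F"
      unfolding r by (rule ext) (rule avg_Suc[OF F B, symmetric])
    also have "K (m + j) (avg (N - j) F) \<le> K m (avg N F)" by (rule Suc.IH) (use Suc.prems in simp)
    finally show ?case unfolding r_def by simp
  qed simp
  from this[of N] show ?thesis by (simp add: avg_0[abs_def])
qed

text \<open>Without the boundary, the second half of the walk has a nearly normal increment, so from
  any position at time \<open>n div 2\<close> the ball is hit with probability O(\<epsilon>).
  \<open>C\<close> has to precede \<epsilon>, because \<epsilon> will be chosen in terms of
  \<open>C\<close>.\<close>

lemma small_ball:
  "\<exists>C\<ge>0. \<forall>\<epsilon>>0. \<forall>\<^sub>F n in sequentially.
    sqrt (real n) * K n (\<lambda>x. indicator {- (\<epsilon> * sqrt (real n))..\<epsilon> * sqrt (real n)} x) \<le> C * \<epsilon> * L n"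
proof -
  obtain \<kappa> where \<kappa>: "\<kappa> \<ge> 0" "\<forall>\<^sub>F n in sequentially. sqrt (real n) * q (n div 2) \<le> \<kappa> * L n"
    using q_div[of 2] by auto
  have "\<forall>\<^sub>F n in sequentially.
    sqrt (real n) * K n (\<lambda>x. indicator {- (\<epsilon> * sqrt (real n))..\<epsilon> * sqrt (real n)} x) \<le> 5 * \<kappa> * \<epsilon> * L n" if \<epsilon>: "\<epsilon> > 0" for \<epsilon>
  proof -
    have N_inf: "filterlim (\<lambda>n. n - n div 2) at_top sequentially"
      by (rule filterlim_at_top_mono[OF filterlim_div[of 2]]) (simp_all, rule always_eventually, presburger)
    have "\<forall>\<^sub>F N in sequentially. tv N < \<epsilon>" using tv_tendsto \<epsilon> by (intro order_tendstoD) auto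
    from eventually_compose_filterlim[OF this N_inf]
    have "\<forall>\<^sub>F n in sequentially. tv (n - n div 2) < \<epsilon>" .
    then show ?thesis using \<kappa>(2) eventually_ge_at_top[of 2]
    proof eventually_elim
      case (elim n)
      define m where "m = n div 2"
      define N where "N = n - m"
      have nN: "n = m + N" "n \<le> 2 * N" "1 \<le> N" "1 \<le> m" using elim(3) unfolding N_def m_def by linarith+
      define s where "s = \<epsilon> * sqrt (real n)"
      define F where "F x = (indicator {- s..s} x :: real)" for x
      have F [measurable]: "F \<in> borel_measurable borel" unfolding F_def by measurable
      have F01: "0 \<le> F x" "F x \<le> 1" for x by (auto simp: F_def indicator_def)
      then have F1: "\<bar>F x\<bar> \<le> 1" for x by (simp add: abs_le_iff order_trans[of _ 0])
      have sN: "0 < sqrt (real N)" using nN by simp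
      have "sqrt (real n) \<le> sqrt (4 * real N)" using nN by (intro real_sqrt_le_mono) linarith
      then have sn: "sqrt (real n) \<le> 2 * sqrt (real N)" by (simp add: real_sqrt_mult)
      \<comment> \<open>\<open>5\<close> is \<open>4 + 1\<close>: the interval has length
        \<open>2 * \<epsilon> * sqrt n\<close> before division by \<open>sqrt N\<close>, with
        \<open>sqrt n <= 2 * sqrt N\<close>, the normal density is at most 1, and
        \<open>tv N\<close> adds less than \<epsilon>.\<close>
      have avg: "avg N F z \<le> 5 * \<epsilon>" for z
      proof -
        have i: "integrable lborel (\<lambda>y. F (z + sqrt (real N) * y) * std_normal_density y)"
          by (rule integrable_bounded_mult[OF _ _ F1]) auto
        have le: "F (z + sqrt (real N) * y) * std_normal_density y \<le> indicator {(- s - z) / sqrt (real N)..(s - z) / sqrt (real N)} y" for y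
        proof -
          have "std_normal_density y \<le> 1"
          proof -
            have "exp (- y\<^sup>2 / 2) \<le> 1" by simp
            moreover have "1 / sqrt (2 * pi) \<le> 1" using pi_ge_two by simp
            ultimately show ?thesis unfolding std_normal_density_def by (intro mult_le_one) auto
          qed
          then show ?thesis using sN by (auto simp: F_def indicator_def field_simps)
        qed
        have "avg N F z \<le> (\<integral>y. F (z + sqrt (real N) * y) * std_normal_density y \<partial>lborel) + tv N"
          using avg_scaled_approx[OF F F1 nN(3), of 1 z] by simp
        also have "(\<integral>y. F (z + sqrt (real N) * y) * std_normal_density y \<partial>lborel) \<le>
           (\<integral>y. indicator {(- s - z) / sqrt (real N)..(s - z) / sqrt (real N)} y \<partial>lborel)"
          by (rule integral_mono[OF i _ le], rule integrable_real_indicator) (auto simp: emeasure_lborel_Icc_eq)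
        also have "\<dots> = (s - z) / sqrt (real N) - (- s - z) / sqrt (real N)"
          using sN \<epsilon> by (simp add: s_def divide_right_mono)
        also have "\<dots> = 2 * \<epsilon> * (sqrt (real n) / sqrt (real N))"
          unfolding s_def by (simp add: diff_divide_distrib)
        also have "\<dots> \<le> 2 * \<epsilon> * 2" using sn sN \<epsilon> by (intro mult_left_mono) (auto simp: divide_le_eq)
        finally show ?thesis using elim(1) unfolding N_def m_def by linarith
      qed
      have "K n F \<le> K m (avg N F)" unfolding nN(1) by (rule K_le_avg[OF F F01])
      also have "\<dots> \<le> K m (\<lambda>_. 5 * \<epsilon>)"
        by (intro K_mono integrable_bounded_walk[OF _ avg_bounded[OF F F1]] nN(4) avg) auto
      also have "\<dots> = 5 * \<epsilon> * q m" by (rule K_const)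
      finally have "sqrt (real n) * K n F \<le> sqrt (real n) * (5 * \<epsilon> * q m)" by (intro mult_left_mono) auto
      also have "\<dots> = 5 * \<epsilon> * (sqrt (real n) * q m)" by (simp only: mult_ac)
      also have "\<dots> \<le> 5 * \<epsilon> * (\<kappa> * L n)" using elim(2) \<epsilon> unfolding m_def by (intro mult_left_mono) auto
      finally show ?case unfolding F_def s_def by (simp add: mult_ac)
    qed
  qed
  then show ?thesis using \<kappa>(1) by (intro exI[of _ "5 * \<kappa>"]) auto
qed

end

section \<open>The Gaussian limit and the bridge\<close>

text \<open>The odd extension of the Gaussian weight from the half line, with the jump of the sign
  at 0 replaced by a linear ramp on \<open>[-\<epsilon>, \<epsilon>]\<close> to make it Lipschitz.
  For \<open>x >= \<epsilon>\<close> it is the weight itself.\<close>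

definition clamp_gauss :: "real \<Rightarrow> real \<Rightarrow> real \<Rightarrow> real" where
  "clamp_gauss a \<epsilon> x = max (- 1) (min 1 (x / \<epsilon>)) * exp (- a * x\<^sup>2)"

lemma clamp_gauss_odd: "clamp_gauss a \<epsilon> (- x) = - clamp_gauss a \<epsilon> x"
proof -
  have "max (- 1) (min 1 (- t)) = - max (- 1) (min 1 t)" for t :: real by (auto simp: max_def min_def)
  from this[of "x / \<epsilon>"] show ?thesis unfolding clamp_gauss_def by simp
qed

lemma clamp_gauss_bounded:
  assumes "0 \<le> a" shows "\<bar>clamp_gauss a \<epsilon> x\<bar> \<le> 1"
proof -
  have "\<bar>max (- 1) (min 1 (x / \<epsilon>))\<bar> \<le> 1" by (auto simp: max_def min_def abs_le_iff)
  moreover have "exp (- a * x\<^sup>2) \<le> 1" using assms by simp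
  ultimately show ?thesis unfolding clamp_gauss_def abs_mult by (intro mult_le_one) auto
qed

lemma clamp_gauss_measurable [measurable]: "clamp_gauss a \<epsilon> \<in> borel_measurable borel"
  unfolding clamp_gauss_def[abs_def] by measurable

text \<open>By \<open>2 * \<bar>z\<bar> <= 1 + z^2\<close> the derivative is at most
  \<open>a * (1 + z^2) * exp (- a * z^2)\<close> in modulus, and \<open>t * exp (- t) <= 1\<close>
  bounds the quadratic part; hence \<open>a + 1\<close>.\<close>

lemma exp_square_lipschitz:
  fixes a x y :: real
  assumes a: "0 \<le> a"
  shows "\<bar>exp (- a * x\<^sup>2) - exp (- a * y\<^sup>2)\<bar> \<le> (a + 1) * \<bar>x - y\<bar>"
proof -
  have main: "\<bar>exp (- a * y\<^sup>2) - exp (- a * x\<^sup>2)\<bar> \<le> (a + 1) * (y - x)" if xy: "x < y" for x y :: real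
  proof -
    have "((\<lambda>x. exp (- a * x\<^sup>2)) has_real_derivative (- (2 * a * z * exp (- a * z\<^sup>2)))) (at z)" for z
      by (auto intro!: derivative_eq_intros)
    then obtain z where z: "exp (- a * y\<^sup>2) - exp (- a * x\<^sup>2) = (y - x) * (- (2 * a * z * exp (- a * z\<^sup>2)))"
      using MVT2[OF xy, of "\<lambda>x. exp (- a * x\<^sup>2)" "\<lambda>z. - (2 * a * z * exp (- a * z\<^sup>2))"] by blast
    have "2 * \<bar>z\<bar> \<le> 1 + z\<^sup>2" using sum_squares_bound[of 1 "\<bar>z\<bar>"] by simp
    then have "a * (2 * \<bar>z\<bar>) \<le> a * (1 + z\<^sup>2)" using a by (rule mult_left_mono)
    then have "a * (2 * \<bar>z\<bar>) * exp (- a * z\<^sup>2) \<le> a * (1 + z\<^sup>2) * exp (- a * z\<^sup>2)" by (rule mult_right_mono) simp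
    also have "\<dots> = a * exp (- a * z\<^sup>2) + (a * z\<^sup>2) * exp (- (a * z\<^sup>2))" by (simp add: algebra_simps)
    also have "\<dots> \<le> a * 1 + 1"
    proof (rule add_mono)
      show "a * exp (- a * z\<^sup>2) \<le> a * 1" using a by (intro mult_left_mono) auto
      have "a * z\<^sup>2 \<le> exp (a * z\<^sup>2)" using exp_ge_add_one_self[of "a * z\<^sup>2"] by linarith
      then show "(a * z\<^sup>2) * exp (- (a * z\<^sup>2)) \<le> 1" by (simp add: exp_minus divide_inverse[symmetric])
    qed
    finally have "\<bar>- (2 * a * z * exp (- a * z\<^sup>2))\<bar> \<le> a + 1" using a by (simp add: abs_mult)
    then show ?thesis unfolding z abs_mult using xy by (simp add: mult.commute mult_left_mono)
  qed
  show ?thesis using main[of x y] main[of y x] by (cases x y rule: linorder_cases) (auto simp: abs_minus_commute)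
qed

lemma clamp_gauss_lipschitz:
  assumes a: "0 \<le> a" and \<epsilon>: "0 < \<epsilon>"
  shows "\<bar>clamp_gauss a \<epsilon> x - clamp_gauss a \<epsilon> y\<bar> \<le> (1 / \<epsilon> + (a + 1)) * \<bar>x - y\<bar>"
proof -
  define c where "c x = max (- 1) (min 1 (x / \<epsilon>))" for x
  have c1: "\<bar>c x\<bar> \<le> 1" for x unfolding c_def by (auto simp: max_def min_def abs_le_iff)
  have cl: "\<bar>c x - c y\<bar> \<le> 1 / \<epsilon> * \<bar>x - y\<bar>"
  proof -
    have "\<bar>c x - c y\<bar> \<le> \<bar>x / \<epsilon> - y / \<epsilon>\<bar>" unfolding c_def by (auto simp: max_def min_def)
    also have "\<dots> = 1 / \<epsilon> * \<bar>x - y\<bar>" using \<epsilon> by (simp add: diff_divide_distrib[symmetric] abs_divide)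
    finally show ?thesis .
  qed
  have e1: "exp (- a * x\<^sup>2) \<le> 1" using a by simp
  have "clamp_gauss a \<epsilon> x - clamp_gauss a \<epsilon> y = (c x - c y) * exp (- a * x\<^sup>2) + c y * (exp (- a * x\<^sup>2) - exp (- a * y\<^sup>2))"
    unfolding clamp_gauss_def c_def by (simp add: algebra_simps)
  also have "\<bar>\<dots>\<bar> \<le> \<bar>(c x - c y) * exp (- a * x\<^sup>2)\<bar> + \<bar>c y * (exp (- a * x\<^sup>2) - exp (- a * y\<^sup>2))\<bar>"
    by (rule abs_triangle_ineq)
  also have "\<dots> \<le> (1 / \<epsilon> * \<bar>x - y\<bar>) * 1 + 1 * ((a + 1) * \<bar>x - y\<bar>)"
    unfolding abs_mult using cl c1[of y] e1 exp_square_lipschitz[OF a, of x y] \<epsilon>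
    by (intro add_mono mult_mono) auto
  finally show ?thesis by (simp add: algebra_simps)
qed

text \<open>The weight merges into the normal density after scaling by
  \<open>sqrt (1 + 2 * a)\<close>. One power of this comes from \<open>\<bar>y\<bar>\<close> and one
  from the change of variables, so no root remains.\<close>

lemma integral_abs_gaussian:
  assumes a: "0 \<le> a"
  shows "integrable lborel (\<lambda>y. \<bar>y\<bar> * exp (- a * y\<^sup>2) * std_normal_density y)"
    "(\<integral>y. \<bar>y\<bar> * exp (- a * y\<^sup>2) * std_normal_density y \<partial>lborel) = sqrt (2 / pi) / (1 + 2 * a)"
proof -
  define b where "b = sqrt (1 + 2 * a)"
  have b: "b > 0" "b * b = 1 + 2 * a" using a by (auto simp: b_def)
  have base: "integrable lborel (\<lambda>x. std_normal_density x * \<bar>x\<bar>)" "(\<integral>x. std_normal_density x * \<bar>x\<bar> \<partial>lborel) = sqrt (2 / pi)"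
    using integrable_std_normal_moment_abs[of 1] integral_std_normal_moment_abs_odd[of 0] by simp_all
  have sc: "std_normal_density (0 + b * y) * \<bar>0 + b * y\<bar> = b * (\<bar>y\<bar> * exp (- a * y\<^sup>2) * std_normal_density y)" for y
  proof -
    have "(b * y)\<^sup>2 = (1 + 2 * a) * y\<^sup>2" unfolding b(2)[symmetric] by (simp add: power2_eq_square)
    then have "- (b * y)\<^sup>2 / 2 = - a * y\<^sup>2 + - y\<^sup>2 / 2" by (simp add: field_simps)
    then have "exp (- (b * y)\<^sup>2 / 2) = exp (- a * y\<^sup>2) * exp (- y\<^sup>2 / 2)" by (simp only: exp_add)
    then show ?thesis using b(1) unfolding std_normal_density_def by (simp add: abs_mult)
  qed
  have "integrable lborel (\<lambda>y. b * (\<bar>y\<bar> * exp (- a * y\<^sup>2) * std_normal_density y))"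
    using lborel_integrable_real_affine[OF base(1), of b 0] b(1) unfolding sc by simp
  then show "integrable lborel (\<lambda>y. \<bar>y\<bar> * exp (- a * y\<^sup>2) * std_normal_density y)" using b(1) by simp
  have "sqrt (2 / pi) = \<bar>b\<bar> *\<^sub>R (\<integral>y. std_normal_density (0 + b * y) * \<bar>0 + b * y\<bar> \<partial>lborel)"
    unfolding base(2)[symmetric] by (rule lborel_integral_real_affine) (use b in simp)
  also have "\<dots> = (b * b) * (\<integral>y. \<bar>y\<bar> * exp (- a * y\<^sup>2) * std_normal_density y \<partial>lborel)"
    unfolding sc integral_mult_right_zero using b(1) by simp
  finally show "(\<integral>y. \<bar>y\<bar> * exp (- a * y\<^sup>2) * std_normal_density y \<partial>lborel) = sqrt (2 / pi) / (1 + 2 * a)"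
    unfolding b(2) using a by (simp add: field_simps)
qed

text \<open>The clamped sign times \<open>y\<close> equals \<open>\<bar>y\<bar>\<close> except for
  \<open>\<bar>y\<bar> < \<epsilon>\<close>, where the two differ by at most \<epsilon>.\<close>

lemma gauss_slope_clamp:
  assumes a: "0 \<le> a" and \<epsilon>: "0 < \<epsilon>"
  shows "\<bar>gauss_slope (clamp_gauss a \<epsilon>) - sqrt (2 / pi) / (1 + 2 * a)\<bar> \<le> \<epsilon>"
proof -
  define T where "T y = \<bar>y\<bar> * exp (- a * y\<^sup>2) * std_normal_density y" for y
  have iT: "integrable lborel T" unfolding T_def using integral_abs_gaussian(1)[OF a] .
  have i1: "integrable lborel (\<lambda>y. clamp_gauss a \<epsilon> y * (y * std_normal_density y))"
    by (rule integrable_bounded_mult[OF integrable_std_normal_first_moment _ clamp_gauss_bounded[OF a]]) measurable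
  have "gauss_slope (clamp_gauss a \<epsilon>) - sqrt (2 / pi) / (1 + 2 * a) = (\<integral>y. clamp_gauss a \<epsilon> y * (y * std_normal_density y) - T y \<partial>lborel)"
    unfolding gauss_slope_def Bochner_Integration.integral_diff[OF i1 iT] unfolding T_def integral_abs_gaussian(2)[OF a] ..
  then have "\<bar>gauss_slope (clamp_gauss a \<epsilon>) - sqrt (2 / pi) / (1 + 2 * a)\<bar> \<le> (\<integral>y. \<bar>clamp_gauss a \<epsilon> y * (y * std_normal_density y) - T y\<bar> \<partial>lborel)"
    using integral_abs_bound[of lborel "\<lambda>y. clamp_gauss a \<epsilon> y * (y * std_normal_density y) - T y"] by simp
  also have "\<dots> \<le> (\<integral>y. \<epsilon> * std_normal_density y \<partial>lborel)"
  proof (rule integral_mono)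
    show "integrable lborel (\<lambda>y. \<bar>clamp_gauss a \<epsilon> y * (y * std_normal_density y) - T y\<bar>)"
      by (intro integrable_abs Bochner_Integration.integrable_diff i1 iT)
    fix y
    define c where "c = max (- 1) (min 1 (y / \<epsilon>))"
    have c: "\<bar>c * y - \<bar>y\<bar>\<bar> \<le> \<epsilon>"
    proof (cases "\<bar>y\<bar> < \<epsilon>")
      case True
      have "0 \<le> c * y"
      proof (cases "0 \<le> y")
        case True
        then have "0 \<le> c" unfolding c_def using \<epsilon> by (simp add: le_max_iff_disj)
        then show ?thesis using True by simp
      next
        case False
        then have "y / \<epsilon> \<le> 0" using \<epsilon> by (simp add: divide_nonpos_pos)
        then have "c \<le> 0" unfolding c_def by (simp add: min_le_iff_disj)
        then show ?thesis using False by (simp add: mult_nonpos_nonpos)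
      qed
      moreover have "c * y \<le> \<bar>y\<bar>"
      proof -
        have "\<bar>c\<bar> \<le> 1" unfolding c_def by (auto simp: max_def min_def abs_le_iff)
        then have "\<bar>c * y\<bar> \<le> \<bar>y\<bar>" unfolding abs_mult by (simp add: mult_left_le_one_le)
        then show ?thesis by linarith
      qed
      ultimately show ?thesis using True by linarith
    next
      case False
      have c1: "max (- 1) (min 1 t) = 1" if "1 \<le> t" for t :: real using that by (auto simp: max_def min_def)
      have c2: "max (- 1) (min 1 t) = - 1" if "t \<le> - 1" for t :: real using that by (auto simp: max_def min_def)
      have "c * y = \<bar>y\<bar>"
      proof (cases "0 \<le> y")
        case True
        then have "1 \<le> y / \<epsilon>" using False \<epsilon> by (simp add: field_simps)
        then show ?thesis using True unfolding c_def by (simp add: c1)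
      next
        case neg: False
        then have "y / \<epsilon> \<le> - 1" using False \<epsilon> by (simp add: field_simps)
        then show ?thesis using neg unfolding c_def by (simp add: c2)
      qed
      then show ?thesis using \<epsilon> by simp
    qed
    have "clamp_gauss a \<epsilon> y * (y * std_normal_density y) - T y = (c * y - \<bar>y\<bar>) * (exp (- a * y\<^sup>2) * std_normal_density y)"
      unfolding clamp_gauss_def T_def c_def by (simp add: algebra_simps)
    then have "\<bar>clamp_gauss a \<epsilon> y * (y * std_normal_density y) - T y\<bar> = \<bar>c * y - \<bar>y\<bar>\<bar> * (exp (- a * y\<^sup>2) * std_normal_density y)"
      by (simp add: abs_mult)
    also have "\<dots> \<le> \<epsilon> * (1 * std_normal_density y)"
      using c a \<epsilon> by (intro mult_mono) auto
    finally show "\<bar>clamp_gauss a \<epsilon> y * (y * std_normal_density y) - T y\<bar> \<le> \<epsilon> * std_normal_density y" by simp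
  qed simp
  finally show ?thesis by simp
qed

section \<open>Gaussian functionals of the killed walk\<close>

context boundary_walk
begin

text \<open>A surviving walk ends above \<open>g n\<close>, hence above
  \<open>- \<epsilon> * sqrt n\<close>, so the even weight and its odd clamped version differ only
  on the ball whose mass \<open>small_ball\<close> controls.\<close>

lemma gaussian_weight_bound:
  assumes a: "0 \<le> a" and \<delta>: "\<delta> > 0"
  shows "\<forall>\<^sub>F n in sequentially. \<bar>sqrt (real n) * K n (\<lambda>x. exp (- a * (x / sqrt (real n))\<^sup>2)) - sqrt (2 / pi) / (1 + 2 * a) * L n\<bar> \<le> \<delta> * L n"
proof -
  obtain C where C: "C \<ge> 0" "\<And>\<epsilon>. \<epsilon> > 0 \<Longrightarrow> \<forall>\<^sub>F n in sequentially.
    sqrt (real n) * K n (\<lambda>x. indicator {- (\<epsilon> * sqrt (real n))..\<epsilon> * sqrt (real n)} x) \<le> C * \<epsilon> * L n"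
    using small_ball by blast
  \<comment> \<open>Solves \<open>2 * (C * \<epsilon>) + 2 * \<epsilon> = \<delta>\<close>: the two
    functions differ by at most 2 on the ball, and the limit for the clamped function and its slope
    cost one \<epsilon> each.\<close>
  define \<epsilon> where "\<epsilon> = \<delta> / (2 * C + 2)"
  have "\<epsilon> * (2 * C + 2) = \<delta>" using C(1) by (simp add: \<epsilon>_def)
  moreover have "\<epsilon> * (2 * C + 2) = 2 * (C * \<epsilon>) + 2 * \<epsilon>" by (simp add: algebra_simps)
  moreover have "\<epsilon> > 0" unfolding \<epsilon>_def using \<delta> C(1) by (intro divide_pos_pos) auto
  ultimately have \<epsilon>: "\<epsilon> > 0" "2 * (C * \<epsilon>) + 2 * \<epsilon> = \<delta>" by auto
  define S where "S = gauss_slope (clamp_gauss a \<epsilon>)"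
  define S0 where "S0 = sqrt (2 / pi) / (1 + 2 * a)"
  have S: "\<bar>S - S0\<bar> \<le> \<epsilon>" unfolding S_def S0_def by (rule gauss_slope_clamp[OF a \<epsilon>(1)])
  obtain N where N: "\<And>i. i \<ge> N \<Longrightarrow> \<bar>g i\<bar> \<le> \<epsilon> * sqrt (real i)" using g_bound[OF \<epsilon>(1)] by auto
  have lim: "\<forall>\<^sub>F n in sequentially. \<bar>sqrt (real n) * K n (\<lambda>x. clamp_gauss a \<epsilon> (x / sqrt (real n))) - S * L n\<bar> \<le> \<epsilon> * L n"
    unfolding S_def by (rule scaled_limit[OF clamp_gauss_measurable clamp_gauss_bounded[OF a] clamp_gauss_odd clamp_gauss_lipschitz[OF a \<epsilon>(1)] \<epsilon>(1)])
  show ?thesis using lim C(2)[OF \<epsilon>(1)] eventually_ge_at_top[of "max N 1"]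
  proof eventually_elim
    case (elim n)
    define s where "s = sqrt (real n)"
    have s: "s > 0" using elim(3) unfolding s_def by simp
    have n: "1 \<le> n" using elim(3) by simp
    have Ln: "0 < L n" by (rule L_pos[OF n])
    have e1: "exp (- a * x\<^sup>2) \<le> 1" for x using a by simp
    have "\<bar>K n (\<lambda>x. exp (- a * (x / s)\<^sup>2)) - K n (\<lambda>x. clamp_gauss a \<epsilon> (x / s))\<bar> \<le> K n (\<lambda>x. 2 * indicator {- (\<epsilon> * s)..\<epsilon> * s} x)"
    proof (rule K_diff_le[OF _ _ _ n])
      show "integrable M (\<lambda>\<omega>. exp (- a * (walk X n \<omega> / s)\<^sup>2))"
        by (rule integrable_bounded_walk[where B=1]) (use e1 in auto)
      show "integrable M (\<lambda>\<omega>. clamp_gauss a \<epsilon> (walk X n \<omega> / s))"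
        by (rule integrable_bounded_walk[where B=1]) (use clamp_gauss_bounded[OF a] in auto)
      show "integrable M (\<lambda>\<omega>. 2 * indicator {- (\<epsilon> * s)..\<epsilon> * s} (walk X n \<omega>) :: real)"
        by (rule integrable_bounded_walk[where B=2]) (auto simp: indicator_def)
      fix x assume x: "g n < x"
      have "- (\<epsilon> * s) \<le> g n" using N[of n] elim(3) unfolding s_def by (simp add: abs_le_iff)
      then have x1: "- (\<epsilon> * s) \<le> x" using x by simp
      show "\<bar>exp (- a * (x / s)\<^sup>2) - clamp_gauss a \<epsilon> (x / s)\<bar> \<le> 2 * indicator {- (\<epsilon> * s)..\<epsilon> * s} x"
      proof (cases "x \<le> \<epsilon> * s")
        case True
        then have "indicator {- (\<epsilon> * s)..\<epsilon> * s} x = (1 :: real)" using x1 by simp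
        moreover have "\<bar>exp (- a * (x / s)\<^sup>2)\<bar> \<le> 1" using e1[of "x / s"] by simp
        ultimately show ?thesis using clamp_gauss_bounded[OF a, of \<epsilon> "x / s"] by linarith
      next
        case False
        then have "1 \<le> x / s / \<epsilon>" using s \<epsilon> by (simp add: field_simps)
        then have "clamp_gauss a \<epsilon> (x / s) = exp (- a * (x / s)\<^sup>2)" unfolding clamp_gauss_def by simp
        then show ?thesis by simp
      qed
    qed
    also have "\<dots> = 2 * K n (\<lambda>x. indicator {- (\<epsilon> * s)..\<epsilon> * s} x)" by (rule K_cmult)
    finally have "s * \<bar>K n (\<lambda>x. exp (- a * (x / s)\<^sup>2)) - K n (\<lambda>x. clamp_gauss a \<epsilon> (x / s))\<bar> \<le> s * (2 * K n (\<lambda>x. indicator {- (\<epsilon> * s)..\<epsilon> * s} x))"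
      using s by (intro mult_left_mono) auto
    then have "\<bar>s * K n (\<lambda>x. exp (- a * (x / s)\<^sup>2)) - s * K n (\<lambda>x. clamp_gauss a \<epsilon> (x / s))\<bar> \<le> 2 * (s * K n (\<lambda>x. indicator {- (\<epsilon> * s)..\<epsilon> * s} x))"
      unfolding right_diff_distrib[symmetric] abs_mult abs_of_pos[OF s] by (simp only: mult.left_commute)
    moreover have "s * K n (\<lambda>x. indicator {- (\<epsilon> * s)..\<epsilon> * s} x) \<le> C * \<epsilon> * L n" using elim(2) unfolding s_def .
    moreover have "\<bar>s * K n (\<lambda>x. clamp_gauss a \<epsilon> (x / s)) - S * L n\<bar> \<le> \<epsilon> * L n" using elim(1) unfolding s_def .
    moreover have "\<bar>S * L n - S0 * L n\<bar> \<le> \<epsilon> * L n"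
      unfolding left_diff_distrib[symmetric] abs_mult using S Ln by (simp add: mult_right_mono)
    moreover have "2 * (C * \<epsilon> * L n) + \<epsilon> * L n + \<epsilon> * L n = \<delta> * L n" unfolding \<epsilon>(2)[symmetric] by (simp add: algebra_simps)
    ultimately have "\<bar>s * K n (\<lambda>x. exp (- a * (x / s)\<^sup>2)) - S0 * L n\<bar> \<le> \<delta> * L n" by linarith
    then show ?case unfolding s_def S0_def .
  qed
qed

lemma ratio_tendsto:
  assumes "\<And>\<delta>. \<delta> > 0 \<Longrightarrow> \<forall>\<^sub>F n in sequentially. \<bar>W n - S * L n\<bar> \<le> \<delta> * L n"
  shows "(\<lambda>n. W n / L n) \<longlonglongrightarrow> S"
proof (rule tendstoI)
  fix e :: real assume e: "e > 0"
  have h: "e / 2 > 0" using e by simp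
  show "\<forall>\<^sub>F n in sequentially. dist (W n / L n) S < e"
    using assms[OF h] eventually_ge_at_top[of 1]
  proof eventually_elim
    case (elim n)
    have Ln: "0 < L n" by (rule L_pos[OF elim(2)])
    have "W n / L n - S = (W n - S * L n) / L n" using Ln by (simp add: field_simps)
    then have "\<bar>W n / L n - S\<bar> = \<bar>W n - S * L n\<bar> / L n" using Ln by simp
    also have "\<dots> \<le> e / 2" using elim(1) Ln by (simp add: divide_le_eq)
    finally show ?case using e by (simp add: dist_real_def)
  qed
qed

text \<open>For \<open>a = 0\<close> the weights do not converge uniformly; as \<open>\<bar>exp (- u * y) - exp (- v * y)\<bar> \<le> \<bar>u - v\<bar> * y\<close>,
  the second moment bound controls the difference.\<close>

lemma gaussian_weight_limit:
  assumes k: "filterlim k at_top sequentially" and \<alpha>: "\<alpha> \<longlonglongrightarrow> a" and \<alpha>0: "\<forall>\<^sub>F n in sequentially. 0 \<le> \<alpha> n" and a: "0 \<le> a"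
  shows "(\<lambda>n. sqrt (real (k n)) * K (k n) (\<lambda>x. exp (- \<alpha> n * (x / sqrt (real (k n)))\<^sup>2)) / L (k n)) \<longlonglongrightarrow> sqrt (2 / pi) / (1 + 2 * a)"
proof -
  have "(\<lambda>n. sqrt (real n) * K n (\<lambda>x. exp (- a * (x / sqrt (real n))\<^sup>2)) / L n) \<longlonglongrightarrow> sqrt (2 / pi) / (1 + 2 * a)"
    by (rule ratio_tendsto[OF gaussian_weight_bound[OF a]])
  from filterlim_compose[OF this k]
  have l1: "(\<lambda>n. sqrt (real (k n)) * K (k n) (\<lambda>x. exp (- a * (x / sqrt (real (k n)))\<^sup>2)) / L (k n)) \<longlonglongrightarrow> sqrt (2 / pi) / (1 + 2 * a)" .
  obtain C N where C: "\<And>n. n \<ge> N \<Longrightarrow> K n (\<lambda>x. x\<^sup>2) \<le> C * (sqrt (real n) * L n)" using K_square_le by auto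
  have kN: "\<forall>\<^sub>F n in sequentially. max N 1 \<le> k n" using k unfolding filterlim_at_top by blast
  have "(\<lambda>n. sqrt (real (k n)) * K (k n) (\<lambda>x. exp (- \<alpha> n * (x / sqrt (real (k n)))\<^sup>2)) / L (k n)
     - sqrt (real (k n)) * K (k n) (\<lambda>x. exp (- a * (x / sqrt (real (k n)))\<^sup>2)) / L (k n)) \<longlonglongrightarrow> 0"
  proof (rule Lim_null_comparison)
    show "(\<lambda>n. \<bar>\<alpha> n - a\<bar> * C) \<longlonglongrightarrow> 0"
      using tendsto_mult_left_zero[OF tendsto_rabs_zero[OF LIM_zero[OF \<alpha>]], of C] .
    show "\<forall>\<^sub>F n in sequentially. norm (sqrt (real (k n)) * K (k n) (\<lambda>x. exp (- \<alpha> n * (x / sqrt (real (k n)))\<^sup>2)) / L (k n)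
     - sqrt (real (k n)) * K (k n) (\<lambda>x. exp (- a * (x / sqrt (real (k n)))\<^sup>2)) / L (k n)) \<le> \<bar>\<alpha> n - a\<bar> * C"
      using kN \<alpha>0
    proof eventually_elim
      case (elim n)
      define m where "m = k n"
      define s where "s = sqrt (real m)"
      have m: "1 \<le> m" "N \<le> m" using elim by (auto simp: m_def)
      have s: "s > 0" "s * s = real m" using m by (auto simp: s_def)
      have Lm: "0 < L m" by (rule L_pos[OF m(1)])
      have e1: "\<bar>exp (- b * x\<^sup>2)\<bar> \<le> 1" if "0 \<le> b" for b x :: real using that by simp
      have "\<bar>K m (\<lambda>x. exp (- \<alpha> n * (x / s)\<^sup>2)) - K m (\<lambda>x. exp (- a * (x / s)\<^sup>2))\<bar> \<le> K m (\<lambda>x. (\<bar>\<alpha> n - a\<bar> / real m) * x\<^sup>2)"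
      proof (rule K_diff_le[OF _ _ _ m(1)])
        show "integrable M (\<lambda>\<omega>. exp (- \<alpha> n * (walk X m \<omega> / s)\<^sup>2))"
          by (rule integrable_bounded_walk[where B=1]) (measurable, rule e1, fact elim(2))
        show "integrable M (\<lambda>\<omega>. exp (- a * (walk X m \<omega> / s)\<^sup>2))"
          by (rule integrable_bounded_walk[where B=1]) (measurable, rule e1, fact a)
        show "integrable M (\<lambda>\<omega>. \<bar>\<alpha> n - a\<bar> / real m * (walk X m \<omega>)\<^sup>2)"
          by (intro integrable_mult_right walk_second_moment(1))
        fix x
        define y where "y = (x / s)\<^sup>2"
        have y: "0 \<le> y" "y = x\<^sup>2 / real m" using s by (auto simp: y_def power_divide power2_eq_square)
        have ex: "\<bar>exp (- u) - exp (- v)\<bar> \<le> \<bar>u - v\<bar>" if "0 \<le> u" "0 \<le> v" for u v :: real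
        proof -
          have *: "exp (- u) - exp (- v) \<le> v - u" if "0 \<le> u" "u \<le> v" for u v :: real
          proof -
            have "exp (- u) - exp (- v) = exp (- u) * (1 - exp (- (v - u)))"
              unfolding right_diff_distrib exp_add[symmetric] by simp
            also have "\<dots> \<le> 1 * (v - u)"
              using that exp_ge_add_one_self[of "- (v - u)"] by (intro mult_mono) (auto simp del: minus_diff_eq)
            finally show ?thesis by simp
          qed
          show ?thesis
          proof (cases "u \<le> v")
            case True
            moreover have "exp (- v) \<le> exp (- u)" using True by simp
            ultimately show ?thesis using *[of u v] that by linarith
          next
            case False
            moreover have "exp (- u) \<le> exp (- v)" using False by simp
            ultimately show ?thesis using *[of v u] that by linarith
          qed
        qed
        have "\<bar>exp (- \<alpha> n * y) - exp (- a * y)\<bar> \<le> \<bar>\<alpha> n * y - a * y\<bar>"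
          using ex[of "\<alpha> n * y" "a * y"] elim(2) a y by simp
        also have "\<dots> = \<bar>\<alpha> n - a\<bar> / real m * x\<^sup>2" using y unfolding left_diff_distrib[symmetric] abs_mult by simp
        finally show "\<bar>exp (- \<alpha> n * (x / s)\<^sup>2) - exp (- a * (x / s)\<^sup>2)\<bar> \<le> \<bar>\<alpha> n - a\<bar> / real m * x\<^sup>2" unfolding y_def .
      qed
      also have "\<dots> = \<bar>\<alpha> n - a\<bar> / real m * K m (\<lambda>x. x\<^sup>2)" by (rule K_cmult)
      also have "\<dots> \<le> \<bar>\<alpha> n - a\<bar> / real m * (C * (s * L m))"
        using C[OF m(2)] unfolding s_def by (intro mult_left_mono) auto
      finally have "s * \<bar>K m (\<lambda>x. exp (- \<alpha> n * (x / s)\<^sup>2)) - K m (\<lambda>x. exp (- a * (x / s)\<^sup>2))\<bar> \<le> s * (\<bar>\<alpha> n - a\<bar> / real m * (C * (s * L m)))"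
        using s by (intro mult_left_mono) auto
      also have "\<dots> = (s * s) / real m * (\<bar>\<alpha> n - a\<bar> * C * L m)" by (simp add: mult_ac)
      also have "\<dots> = \<bar>\<alpha> n - a\<bar> * C * L m" unfolding s(2) using m by simp
      finally have "\<bar>s * K m (\<lambda>x. exp (- \<alpha> n * (x / s)\<^sup>2)) - s * K m (\<lambda>x. exp (- a * (x / s)\<^sup>2))\<bar> \<le> \<bar>\<alpha> n - a\<bar> * C * L m"
        unfolding right_diff_distrib[symmetric] abs_mult abs_of_pos[OF s(1)] .
      then have "\<bar>(s * K m (\<lambda>x. exp (- \<alpha> n * (x / s)\<^sup>2)) - s * K m (\<lambda>x. exp (- a * (x / s)\<^sup>2))) / L m\<bar> \<le> \<bar>\<alpha> n - a\<bar> * C"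
        using Lm by (simp add: abs_divide divide_le_eq)
      then show ?case unfolding m_def[symmetric] s_def[symmetric] real_norm_def diff_divide_distrib .
    qed
  qed
  from tendsto_add[OF this l1] show ?thesis by simp
qed

section \<open>Conditioning on the return to 0\<close>

lemma integral_killed_law:
  assumes k: "1 \<le> k" and F [measurable]: "F \<in> borel_measurable borel"
  shows "(LINT u:{g k<..}|killed_law M X g k. F u) = K k F"
proof -
  have w: "walk X k \<in> measurable (restrict_space M (alive k)) borel"
    by (rule measurable_restrict_space1) simp
  have "(LINT u:{g k<..}|killed_law M X g k. F u) =
      (\<integral>\<omega>. indicator {g k<..} (walk X k \<omega>) * F (walk X k \<omega>) \<partial>restrict_space M (alive k))"
    unfolding set_lebesgue_integral_def killed_law_def by (subst integral_distr[OF w]) auto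
  also have "\<dots> = (\<integral>\<omega>. indicator (alive k) \<omega> *\<^sub>R (indicator {g k<..} (walk X k \<omega>) * F (walk X k \<omega>)) \<partial>M)"
    by (rule integral_restrict_space) (simp add: alive_sets)
  also have "\<dots> = K k F"
    unfolding K_def
    by (rule Bochner_Integration.integral_cong) (use alive_above[OF k] in \<open>auto simp: indicator_def\<close>)
  finally show ?thesis .
qed

lemma llt_at:
  "\<forall>\<^sub>F N in sequentially. \<forall>u. \<bar>sqrt (real N) * walk_density f N u - std_normal_density (u / sqrt (real N))\<bar> \<le> llt_error N"
  using local_limit_theorem eventually_ge_at_top[of 1]
proof eventually_elim
  case (elim N)
  have "sqrt (real N) * (u / sqrt (real N)) = u" for u using elim(2) by simp
  then show ?case using elim(1) by metis
qed

text \<open>The Gaussian weight over the endpoint contributes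
  \<open>1 / (1 + 2 * a) = 1 - c\<close>, the limit of \<open>(n - k) / n\<close>. The quotient of
  the densities of \<open>S_(n-k)\<close> and \<open>S_n\<close> contributes
  \<open>sqrt (n / (n - k))\<close>, which leaves the square root of the claim.\<close>

theorem bridge_limit:
  assumes k: "filterlim k at_top sequentially" and nk: "filterlim (\<lambda>n. n - k n) at_top sequentially"
    and kn: "\<forall>\<^sub>F n in sequentially. 1 \<le> k n \<and> k n < n" and c: "(\<lambda>n. real (k n) / real n) \<longlonglongrightarrow> c" "c < 1"
  shows "(\<lambda>n. bridge_survival_prob M X f g n (k n) /
      (sqrt (2 / pi) * L (k n) * sqrt (real (n - k n) / real n)
        * real (k n) powr (- 1 / 2))) \<longlonglongrightarrow> 1"
proof -
  define N where "N n = n - k n" for n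
  define \<phi>0 where "\<phi>0 = std_normal_density 0"
  have \<phi>0: "\<phi>0 > 0" unfolding \<phi>0_def by (rule normal_density_pos) simp
  have N_inf: "filterlim N at_top sequentially" unfolding N_def using nk .
  have c0: "0 \<le> c" by (rule tendsto_lowerbound[OF c(1)]) (auto intro: always_eventually)
  have Nn: "(\<lambda>n. real (N n) / real n) \<longlonglongrightarrow> 1 - c"
  proof (rule Lim_transform_eventually)
    show "(\<lambda>n. 1 - real (k n) / real n) \<longlonglongrightarrow> 1 - c" by (intro tendsto_intros c)
    show "\<forall>\<^sub>F n in sequentially. 1 - real (k n) / real n = real (N n) / real n"
      using kn by eventually_elim (auto simp: N_def field_simps)
  qed
  \<comment> \<open>The exponent \<open>u^2 / (2 * (n - k))\<close> of the normal density, expressed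
    in the normalised variable \<open>u / sqrt k\<close>.\<close>
  define \<alpha> where "\<alpha> n = real (k n) / (2 * real (N n))" for n
  define a where "a = c / (2 * (1 - c))"
  have a: "0 \<le> a" "1 + 2 * a = 1 / (1 - c)" using c0 c(2) by (auto simp: a_def field_simps)
  have \<alpha>: "\<alpha> \<longlonglongrightarrow> a"
  proof (rule Lim_transform_eventually)
    show "(\<lambda>n. (real (k n) / real n) / (2 * (real (N n) / real n))) \<longlonglongrightarrow> a"
      unfolding a_def by (intro tendsto_intros c Nn) (use c(2) in auto)
    show "\<forall>\<^sub>F n in sequentially. (real (k n) / real n) / (2 * (real (N n) / real n)) = \<alpha> n"
      using kn by eventually_elim (auto simp: \<alpha>_def N_def)
  qed
  have \<alpha>0: "\<forall>\<^sub>F n in sequentially. 0 \<le> \<alpha> n" by (auto simp: \<alpha>_def)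
  define W where "W n = sqrt (real (k n)) * K (k n) (\<lambda>x. exp (- \<alpha> n * (x / sqrt (real (k n)))\<^sup>2)) / L (k n)" for n
  have "W \<longlonglongrightarrow> sqrt (2 / pi) / (1 + 2 * a)" unfolding W_def by (rule gaussian_weight_limit[OF k \<alpha> \<alpha>0 a(1)])
  then have W: "W \<longlonglongrightarrow> sqrt (2 / pi) * (1 - c)" unfolding a(2) by simp
  define P where "P n = sqrt (real (k n)) * (sqrt (real (N n)) * K (k n) (\<lambda>u. walk_density f (N n) (- u))) / L (k n)" for n
  obtain \<kappa> where \<kappa>: "\<kappa> \<ge> 0" "\<forall>\<^sub>F n in sequentially. sqrt (real n) * q n \<le> \<kappa> * L n" using q_le_L by auto
  have \<kappa>k: "\<forall>\<^sub>F n in sequentially. sqrt (real (k n)) * q (k n) \<le> \<kappa> * L (k n)"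
    by (rule eventually_compose_filterlim[OF \<kappa>(2) k])
  \<comment> \<open>The error of the local limit theorem is uniform in the endpoint, so it enters
    multiplied by \<open>q (k n)\<close>; since \<open>sqrt k * q k\<close> is
    O(\<open>L k\<close>), it is negligible on the scale of \<open>W\<close>.\<close>
  have PW: "(\<lambda>n. P n - \<phi>0 * W n) \<longlonglongrightarrow> 0"
  proof (rule Lim_null_comparison)
    show "(\<lambda>n. \<kappa> * llt_error (N n)) \<longlonglongrightarrow> 0"
      using tendsto_mult_right_zero[OF filterlim_compose[OF llt_error_tendsto N_inf], of \<kappa>] .
    show "\<forall>\<^sub>F n in sequentially. norm (P n - \<phi>0 * W n) \<le> \<kappa> * llt_error (N n)"
      using eventually_compose_filterlim[OF llt_at N_inf] \<kappa>k kn
    proof eventually_elim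
      case (elim n)
      define m where "m = k n"
      define s where "s = sqrt (real m)"
      define t where "t = sqrt (real (N n))"
      have m: "1 \<le> m" "1 \<le> N n" using elim(3) by (auto simp: m_def N_def)
      have s: "s > 0" "t > 0" using m by (auto simp: s_def t_def)
      have Lm: "0 < L m" by (rule L_pos[OF m(1)])
      have phi: "std_normal_density (- u / t) = \<phi>0 * exp (- \<alpha> n * (u / s)\<^sup>2)" for u
      proof -
        have "- (- u / t)\<^sup>2 / 2 = - \<alpha> n * (u / s)\<^sup>2"
          using s m unfolding \<alpha>_def m_def[symmetric] by (simp add: power_divide s_def t_def)
        then show ?thesis unfolding \<phi>0_def std_normal_density_def by simp
      qed
      have bd: "\<bar>t * walk_density f (N n) (- u) - \<phi>0 * exp (- \<alpha> n * (u / s)\<^sup>2)\<bar> \<le> llt_error (N n)" for u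
        using elim(1)[rule_format, of "- u"] unfolding t_def[symmetric] phi .
      have eb: "\<bar>\<phi>0 * exp (- \<alpha> n * (u / s)\<^sup>2)\<bar> \<le> \<phi>0" for u
        using \<phi>0 by (simp add: abs_mult \<alpha>_def)
      have ie: "integrable M (\<lambda>\<omega>. \<phi>0 * exp (- \<alpha> n * (walk X m \<omega> / s)\<^sup>2))"
        by (rule integrable_bounded_walk[OF _ eb]) measurable
      have it: "integrable M (\<lambda>\<omega>. t * walk_density f (N n) (- walk X m \<omega>))"
      proof (rule integrable_bounded_walk[where B="\<phi>0 + llt_error (N n)"])
        show "\<bar>t * walk_density f (N n) (- x)\<bar> \<le> \<phi>0 + llt_error (N n)" for x
          using bd[of x] eb[of x] by linarith
      qed measurable
      have "\<bar>K m (\<lambda>u. t * walk_density f (N n) (- u)) - K m (\<lambda>u. \<phi>0 * exp (- \<alpha> n * (u / s)\<^sup>2))\<bar> \<le> K m (\<lambda>_. llt_error (N n))"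
        by (rule K_diff_le[OF it ie _ m(1) bd]) simp
      then have d1: "\<bar>t * K m (\<lambda>u. walk_density f (N n) (- u)) - \<phi>0 * K m (\<lambda>u. exp (- \<alpha> n * (u / s)\<^sup>2))\<bar> \<le> llt_error (N n) * q m"
        unfolding K_cmult K_const .
      have "P n - \<phi>0 * W n = s * (t * K m (\<lambda>u. walk_density f (N n) (- u)) - \<phi>0 * K m (\<lambda>u. exp (- \<alpha> n * (u / s)\<^sup>2))) / L m"
        unfolding P_def W_def m_def[symmetric] s_def[symmetric] t_def[symmetric]
        by (simp only: right_diff_distrib diff_divide_distrib times_divide_eq_right mult.left_commute)
      then have "\<bar>P n - \<phi>0 * W n\<bar> = s * \<bar>t * K m (\<lambda>u. walk_density f (N n) (- u)) - \<phi>0 * K m (\<lambda>u. exp (- \<alpha> n * (u / s)\<^sup>2))\<bar> / L m"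
        using s Lm by (simp only: abs_divide abs_mult abs_of_pos)
      also have "\<dots> \<le> s * (llt_error (N n) * q m) / L m"
        using d1 s Lm by (intro divide_right_mono mult_left_mono) auto
      also have "\<dots> = llt_error (N n) * (s * q m) / L m" by (simp only: mult.left_commute)
      also have "\<dots> \<le> llt_error (N n) * (\<kappa> * L m) / L m"
        using elim(2) Lm llt_error_nonneg unfolding m_def s_def by (intro divide_right_mono mult_left_mono) auto
      also have "\<dots> = \<kappa> * llt_error (N n)" using Lm by simp
      finally show ?case by simp
    qed
  qed
  have "(\<lambda>n. (P n - \<phi>0 * W n) + \<phi>0 * W n) \<longlonglongrightarrow> 0 + \<phi>0 * (sqrt (2 / pi) * (1 - c))"
    by (intro tendsto_intros PW W)
  then have P: "P \<longlonglongrightarrow> \<phi>0 * (sqrt (2 / pi) * (1 - c))" by simp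
  have Q: "(\<lambda>n. sqrt (real n) * walk_density f n 0) \<longlonglongrightarrow> \<phi>0"
  proof -
    have "(\<lambda>n. sqrt (real n) * walk_density f n 0 - \<phi>0) \<longlonglongrightarrow> 0"
    proof (rule Lim_null_comparison[OF _ llt_error_tendsto])
      show "\<forall>\<^sub>F n in sequentially. norm (sqrt (real n) * walk_density f n 0 - \<phi>0) \<le> llt_error n"
        using llt_at
      proof eventually_elim
        case (elim n)
        then show ?case using elim[rule_format, of 0] by (simp add: \<phi>0_def)
      qed
    qed
    then show ?thesis by (rule LIM_zero_cancel)
  qed
  have "(\<lambda>n. P n / (sqrt (2 / pi) * (sqrt (real n) * walk_density f n 0) * (real (N n) / real n))) \<longlonglongrightarrow>
      \<phi>0 * (sqrt (2 / pi) * (1 - c)) / (sqrt (2 / pi) * \<phi>0 * (1 - c))"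
    by (intro tendsto_intros P Q Nn) (use \<phi>0 c(2) in auto)
  also have "\<phi>0 * (sqrt (2 / pi) * (1 - c)) / (sqrt (2 / pi) * \<phi>0 * (1 - c)) = 1"
    using \<phi>0 c(2) by simp
  finally show ?thesis
  proof (rule Lim_transform_eventually)
    show "\<forall>\<^sub>F n in sequentially. P n / (sqrt (2 / pi) * (sqrt (real n) * walk_density f n 0) * (real (N n) / real n)) =
      bridge_survival_prob M X f g n (k n) /
      (sqrt (2 / pi) * L (k n) * sqrt (real (n - k n) / real n) * real (k n) powr (- 1 / 2))"
      using kn
    proof eventually_elim
      case (elim n)
      define m where "m = k n"
      define T where "T = K m (\<lambda>u. walk_density f (N n) (- u))"
      define s where "s = sqrt (real m)"
      define t where "t = sqrt (real (N n))"
      define r where "r = sqrt (real n)"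
      define w where "w = walk_density f n 0"
      have m: "1 \<le> m" "1 \<le> N n" "1 \<le> n" using elim by (auto simp: m_def N_def)
      have pos: "s > 0" "t > 0" "r > 0" using m by (auto simp: s_def t_def r_def)
      have Lm: "0 < L m" by (rule L_pos[OF m(1)])
      have sq: "real (N n) = t * t" "real n = r * r" by (auto simp: t_def r_def)
      have br: "bridge_survival_prob M X f g n m = 1 / w * T"
        unfolding bridge_survival_prob_def T_def w_def N_def m_def[symmetric]
        by (subst integral_killed_law[OF m(1)]) auto
      have pw: "real m powr (- 1 / 2) = 1 / s"
        using m by (simp add: powr_minus_divide powr_half_sqrt s_def)
      have rt: "sqrt (real (n - m) / real n) = t / r"
        by (simp add: real_sqrt_divide t_def r_def N_def m_def)
      show ?case
        unfolding P_def m_def[symmetric] T_def[symmetric] s_def[symmetric] t_def[symmetric] r_def[symmetric] w_def[symmetric] br pw rt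
        unfolding sq
        using pos Lm by (simp add: field_simps)
    qed
  qed
qed

end

theorem theorem1:
  fixes M :: "'a measure" and X :: "nat \<Rightarrow> 'a \<Rightarrow> real" and f :: "real \<Rightarrow> real"
    and g :: "nat \<Rightarrow> real" and k :: "nat \<Rightarrow> nat" and c :: real
  assumes "prob_space M"
    and "prob_space.indep_vars M (\<lambda>_. borel) X {1..}"
    and "\<And>t. 0 \<le> f t"
    and "\<And>i. 1 \<le> i \<Longrightarrow> distributed M lborel (X i) (\<lambda>t. ennreal (f t))"
    and "\<And>i. 1 \<le> i \<Longrightarrow> integrable M (X i) \<and> (\<integral>\<omega>. X i \<omega> \<partial>M) = 0"
    and "\<And>i. 1 \<le> i \<Longrightarrow>
      integrable M (\<lambda>\<omega>. (X i \<omega>)\<^sup>2) \<and> (\<integral>\<omega>. (X i \<omega>)\<^sup>2 \<partial>M) = 1"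
    and "\<exists>n\<^sub>0\<ge>1. \<exists>C. AE t in lborel. walk_density f n\<^sub>0 t \<le> C"
    and "g \<in> o(\<lambda>i. sqrt (real i))"
    and "\<And>n. 1 \<le> n \<Longrightarrow> 0 < measure M (survival_event M X g n)"
    and "\<forall>\<^sub>F n in sequentially. 1 \<le> k n \<and> k n < n"
    and "filterlim k at_top sequentially"
    and "filterlim (\<lambda>n. n - k n) at_top sequentially"
    and "(\<lambda>n. real (k n) / real n) \<longlonglongrightarrow> c" and "c < 1"
  shows "(\<lambda>n. bridge_survival_prob M X f g n (k n) /
      (sqrt (2 / pi) * L_fun M X g (k n) * sqrt (real (n - k n) / real n)
        * real (k n) powr (- 1 / 2))) \<longlonglongrightarrow> 1"
proof -
  obtain n\<^sub>0 C\<^sub>0 where "1 \<le> n\<^sub>0" "AE t in lborel. walk_density f n\<^sub>0 t \<le> C\<^sub>0"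
    using assms(7) by blast
  then interpret boundary_walk M X f n\<^sub>0 C\<^sub>0 g
    using assms(1-6,8,9) by (intro boundary_walk.intro bounded_density_walk.intro
      bounded_density_walk_axioms.intro boundary_walk_axioms.intro) auto
  show ?thesis
    using bridge_limit[OF assms(11,12,10,13,14)] .
qed

end
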